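(* Let $n\ge 2$, let $(M^n,g)$ be an $n$-dimensional compact oriented conformally flat Riemannian manifold with boundary, and let $\boldsymbol{p}:M^n\to\Lambda^{n+1}$ be an isometric immersion. Let $F:(-\varepsilon,\varepsilon)\times M^n\to\mathbb{R}^{n+2}_1$ be a characteristic variation of $\boldsymbol{p}$ with fixed boundary, with variational vector field $X$. If the scalar curvature of $(M^n,g)$ is identically zero, then the second variation of the volume is given by \[\left.\frac{d^2}{dt^2}\right|_{t=0}\mathrm{Vol}(t)=-\int_{M^n}\langle X,\boldsymbol{p}\rangle^2\,\mathrm{tr}(A^2)\,dV_0\le 0,\] where $A$ is the shape operator of $\boldsymbol{p}$.
   Context: $\mathbb{R}^{n+2}_1$ is the Minkowski spacetime of signature $(-,+,\dots,+)$ with Lorentzian inner product $\langle\cdot,\cdot\rangle$ and Levi-Civita (flat) connection $\overline{\nabla}$, and $\Lambda^{n+1}=\{\boldsymbol{x}\in\mathbb{R}^{n+2}_1 : \langle \boldsymbol{x},\boldsymbol{x}\rangle=0\}$ is the light-cone. An isometric immersion $\boldsymbol{p}:M^n\to\Lambda^{n+1}$ is a smooth immersion $\boldsymbol{p}:M^n\to\mathbb{R}^{n+2}_1$ with image in $\Lambda^{n+1}$ such that $\boldsymbol{p}^*\langle\cdot,\cdot\rangle=g$. Tangent vectors of $M^n$ are identified with vectors of $\mathbb{R}^{n+2}_1$ via $d\boldsymbol{p}$. Dual map: there is a unique smooth map $\boldsymbol{q}:M^n\to\Lambda^{n+1}$ with $\langle\boldsymbol{p},\boldsymbol{q}\rangle=1$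 and $\langle d\boldsymbol{p}(Y),\boldsymbol{q}\rangle=0$ for all tangent vector fields $Y$ on $M^n$; it is called the dual map of $\boldsymbol{p}$. Shape operator: with $\mathrm{II}(Y,Z)=(\overline{\nabla}_YZ)^\perp$ the second fundamental form of $\boldsymbol{p}$ in $\mathbb{R}^{n+2}_1$ ($\perp$ = projection to the normal bundle), $A$ is the endomorphism of $TM^n$ defined by $\langle AY,Z\rangle=\langle \mathrm{II}(Y,Z),\boldsymbol{q}\rangle$. Variations: a variation of $\boldsymbol{p}$ is a smooth map $F:(-\varepsilon,\varepsilon)\times M^n\to\mathbb{R}^{n+2}_1$ ($\varepsilon>0$) such that $F(0,x)=\boldsymbol{p}(x)$ and each $F(t,\cdot)$ is a spacelike immersion (the induced metric $g_t$ is Riemannian). It has fixed boundary if $F(t,x)=\boldsymbol{p}(x)$ for all $t$ and all $x\in\partial M^n$. $dV_t$ is the volume form of $(M^n,g_t)$ and $\mathrm{Vol}(t)=\int_{M^n}dV_t$. The extended variational vector field is $\overline{X}=\partial F/\partial t$, the variational vector field is $X=\frac{\partial}{\partial t}\big|_{t=0}F$, and $(\overline{\nabla}_t\overline{X})_x=\frac{\partial^2}{\partial t^2}\big|_{t=0}F(t,x)$. The variation $F$ is admissible if there is a real-valued function $\varphi$ on $M^n$ with $X=\varphi\,\boldsymbol{q}$. An admissible variation $F$ is characteristic if there is moreover a real-valued function $\psi$ on $M^n$ with $\overline{\nabla}_t\overline{X}=\psi\,\boldsymbol{q}$. *)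

theory Defs
  imports "HOL-Analysis.Analysis"
begin

section \<open>Smooth maps on subsets of Euclidean spaces\<close>

primrec Ck_on_open :: "nat \<Rightarrow> ('a::euclidean_space \<Rightarrow> 'b::real_normed_vector) \<Rightarrow> 'a set \<Rightarrow> bool" where
  "Ck_on_open 0 f U \<longleftrightarrow> continuous_on U f"
| "Ck_on_open (Suc k) f U \<longleftrightarrow>
     (\<forall>x\<in>U. f differentiable (at x)) \<and>
     (\<forall>v. Ck_on_open k (\<lambda>x. frechet_derivative f (at x) v) U)"

text \<open>On a set that need not be open (here: a relatively open subset of a half-space, possibly
  times an interval), smooth means: locally the restriction of a smooth map defined on an open
  subset of the ambient space.\<close>

definition smooth_on :: "'a::euclidean_space set \<Rightarrow> ('a \<Rightarrow> 'b::real_normed_vector) \<Rightarrow> bool" where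
  "smooth_on S f \<longleftrightarrow>
     (\<forall>x\<in>S. \<exists>U f'. open U \<and> x \<in> U \<and> (\<forall>k. Ck_on_open k f' U) \<and> (\<forall>y\<in>S \<inter> U. f' y = f y))"

section \<open>Oriented smooth manifolds with boundary\<close>

text \<open>A chart is a pair of its domain and its coordinate map (only the values on the domain
  matter). The dimension of the manifold is \<open>CARD('n)\<close>. As \<open>'n\<close> carries no order, an arbitrary
  coordinate \<open>k\<close> plays the role of the last one in the definition of the model half-space.\<close>

type_synonym ('a, 'n) chart = "'a set \<times> ('a \<Rightarrow> real ^ 'n)"

definition half_space :: "'n::finite \<Rightarrow> (real ^ 'n) set" where
  "half_space k = {u. 0 \<le> u $ k}"

definition chart_image :: "('a, 'n::finite) chart \<Rightarrow> (real ^ 'n) set" where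
  "chart_image c = snd c ` fst c"

definition chart_inv :: "('a, 'n::finite) chart \<Rightarrow> real ^ 'n \<Rightarrow> 'a" where
  "chart_inv c = inv_into (fst c) (snd c)"

definition is_chart :: "'a topology \<Rightarrow> 'n::finite \<Rightarrow> ('a, 'n) chart \<Rightarrow> bool" where
  "is_chart M k c \<longleftrightarrow>
     openin M (fst c) \<and>
     openin (top_of_set (half_space k)) (chart_image c) \<and>
     homeomorphic_map (subtopology M (fst c)) (top_of_set (chart_image c)) (snd c)"

definition overlap :: "('a, 'n::finite) chart \<Rightarrow> ('a, 'n) chart \<Rightarrow> (real ^ 'n) set" where
  "overlap c d = snd c ` (fst c \<inter> fst d)"

definition transition :: "('a, 'n::finite) chart \<Rightarrow> ('a, 'n) chart \<Rightarrow> real ^ 'n \<Rightarrow> real ^ 'n" where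
  "transition c d = snd d \<circ> chart_inv c"

text \<open>Derivatives are taken within relatively open subsets of the half-space; there the
  derivative of a differentiable map is unique, also at boundary points.\<close>

definition jacobian_within :: "(real ^ 'n) set \<Rightarrow> (real ^ 'n \<Rightarrow> real ^ 'n) \<Rightarrow> real ^ 'n \<Rightarrow> real ^ 'n ^ 'n::finite" where
  "jacobian_within S f u = matrix (frechet_derivative f (at u within S))"

definition oriented_atlas :: "'a topology \<Rightarrow> 'n::finite \<Rightarrow> ('a, 'n) chart set \<Rightarrow> bool" where
  "oriented_atlas M k \<A> \<longleftrightarrow>
     (\<forall>c\<in>\<A>. is_chart M k c) \<and>
     (\<Union>c\<in>\<A>. fst c) = topspace M \<and>
     (\<forall>c\<in>\<A>. \<forall>d\<in>\<A>. smooth_on (overlap c d) (transition c d) \<and>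
        (\<forall>u\<in>overlap c d. 0 < det (jacobian_within (overlap c d) (transition c d) u)))"

text \<open>The boundary may be empty. In dimension at least two, every oriented manifold with boundary
  has an oriented atlas of charts into one and the same half-space.\<close>

definition oriented_manifold_with_boundary :: "'a topology \<Rightarrow> 'n::finite \<Rightarrow> ('a, 'n) chart set \<Rightarrow> bool" where
  "oriented_manifold_with_boundary M k \<A> \<longleftrightarrow>
     Hausdorff_space M \<and> second_countable M \<and> oriented_atlas M k \<A>"

definition manifold_boundary :: "'n::finite \<Rightarrow> ('a, 'n) chart set \<Rightarrow> 'a set" where
  "manifold_boundary k \<A> = {x. \<exists>c\<in>\<A>. x \<in> fst c \<and> snd c x $ k = 0}"

definition smooth_map :: "('a, 'n::finite) chart set \<Rightarrow> ('a \<Rightarrow> 'b::real_normed_vector) \<Rightarrow> bool" where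
  "smooth_map \<A> f \<longleftrightarrow> (\<forall>c\<in>\<A>. smooth_on (chart_image c) (f \<circ> chart_inv c))"

text \<open>The differential of \<open>f\<close> at the point with coordinates \<open>u\<close>, applied to the tangent vector with
  components \<open>v\<close> in the chart \<open>c\<close>.\<close>

definition differential :: "('a, 'n::finite) chart \<Rightarrow> ('a \<Rightarrow> 'b::real_normed_vector) \<Rightarrow> real ^ 'n \<Rightarrow> real ^ 'n \<Rightarrow> 'b" where
  "differential c f u v = frechet_derivative (f \<circ> chart_inv c) (at u within chart_image c) v"

section \<open>Integration of top-degree forms\<close>

text \<open>Tensor fields are given by their components: to every chart belongs a function of the
  coordinates. In particular an \<open>n\<close>-form \<open>\<omega>\<^sub>c du\<^sub>1 \<and> \<dots> \<and> du\<^sub>n\<close> is given by the coefficients \<open>\<omega>\<^sub>c\<close>.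
  Its integral over an oriented compact manifold does not depend on the partition of
  unity chosen below, which need only be continuous.\<close>

definition partition_of_unity ::
  "'a topology \<Rightarrow> ('a, 'n::finite) chart set \<Rightarrow> ('a, 'n) chart set \<Rightarrow> (('a, 'n) chart \<Rightarrow> 'a \<Rightarrow> real) \<Rightarrow> bool" where
  "partition_of_unity M \<A> C \<rho> \<longleftrightarrow>
     finite C \<and> C \<subseteq> \<A> \<and>
     (\<forall>c\<in>C. continuous_map M euclideanreal (\<rho> c) \<and>
        (\<forall>x\<in>topspace M. 0 \<le> \<rho> c x) \<and>
        M closure_of {x \<in> topspace M. \<rho> c x \<noteq> 0} \<subseteq> fst c) \<and>
     (\<forall>x\<in>topspace M. (\<Sum>c\<in>C. \<rho> c x) = 1)"

definition integral_form ::
  "'a topology \<Rightarrow> ('a, 'n::finite) chart set \<Rightarrow> (('a, 'n) chart \<Rightarrow> real ^ 'n \<Rightarrow> real) \<Rightarrow> real" where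
  "integral_form M \<A> \<omega> =
     (case (SOME (C, \<rho>). partition_of_unity M \<A> C \<rho>) of (C, \<rho>) \<Rightarrow>
        (\<Sum>c\<in>C. LINT u:chart_image c|lborel. \<rho> c (chart_inv c u) * \<omega> c u))"

section \<open>Riemannian metrics\<close>

type_synonym ('a, 'n) metric_components = "('a, 'n) chart \<Rightarrow> real ^ 'n \<Rightarrow> real ^ 'n ^ 'n"

definition riemannian_metric :: "('a, 'n::finite) chart set \<Rightarrow> ('a, 'n) metric_components \<Rightarrow> bool" where
  "riemannian_metric \<A> g \<longleftrightarrow>
     (\<forall>c\<in>\<A>. smooth_on (chart_image c) (g c) \<and>
        (\<forall>u\<in>chart_image c. transpose (g c u) = g c u \<and> (\<forall>v. v \<noteq> 0 \<longrightarrow> 0 < v \<bullet> (g c u *v v)))) \<and>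
     (\<forall>c\<in>\<A>. \<forall>d\<in>\<A>. \<forall>u\<in>overlap c d.
        let J = jacobian_within (overlap c d) (transition c d) u
        in g c u = transpose J ** g d (transition c d u) ** J)"

definition volume_form :: "('a, 'n::finite) metric_components \<Rightarrow> ('a, 'n) chart \<Rightarrow> real ^ 'n \<Rightarrow> real" where
  "volume_form g c u = sqrt (det (g c u))"

text \<open>Every point has a neighbourhood \<open>W\<close> on which \<open>e\<^sup>2\<^sup>f g\<close> is the pullback of the Euclidean metric
  by a diffeomorphism \<open>\<Phi>\<close> onto a subset of \<open>\<real>\<^sup>n\<close>. At boundary points \<open>\<Phi>\<close> is not required
  to map the boundary into a hyperplane, which would be a condition on the boundary.\<close>

definition conformally_flat :: "('a, 'n::finite) chart set \<Rightarrow> ('a, 'n) metric_components \<Rightarrow> bool" where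
  "conformally_flat \<A> g \<longleftrightarrow>
     (\<forall>c\<in>\<A>. \<forall>u\<in>chart_image c. \<exists>W \<Phi> (f :: real ^ 'n \<Rightarrow> real).
        u \<in> W \<and> openin (top_of_set (chart_image c)) W \<and>
        smooth_on W f \<and> smooth_on W \<Phi> \<and> inj_on \<Phi> W \<and>
        (\<forall>w\<in>W. exp (2 * f w) *\<^sub>R g c w = transpose (jacobian_within W \<Phi> w) ** jacobian_within W \<Phi> w))"

definition partial :: "(real ^ 'n) set \<Rightarrow> 'n::finite \<Rightarrow> (real ^ 'n \<Rightarrow> real) \<Rightarrow> real ^ 'n \<Rightarrow> real" where
  "partial S i f u = frechet_derivative f (at u within S) (axis i 1)"

definition christoffel ::
  "(real ^ 'n) set \<Rightarrow> (real ^ 'n \<Rightarrow> real ^ 'n ^ 'n) \<Rightarrow> 'n::finite \<Rightarrow> 'n \<Rightarrow> 'n \<Rightarrow> real ^ 'n \<Rightarrow> real" where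
  "christoffel S G l i j u =
     (1 / 2) * (\<Sum>m\<in>UNIV. matrix_inv (G u) $ l $ m *
       (partial S i (\<lambda>w. G w $ j $ m) u + partial S j (\<lambda>w. G w $ i $ m) u
        - partial S m (\<lambda>w. G w $ i $ j) u))"

definition ricci ::
  "(real ^ 'n) set \<Rightarrow> (real ^ 'n \<Rightarrow> real ^ 'n ^ 'n) \<Rightarrow> 'n::finite \<Rightarrow> 'n \<Rightarrow> real ^ 'n \<Rightarrow> real" where
  "ricci S G i j u =
     (\<Sum>l\<in>UNIV. partial S l (christoffel S G l i j) u - partial S j (christoffel S G l i l) u
       + (\<Sum>m\<in>UNIV. christoffel S G l l m u * christoffel S G m i j u
                    - christoffel S G l j m u * christoffel S G m i l u))"

definition scalar_curvature :: "('a, 'n::finite) metric_components \<Rightarrow> ('a, 'n) chart \<Rightarrow> real ^ 'n \<Rightarrow> real" where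
  "scalar_curvature g c u =
     (\<Sum>i\<in>UNIV. \<Sum>j\<in>UNIV. matrix_inv (g c u) $ i $ j * ricci (chart_image c) (g c) i j u)"

section \<open>Minkowski spacetime and the light-cone\<close>

text \<open>The first factor is the time axis; for \<open>CARD('s) = n + 1\<close> this is \<open>\<real>\<^sup>n\<^sup>+\<^sup>2\<^sub>1\<close>.\<close>

type_synonym 's minkowski = "real \<times> (real ^ 's)"

definition lorentz :: "'s::finite minkowski \<Rightarrow> 's minkowski \<Rightarrow> real" where
  "lorentz x y = - (fst x * fst y) + snd x \<bullet> snd y"

definition light_cone :: "'s::finite minkowski set" where
  "light_cone = {x. lorentz x x = 0}"

definition induced_metric :: "('a \<Rightarrow> 's::finite minkowski) \<Rightarrow> ('a, 'n::finite) metric_components" where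
  "induced_metric f c u =
     (\<chi> i j. lorentz (differential c f u (axis i 1)) (differential c f u (axis j 1)))"

definition immersion :: "('a, 'n::finite) chart set \<Rightarrow> ('a \<Rightarrow> 's::finite minkowski) \<Rightarrow> bool" where
  "immersion \<A> f \<longleftrightarrow>
     smooth_map \<A> f \<and> (\<forall>c\<in>\<A>. \<forall>u\<in>chart_image c. inj (differential c f u))"

definition spacelike_immersion :: "('a, 'n::finite) chart set \<Rightarrow> ('a \<Rightarrow> 's::finite minkowski) \<Rightarrow> bool" where
  "spacelike_immersion \<A> f \<longleftrightarrow>
     immersion \<A> f \<and>
     (\<forall>c\<in>\<A>. \<forall>u\<in>chart_image c. \<forall>v. v \<noteq> 0 \<longrightarrow>
        0 < lorentz (differential c f u v) (differential c f u v))"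

definition isometric_immersion_light_cone ::
  "'a topology \<Rightarrow> ('a, 'n::finite) chart set \<Rightarrow> ('a, 'n) metric_components \<Rightarrow> ('a \<Rightarrow> 's::finite minkowski) \<Rightarrow> bool" where
  "isometric_immersion_light_cone M \<A> g p \<longleftrightarrow>
     immersion \<A> p \<and> p ` topspace M \<subseteq> light_cone \<and>
     (\<forall>c\<in>\<A>. \<forall>u\<in>chart_image c. induced_metric p c u = g c u)"

definition dual_map ::
  "'a topology \<Rightarrow> ('a, 'n::finite) chart set \<Rightarrow> ('a \<Rightarrow> 's::finite minkowski) \<Rightarrow> ('a \<Rightarrow> 's minkowski) \<Rightarrow> bool" where
  "dual_map M \<A> p q \<longleftrightarrow>
     smooth_map \<A> q \<and> q ` topspace M \<subseteq> light_cone \<and>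
     (\<forall>x\<in>topspace M. lorentz (p x) (q x) = 1) \<and>
     (\<forall>c\<in>\<A>. \<forall>u\<in>chart_image c. \<forall>v. lorentz (differential c p u v) (q (chart_inv c u)) = 0)"

definition normal_part :: "'s::finite minkowski set \<Rightarrow> 's minkowski \<Rightarrow> 's minkowski" where
  "normal_part T w = (THE \<nu>. (\<forall>z\<in>T. lorentz \<nu> z = 0) \<and> w - \<nu> \<in> T)"

text \<open>\<open>Y\<close> and \<open>Z\<close> are the components of vector fields in the chart \<open>c\<close>; the flat connection
  differentiates \<open>dp(Z)\<close> in the direction of \<open>Y\<close>.\<close>

definition second_fundamental_form ::
  "('a, 'n::finite) chart \<Rightarrow> ('a \<Rightarrow> 's::finite minkowski) \<Rightarrow> (real ^ 'n \<Rightarrow> real ^ 'n) \<Rightarrow> (real ^ 'n \<Rightarrow> real ^ 'n)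
    \<Rightarrow> real ^ 'n \<Rightarrow> 's minkowski" where
  "second_fundamental_form c p Y Z u =
     normal_part (range (differential c p u))
       (frechet_derivative (\<lambda>w. differential c p w (Z w)) (at u within chart_image c) (Y u))"

text \<open>\<open>A c u\<close> is the matrix of the endomorphism in the chart \<open>c\<close>.\<close>

definition shape_operator ::
  "('a, 'n::finite) chart set \<Rightarrow> ('a \<Rightarrow> 's::finite minkowski) \<Rightarrow> ('a \<Rightarrow> 's minkowski)
    \<Rightarrow> (('a, 'n) chart \<Rightarrow> real ^ 'n \<Rightarrow> real ^ 'n ^ 'n) \<Rightarrow> bool" where
  "shape_operator \<A> p q A \<longleftrightarrow>
     (\<forall>c\<in>\<A>. \<forall>Y Z. smooth_on (chart_image c) Y \<and> smooth_on (chart_image c) Z \<longrightarrow>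
        (\<forall>u\<in>chart_image c.
           lorentz (differential c p u (A c u *v Y u)) (differential c p u (Z u))
           = lorentz (second_fundamental_form c p Y Z u) (q (chart_inv c u))))"

section \<open>Variations\<close>

definition variation ::
  "'a topology \<Rightarrow> ('a, 'n::finite) chart set \<Rightarrow> ('a \<Rightarrow> 's::finite minkowski) \<Rightarrow> real \<Rightarrow> (real \<Rightarrow> 'a \<Rightarrow> 's minkowski) \<Rightarrow> bool" where
  "variation M \<A> p \<epsilon> F \<longleftrightarrow>
     0 < \<epsilon> \<and>
     (\<forall>c\<in>\<A>. smooth_on ({-\<epsilon><..<\<epsilon>} \<times> chart_image c) (\<lambda>(t, u). F t (chart_inv c u))) \<and>
     (\<forall>x\<in>topspace M. F 0 x = p x) \<and>
     (\<forall>t\<in>{-\<epsilon><..<\<epsilon>}. spacelike_immersion \<A> (F t))"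

definition fixed_boundary ::
  "'n::finite \<Rightarrow> ('a, 'n) chart set \<Rightarrow> ('a \<Rightarrow> 's::finite minkowski) \<Rightarrow> real \<Rightarrow> (real \<Rightarrow> 'a \<Rightarrow> 's minkowski) \<Rightarrow> bool" where
  "fixed_boundary k \<A> p \<epsilon> F \<longleftrightarrow>
     (\<forall>t\<in>{-\<epsilon><..<\<epsilon>}. \<forall>x\<in>manifold_boundary k \<A>. F t x = p x)"

definition extended_variational_field ::
  "(real \<Rightarrow> 'a \<Rightarrow> 's::finite minkowski) \<Rightarrow> real \<Rightarrow> 'a \<Rightarrow> 's minkowski" where
  "extended_variational_field F t x = vector_derivative (\<lambda>s. F s x) (at t)"

definition variational_field :: "(real \<Rightarrow> 'a \<Rightarrow> 's::finite minkowski) \<Rightarrow> 'a \<Rightarrow> 's minkowski" where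
  "variational_field F = extended_variational_field F 0"

definition variational_acceleration :: "(real \<Rightarrow> 'a \<Rightarrow> 's::finite minkowski) \<Rightarrow> 'a \<Rightarrow> 's minkowski" where
  "variational_acceleration F x = vector_derivative (\<lambda>t. extended_variational_field F t x) (at 0)"

definition admissible ::
  "'a topology \<Rightarrow> ('a \<Rightarrow> 's::finite minkowski) \<Rightarrow> (real \<Rightarrow> 'a \<Rightarrow> 's minkowski) \<Rightarrow> bool" where
  "admissible M q F \<longleftrightarrow>
     (\<exists>\<phi> :: 'a \<Rightarrow> real. \<forall>x\<in>topspace M. variational_field F x = \<phi> x *\<^sub>R q x)"

definition characteristic ::
  "'a topology \<Rightarrow> ('a \<Rightarrow> 's::finite minkowski) \<Rightarrow> (real \<Rightarrow> 'a \<Rightarrow> 's minkowski) \<Rightarrow> bool" where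
  "characteristic M q F \<longleftrightarrow>
     admissible M q F \<and>
     (\<exists>\<psi> :: 'a \<Rightarrow> real. \<forall>x\<in>topspace M. variational_acceleration F x = \<psi> x *\<^sub>R q x)"

definition Vol :: "'a topology \<Rightarrow> ('a, 'n::finite) chart set \<Rightarrow> (real \<Rightarrow> 'a \<Rightarrow> 's::finite minkowski) \<Rightarrow> real \<Rightarrow> real" where
  "Vol M \<A> F t = integral_form M \<A> (volume_form (induced_metric (F t)))"

end

theory Submission
  imports Defs
begin

text \<open>
  In a chart with coordinate fields \<open>e\<^sub>i\<close> put \<open>h\<^sub>i\<^sub>j = \<langle>\<partial>\<^sub>i\<partial>\<^sub>jp, q\<rangle>\<close>, so that \<open>A = g\<^sup>-\<^sup>1h\<close>. The vectors
  \<open>\<partial>\<^sub>ip\<close>, \<open>p\<close>, \<open>q\<close> form a frame of Minkowski space, which yields the Gauss formula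
  \<open>\<partial>\<^sub>i\<partial>\<^sub>jp = \<Gamma>\<^sup>l\<^sub>i\<^sub>j\<partial>\<^sub>lp + h\<^sub>i\<^sub>jp - g\<^sub>i\<^sub>jq\<close> and the Weingarten formula \<open>\<partial>\<^sub>iq = - A\<^sup>l\<^sub>i\<partial>\<^sub>lp\<close>. The symmetry of third
  derivatives of \<open>p\<close> then gives the scalar curvature \<open>- 2 (n - 1) tr A\<close>, hence \<open>tr A = 0\<close>.

  If \<open>\<partial>\<^sub>tF = \<phi>q\<close> and \<open>\<partial>\<^sub>t\<^sup>2F = \<psi>q\<close> at time \<open>0\<close>, the induced metric has the time derivatives \<open>g' = - 2\<phi>h\<close> and
  \<open>g'' = - 2\<psi>h + 2\<phi>\<^sup>2hg\<^sup>-\<^sup>1h\<close>. Substituting these and \<open>tr A = 0\<close> into the second derivative of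
  \<open>sqrt (det g)\<close> leaves \<open>- \<phi>\<^sup>2 tr (A\<^sup>2) sqrt (det g)\<close> pointwise, before integration, and no
  integration by parts is needed. Finally \<open>\<langle>X, p\<rangle> = \<phi>\<close>, and \<open>tr (A\<^sup>2) \<ge> 0\<close> as \<open>A\<close> is self-adjoint for \<open>g\<close>.
\<close>

section \<open>Maps of class Ck and symmetry of second derivatives\<close>

text \<open>Charts take values in a half-space, so at boundary points there is only a derivative
  within a set, and smoothness only means that local extensions exist. All calculus is therefore
  phrased with one operator, \<open>dderiv\<close>, whose values are those of any local extension.
  An interval times a chart image is a set of the same kind, so one symmetry lemma exchanges
  coordinate derivatives with each other and with the time derivative.

  Before \<open>tr A = 0\<close> is inserted, the second derivative of \<open>sqrt (det g)\<close>,
  divided by \<open>sqrt (det g)\<close>, is \<open>\<phi>\<^sup>2 (tr A)\<^sup>2 - \<psi> tr A -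
  \<phi>\<^sup>2 tr (A\<^sup>2)\<close>. Derivatives of \<open>\<phi>\<close> and
  \<open>\<psi>\<close> are absent because they only multiply \<open>q\<close>, which is null and
  orthogonal to \<open>dp\<close> and \<open>dq\<close>; this is why the identity is pointwise.

  The partition of unity behind \<open>integral_form\<close> is selected from the manifold and its
  atlas alone. The volumes at all times and the final integral thus share it, and the pointwise
  identity is integrated chart by chart without any change of variables.\<close>

lemma Ck_on_open_subset: "Ck_on_open k f U \<Longrightarrow> V \<subseteq> U \<Longrightarrow> Ck_on_open k f V"
  by (induction k arbitrary: f) (auto intro: continuous_on_subset)

lemma Ck_on_open_cong:
  assumes "open U" "\<And>x. x \<in> U \<Longrightarrow> f x = g x" "Ck_on_open k f U"
  shows "Ck_on_open k g U"
  using assms(2,3)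
proof (induction k arbitrary: f g)
  case 0
  then show ?case by (auto cong: continuous_on_cong)
next
  case (Suc k)
  have diff: "g differentiable (at x)" if "x \<in> U" for x
    using Suc.prems that assms(1) has_derivative_transform_within_open[of f _ x UNIV U g]
    unfolding differentiable_def Ck_on_open.simps(2) by metis
  have "Ck_on_open k (\<lambda>x. frechet_derivative g (at x) v) U" for v
  proof (rule Suc.IH)
    show "Ck_on_open k (\<lambda>x. frechet_derivative f (at x) v) U"
      using Suc.prems by simp
    show "frechet_derivative f (at x) v = frechet_derivative g (at x) v" if "x \<in> U" for x
      using frechet_derivative_transform_within_open[of f x U g] that Suc.prems assms(1) by simp
  qed
  with diff show ?case by simp
qed

lemma Ck_on_open_SucD: "Ck_on_open (Suc k) f U \<Longrightarrow> Ck_on_open k f U"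
proof (induction k arbitrary: f)
  case 0
  then show ?case
    by (auto intro!: continuous_at_imp_continuous_on differentiable_imp_continuous_within)
next
  case (Suc k)
  have "Ck_on_open k (\<lambda>x. frechet_derivative f (at x) v) U" for v
    using Suc.prems by (intro Suc.IH) (simp only: Ck_on_open.simps(2)[of "Suc k"])
  then show ?case
    using Suc.prems by simp
qed

text \<open>The definition speaks of \<open>frechet_derivative\<close>, whereas the closure rules
  know the derivative as an explicit formula. Uniqueness of derivatives on the open set
  \<open>U\<close> makes the formula an admissible witness.\<close>

lemma Ck_on_open_SucI:
  assumes "open U" "\<And>x. x \<in> U \<Longrightarrow> (f has_derivative f' x) (at x)"
    and "\<And>v. Ck_on_open k (\<lambda>x. f' x v) U"
  shows "Ck_on_open (Suc k) f U"
proof -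
  have "Ck_on_open k (\<lambda>x. frechet_derivative f (at x) v) U" for v
    using assms(2) by (intro Ck_on_open_cong[OF assms(1) _ assms(3)[of v]])
      (metis frechet_derivative_at)
  then show ?thesis
    using assms(2) by (auto simp: differentiable_def)
qed

lemma Ck_on_open_Suc_has_derivative:
  "Ck_on_open (Suc k) f U \<Longrightarrow> x \<in> U \<Longrightarrow> (f has_derivative frechet_derivative f (at x)) (at x)"
  by (simp add: frechet_derivative_works[symmetric])

section \<open>Closure properties of the classes Ck\<close>

lemma Ck_on_open_const: "open U \<Longrightarrow> Ck_on_open k (\<lambda>x. c) U"
  by (induction k arbitrary: c) (auto simp: frechet_derivative_const)

lemma Ck_on_open_add:
  assumes "open U"
  shows "Ck_on_open k f U \<Longrightarrow> Ck_on_open k g U \<Longrightarrow> Ck_on_open k (\<lambda>x. f x + g x) U"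
proof (induction k arbitrary: f g)
  case 0
  then show ?case by (auto intro: continuous_intros)
next
  case (Suc k)
  show ?case
    by (rule Ck_on_open_SucI[where f' = "\<lambda>x v. frechet_derivative f (at x) v + frechet_derivative g (at x) v"])
      (use Suc assms in \<open>auto intro!: has_derivative_add simp: frechet_derivative_works[symmetric]\<close>)
qed

lemma Ck_on_open_bounded_linear:
  assumes "open U" "bounded_linear L"
  shows "Ck_on_open k f U \<Longrightarrow> Ck_on_open k (\<lambda>x. L (f x)) U"
proof (induction k arbitrary: f)
  case 0
  then show ?case
    by (auto intro: bounded_linear.continuous_on[OF assms(2)])
next
  case (Suc k)
  show ?case
    by (rule Ck_on_open_SucI[where f' = "\<lambda>x v. L (frechet_derivative f (at x) v)"])
      (use Suc assms in \<open>auto intro!: bounded_linear.has_derivative[OF assms(2)] simp: frechet_derivative_works[symmetric]\<close>)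
qed

lemma Ck_on_open_bilinear:
  assumes "open U" "bounded_bilinear B"
  shows "Ck_on_open k f U \<Longrightarrow> Ck_on_open k g U \<Longrightarrow> Ck_on_open k (\<lambda>x. B (f x) (g x)) U"
proof (induction k arbitrary: f g)
  case 0
  then show ?case by (auto intro: bounded_bilinear.continuous_on[OF assms(2)])
next
  case (Suc k)
  \<comment> \<open>Each Leibniz term keeps one factor undifferentiated, which has to be lowered to
    class \<open>k\<close> before the induction hypothesis applies.\<close>
  note SucD = Suc.prems[THEN Ck_on_open_SucD]
  show ?case
  proof (rule Ck_on_open_SucI[OF assms(1)])
    show "((\<lambda>x. B (f x) (g x)) has_derivative
        (\<lambda>v. B (f x) (frechet_derivative g (at x) v) + B (frechet_derivative f (at x) v) (g x))) (at x)"
      if "x \<in> U" for x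
      using Suc.prems that
      by (intro bounded_bilinear.FDERIV[OF assms(2)] Ck_on_open_Suc_has_derivative) auto
    show "Ck_on_open k (\<lambda>x. B (f x) (frechet_derivative g (at x) v)
        + B (frechet_derivative f (at x) v) (g x)) U" for v
      using Suc.prems SucD by (intro Ck_on_open_add[OF assms(1)] Suc.IH) auto
  qed
qed

text \<open>The inner derivative is the constant map \<open>L\<close>, so a directional derivative
  of the composite is again a function composed with the same affine map, and the induction closes.
  The instance needed later is the inclusion of a time slice.\<close>

lemma Ck_on_open_affine:
  assumes L: "bounded_linear L"
  shows "Ck_on_open k f U \<Longrightarrow> open U \<Longrightarrow> Ck_on_open k (\<lambda>x. f (c + L x)) ((\<lambda>x. c + L x) -` U)"
proof (induction k arbitrary: f)
  case 0
  then show ?case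
    by (auto intro!: continuous_intros continuous_on_compose2[of U f]
        bounded_linear.continuous_on[OF L])
next
  case (Suc k)
  have op: "open ((\<lambda>x. c + L x) -` U)"
    using Suc.prems by (auto intro!: open_vimage continuous_intros bounded_linear.continuous_on[OF L])
  show ?case
  proof (rule Ck_on_open_SucI[OF op])
    fix x assume "x \<in> (\<lambda>x. c + L x) -` U"
    then have f: "(f has_derivative frechet_derivative f (at (c + L x))) (at (c + L x))"
      using Suc.prems by (intro Ck_on_open_Suc_has_derivative) auto
    have "((\<lambda>x. c + L x) has_derivative L) (at x)"
      using has_derivative_add[OF has_derivative_const[of c] bounded_linear_imp_has_derivative[OF L, of "at x"]]
      by simp
    then show "((\<lambda>x. f (c + L x)) has_derivative (\<lambda>v. frechet_derivative f (at (c + L x)) (L v))) (at x)"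
      by (rule has_derivative_compose) (rule f)
  next
    show "Ck_on_open k (\<lambda>x. frechet_derivative f (at (c + L x)) (L v)) ((\<lambda>x. c + L x) -` U)" for v
      using Suc.prems by (intro Suc.IH) auto
  qed
qed

text \<open>Regularity bootstraps: the derivative of \<open>1 / f\<close> is a product of
  \<open>f'\<close> and two copies of \<open>1 / f\<close>, so class \<open>k\<close> of the
  reciprocal gives class \<open>k + 1\<close>. The square root below is treated in the same way, its
  derivative containing \<open>1 / sqrt f\<close>.\<close>

lemma Ck_on_open_inverse:
  fixes f :: "'a::euclidean_space \<Rightarrow> real"
  assumes "open U" "\<And>x. x \<in> U \<Longrightarrow> f x \<noteq> 0"
  shows "Ck_on_open k f U \<Longrightarrow> Ck_on_open k (\<lambda>x. inverse (f x)) U"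
proof (induction k)
  case 0
  then show ?case using assms by (auto intro: continuous_intros)
next
  case (Suc k)
  note inv = Suc.IH[OF Ck_on_open_SucD[OF Suc.prems]]
  note mult = Ck_on_open_bilinear[OF assms(1) bounded_bilinear_mult]
  show ?case
  proof (rule Ck_on_open_SucI[OF assms(1)])
    show "((\<lambda>x. inverse (f x)) has_derivative
        (\<lambda>v. - 1 * (inverse (f x) * frechet_derivative f (at x) v * inverse (f x)))) (at x)"
      if "x \<in> U" for x
      using Deriv.has_derivative_inverse[OF assms(2)[OF that] Ck_on_open_Suc_has_derivative[OF Suc.prems that]] by simp
    show "Ck_on_open k (\<lambda>x. - 1 * (inverse (f x) * frechet_derivative f (at x) v * inverse (f x))) U" for v
      using Suc.prems by (intro mult Ck_on_open_const inv assms(1)) auto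
  qed
qed

lemma Ck_on_open_sqrt:
  fixes f :: "'a::euclidean_space \<Rightarrow> real"
  assumes "open U" "\<And>x. x \<in> U \<Longrightarrow> 0 < f x"
  shows "Ck_on_open k f U \<Longrightarrow> Ck_on_open k (\<lambda>x. sqrt (f x)) U"
proof (induction k)
  case 0
  then show ?case by (auto intro: continuous_intros)
next
  case (Suc k)
  note sq = Suc.IH[OF Ck_on_open_SucD[OF Suc.prems]]
  note mult = Ck_on_open_bilinear[OF assms(1) bounded_bilinear_mult]
  show ?case
  proof (rule Ck_on_open_SucI[OF assms(1)])
    fix x assume x: "x \<in> U"
    have "(sqrt has_derivative (\<lambda>h. h * (inverse (sqrt (f x)) / 2))) (at (f x))"
      using DERIV_real_sqrt[OF assms(2)[OF x]]
      unfolding has_field_derivative_def by (subst mult.commute)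
    from has_derivative_compose[OF Ck_on_open_Suc_has_derivative[OF Suc.prems x] this]
    show "((\<lambda>x. sqrt (f x)) has_derivative
        (\<lambda>v. (1/2) * (frechet_derivative f (at x) v * inverse (sqrt (f x))))) (at x)"
      by simp
  next
    have "f x \<noteq> 0" if "x \<in> U" for x using assms(2)[OF that] by simp
    then show "Ck_on_open k (\<lambda>x. (1/2) * (frechet_derivative f (at x) v * inverse (sqrt (f x)))) U" for v
      using Suc.prems by (intro mult Ck_on_open_const Ck_on_open_inverse sq assms(1)) auto
  qed
qed

text \<open>Two applications of the mean value theorem rewrite the second difference of \<open>f\<close> in the
  directions \<open>v\<close>, \<open>w\<close> as a value of the iterated derivative at a nearby point.\<close>

lemma second_difference_mean_value:
  fixes f :: "'a::euclidean_space \<Rightarrow> real"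
  assumes C: "Ck_on_open (Suc (Suc 0)) f (ball x r)" and h: "0 < h" "h * (norm v + norm w) < r"
  shows "\<exists>s t. 0 < s \<and> s < h \<and> 0 < t \<and> t < h \<and>
    f (x + h *\<^sub>R v + h *\<^sub>R w) - f (x + h *\<^sub>R v) - f (x + h *\<^sub>R w) + f x
     = h * (h * frechet_derivative (\<lambda>y. frechet_derivative f (at y) v) (at (x + s *\<^sub>R v + t *\<^sub>R w)) w)"
proof -
  have mem: "x + s *\<^sub>R v + t *\<^sub>R w \<in> ball x r" if "0 \<le> s" "s \<le> h" "0 \<le> t" "t \<le> h" for s t
  proof -
    have "norm (s *\<^sub>R v + t *\<^sub>R w) \<le> norm (s *\<^sub>R v) + norm (t *\<^sub>R w)" by (rule norm_triangle_ineq)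
    also have "\<dots> = s * norm v + t * norm w" using that by simp
    also have "\<dots> \<le> h * norm v + h * norm w" using that by (intro add_mono mult_right_mono) auto
    also have "\<dots> < r" using h by (simp add: algebra_simps)
    finally have "norm (s *\<^sub>R v + t *\<^sub>R w) < r" .
    moreover have "dist x (x + s *\<^sub>R v + t *\<^sub>R w) = norm (s *\<^sub>R v + t *\<^sub>R w)"
      using norm_minus_cancel[of "s *\<^sub>R v + t *\<^sub>R w"] by (simp add: dist_norm algebra_simps)
    ultimately show ?thesis by simp
  qed
  have D1: "((\<lambda>s. f (x + s *\<^sub>R v + c *\<^sub>R w)) has_real_derivative
      frechet_derivative f (at (x + s *\<^sub>R v + c *\<^sub>R w)) v) (at s)" if "0 \<le> s" "s \<le> h" "0 \<le> c" "c \<le> h" for s c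
  proof -
    have fd: "(f has_derivative frechet_derivative f (at (x + s *\<^sub>R v + c *\<^sub>R w))) (at (x + s *\<^sub>R v + c *\<^sub>R w))"
      by (rule Ck_on_open_Suc_has_derivative[OF C mem[OF that]])
    have "((\<lambda>s. x + s *\<^sub>R v + c *\<^sub>R w) has_derivative (\<lambda>d. d *\<^sub>R v)) (at s)"
      by (auto intro!: derivative_eq_intros)
    from has_derivative_compose[OF this fd] show ?thesis
      using linear.scaleR[OF has_derivative_linear[OF fd]] by (simp add: has_field_derivative_def mult_commute_abs)
  qed
  have D2: "((\<lambda>t. frechet_derivative f (at (x + s *\<^sub>R v + t *\<^sub>R w)) v) has_real_derivative
      frechet_derivative (\<lambda>y. frechet_derivative f (at y) v) (at (x + s *\<^sub>R v + t *\<^sub>R w)) w) (at t)"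
    if "0 \<le> s" "s \<le> h" "0 \<le> t" "t \<le> h" for s t
  proof -
    have C': "Ck_on_open (Suc 0) (\<lambda>y. frechet_derivative f (at y) v) (ball x r)"
      using C by (simp only: Ck_on_open.simps(2)[of "Suc 0"])
    note fd = Ck_on_open_Suc_has_derivative[OF C' mem[OF that]]
    have "((\<lambda>t. x + s *\<^sub>R v + t *\<^sub>R w) has_derivative (\<lambda>d. d *\<^sub>R w)) (at t)"
      by (auto intro!: derivative_eq_intros)
    from has_derivative_compose[OF this fd] show ?thesis
      using linear.scaleR[OF has_derivative_linear[OF fd]] by (simp add: has_field_derivative_def mult_commute_abs)
  qed
  define \<phi> where "\<phi> s = f (x + s *\<^sub>R v + h *\<^sub>R w) - f (x + s *\<^sub>R v)" for s
  have "(\<phi> has_real_derivative frechet_derivative f (at (x + s *\<^sub>R v + h *\<^sub>R w)) v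
      - frechet_derivative f (at (x + s *\<^sub>R v)) v) (at s)" if "0 \<le> s" "s \<le> h" for s
    unfolding \<phi>_def using D1[of s 0] D1[of s h] that h by (intro DERIV_diff) auto
  from MVT2[OF h(1) this] obtain s where s: "0 < s" "s < h" and
    e1: "\<phi> h - \<phi> 0 = h * (frechet_derivative f (at (x + s *\<^sub>R v + h *\<^sub>R w)) v - frechet_derivative f (at (x + s *\<^sub>R v)) v)"
    by auto
  from MVT2[OF h(1) D2[of s]] s obtain t where t: "0 < t" "t < h" and
    e2: "frechet_derivative f (at (x + s *\<^sub>R v + h *\<^sub>R w)) v - frechet_derivative f (at (x + s *\<^sub>R v)) v
      = h * frechet_derivative (\<lambda>y. frechet_derivative f (at y) v) (at (x + s *\<^sub>R v + t *\<^sub>R w)) w"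
    by fastforce
  show ?thesis
    using s t e1 e2 by (intro exI[of _ s] exI[of _ t]) (simp add: \<phi>_def)
qed

text \<open>The second difference is symmetric in \<open>v\<close> and \<open>w\<close>. It equals
  \<open>h\<^sup>2\<close> times the one mixed derivative at some nearby point and
  \<open>h\<^sup>2\<close> times the other at another nearby point; both points tend to
  \<open>x\<close> as \<open>h\<close> tends to \<open>0\<close>, and the mixed derivatives are
  continuous.\<close>

lemma frechet_derivative_commute_real:
  fixes f :: "'a::euclidean_space \<Rightarrow> real"
  assumes U: "open U" "x \<in> U" and C: "Ck_on_open (Suc (Suc 0)) f U"
  shows "frechet_derivative (\<lambda>y. frechet_derivative f (at y) v) (at x) w
       = frechet_derivative (\<lambda>y. frechet_derivative f (at y) w) (at x) v"
proof -
  obtain r where r: "0 < r" "ball x r \<subseteq> U" using U open_contains_ball by blast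
  note Cr = Ck_on_open_subset[OF C r(2)]
  define D where "D a b y = frechet_derivative (\<lambda>y. frechet_derivative f (at y) a) (at y) b" for a b y
  have lim: "((\<lambda>n. D a b (x + s n *\<^sub>R v + t n *\<^sub>R w)) \<longlonglongrightarrow> D a b x)"
    if "s \<longlonglongrightarrow> 0" "t \<longlonglongrightarrow> 0" for a b and s t :: "nat \<Rightarrow> real"
  proof -
    have "continuous_on U (D a b)" using C by (auto simp: D_def)
    then have "isCont (D a b) x" using U by (simp add: continuous_on_eq_continuous_at)
    moreover have "(\<lambda>n. x + s n *\<^sub>R v + t n *\<^sub>R w) \<longlonglongrightarrow> x"
      by (rule tendsto_eq_intros tendsto_const that | simp)+
    ultimately show ?thesis by (rule isCont_tendsto_compose)
  qed
  \<comment> \<open>The summand \<open>1\<close> in the denominator covers the case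
    \<open>v = w = 0\<close>; the second factor is \<open>1 / (n + 2)\<close>, which is below
    \<open>1\<close> already for \<open>n = 0\<close>.\<close>
  define h where "h n = (r / (norm v + norm w + 1)) * inverse (real (Suc n) + 1)" for n
  have pos: "0 < norm v + norm w + 1" by (simp add: add_nonneg_pos)
  have h0: "0 < h n" for n using r pos by (simp add: h_def)
  have hr: "h n * (norm v + norm w) < r" for n
  proof -
    have "inverse (real (Suc n) + 1) < 1" by (simp add: field_simps)
    then have "h n < r / (norm v + norm w + 1)"
      unfolding h_def using r pos mult_strict_left_mono[of "inverse (real (Suc n) + 1)" 1 "r / (norm v + norm w + 1)"]
      by simp
    then have "h n * (norm v + norm w + 1) < r" using pos by (simp add: pos_less_divide_eq)
    then show ?thesis using h0[of n] by (simp add: algebra_simps)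
  qed
  have hlim: "h \<longlonglongrightarrow> 0"
  proof -
    have "(\<lambda>n. inverse (real (Suc (Suc n)))) \<longlonglongrightarrow> 0"
      using LIMSEQ_Suc[OF LIMSEQ_inverse_real_of_nat] .
    then have "(\<lambda>n. (r / (norm v + norm w + 1)) * inverse (real (Suc (Suc n)))) \<longlonglongrightarrow> 0"
      by (rule tendsto_mult_right_zero)
    then show ?thesis unfolding h_def by (simp add: add.commute)
  qed
  have "\<exists>s t. 0 < s \<and> s < h n \<and> 0 < t \<and> t < h n \<and>
    f (x + h n *\<^sub>R v + h n *\<^sub>R w) - f (x + h n *\<^sub>R v) - f (x + h n *\<^sub>R w) + f x
     = h n * (h n * D v w (x + s *\<^sub>R v + t *\<^sub>R w))" for n
    unfolding D_def by (rule second_difference_mean_value[OF Cr h0 hr])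
  then obtain s t where st: "\<And>n. 0 < s n" "\<And>n. s n < h n" "\<And>n. 0 < t n" "\<And>n. t n < h n"
    and e1: "\<And>n. f (x + h n *\<^sub>R v + h n *\<^sub>R w) - f (x + h n *\<^sub>R v) - f (x + h n *\<^sub>R w) + f x
     = h n * (h n * D v w (x + s n *\<^sub>R v + t n *\<^sub>R w))" by metis
  have "\<exists>t s. 0 < t \<and> t < h n \<and> 0 < s \<and> s < h n \<and>
    f (x + h n *\<^sub>R w + h n *\<^sub>R v) - f (x + h n *\<^sub>R w) - f (x + h n *\<^sub>R v) + f x
     = h n * (h n * D w v (x + t *\<^sub>R w + s *\<^sub>R v))" for n
    unfolding D_def using hr by (intro second_difference_mean_value[OF Cr h0]) (simp add: add.commute)
  then obtain s' t' where st': "\<And>n. 0 < s' n" "\<And>n. s' n < h n" "\<And>n. 0 < t' n" "\<And>n. t' n < h n"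
    and e2: "\<And>n. f (x + h n *\<^sub>R w + h n *\<^sub>R v) - f (x + h n *\<^sub>R w) - f (x + h n *\<^sub>R v) + f x
     = h n * (h n * D w v (x + t' n *\<^sub>R w + s' n *\<^sub>R v))" by metis
  have sq: "z \<longlonglongrightarrow> 0" if "\<And>n. 0 < z n" "\<And>n. z n < h n" for z
    using that by (intro tendsto_sandwich[OF _ _ tendsto_const hlim]) (auto intro!: always_eventually less_imp_le)
  have "D v w (x + s n *\<^sub>R v + t n *\<^sub>R w) = D w v (x + s' n *\<^sub>R v + t' n *\<^sub>R w)" for n
  proof -
    have "h n * (h n * D v w (x + s n *\<^sub>R v + t n *\<^sub>R w)) = h n * (h n * D w v (x + s' n *\<^sub>R v + t' n *\<^sub>R w))"
      using e1[of n] e2[of n] by (simp add: algebra_simps)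
    then show ?thesis using h0[of n] by simp
  qed
  then have "(\<lambda>n. D v w (x + s n *\<^sub>R v + t n *\<^sub>R w)) \<longlonglongrightarrow> D w v x"
    using lim[OF sq[OF st'(1,2)] sq[OF st'(3,4)]] by simp
  moreover have "(\<lambda>n. D v w (x + s n *\<^sub>R v + t n *\<^sub>R w)) \<longlonglongrightarrow> D v w x"
    by (rule lim[OF sq[OF st(1,2)] sq[OF st(3,4)]])
  ultimately show ?thesis unfolding D_def using LIMSEQ_unique by blast
qed

text \<open>Both sides are tested against basis vectors. The auxiliary equations move the inner
  product with \<open>b\<close> through one and through two derivatives, which reduces the claim to
  real-valued functions.\<close>

lemma frechet_derivative_commute:
  fixes f :: "'a::euclidean_space \<Rightarrow> 'b::euclidean_space"
  assumes U: "open U" "x \<in> U" and C: "Ck_on_open (Suc (Suc 0)) f U"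
  shows "frechet_derivative (\<lambda>y. frechet_derivative f (at y) v) (at x) w
       = frechet_derivative (\<lambda>y. frechet_derivative f (at y) w) (at x) v"
proof (rule euclidean_eqI)
  fix b :: 'b
  have d: "frechet_derivative (\<lambda>y. g y \<bullet> b) (at y) a = frechet_derivative g (at y) a \<bullet> b"
    if "g differentiable (at y)" for g y a
  proof -
    have "((\<lambda>y. g y \<bullet> b) has_derivative (\<lambda>a. frechet_derivative g (at y) a \<bullet> b)) (at y)"
      using that by (intro has_derivative_inner_left) (simp add: frechet_derivative_works[symmetric])
    from frechet_derivative_at[OF this] show ?thesis by (metis)
  qed
  have dd: "frechet_derivative (\<lambda>y. frechet_derivative f (at y) c \<bullet> b) (at x) a
      = frechet_derivative (\<lambda>y. frechet_derivative (\<lambda>y. f y \<bullet> b) (at y) c) (at x) a" for a c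
  proof -
    have "(\<lambda>y. frechet_derivative f (at y) c \<bullet> b) differentiable (at x)"
      using C U differentiable_inner[OF _ differentiable_const, of "\<lambda>y. frechet_derivative f (at y) c" x UNIV b] by simp
    then show ?thesis
      using C U by (subst frechet_derivative_transform_within_open[of _ x U]) (auto simp: d)
  qed
  have "Ck_on_open (Suc (Suc 0)) (\<lambda>y. f y \<bullet> b) U"
    by (rule Ck_on_open_bounded_linear[OF U(1) bounded_linear_inner_left C])
  from frechet_derivative_commute_real[OF U this, of v w]
  show "frechet_derivative (\<lambda>y. frechet_derivative f (at y) v) (at x) w \<bullet> b
      = frechet_derivative (\<lambda>y. frechet_derivative f (at y) w) (at x) v \<bullet> b"
    using C U by (simp add: dd[symmetric] d)
qed

section \<open>Smooth maps on half-space domains\<close>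

text \<open>The condition under which derivatives within \<open>S\<close> are unique.\<close>

definition axis_accessible :: "'a::euclidean_space set \<Rightarrow> bool" where
  "axis_accessible S \<longleftrightarrow>
     (\<forall>x\<in>S. \<forall>i\<in>Basis. \<forall>e>0. \<exists>d. 0 < \<bar>d\<bar> \<and> \<bar>d\<bar> < e \<and> x + d *\<^sub>R i \<in> S)"

text \<open>The direction comes before the function, so that \<open>dderiv S v\<close> is an
  operator on functions and can be iterated.\<close>

definition dderiv :: "'a::euclidean_space set \<Rightarrow> 'a \<Rightarrow> ('a \<Rightarrow> 'b::real_normed_vector) \<Rightarrow> 'a \<Rightarrow> 'b" where
  "dderiv S v f x = frechet_derivative f (at x within S) v"

text \<open>This is where accessibility enters: points of \<open>S\<close> arbitrarily near
  \<open>x\<close> on every axis through \<open>x\<close> determine a linear map from its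
  first-order behaviour within \<open>S\<close>.\<close>

lemma dderiv_eq:
  assumes "axis_accessible S" "x \<in> S" "(f has_derivative f') (at x within S)"
  shows "dderiv S v f x = f' v"
proof -
  have "(f has_derivative frechet_derivative f (at x within S)) (at x within S)"
    using assms(3) by (metis differentiableI frechet_derivative_works)
  then have "frechet_derivative f (at x within S) = f'"
    using assms by (intro frechet_derivative_unique_within[of f _ x S]) (auto simp: axis_accessible_def)
  then show ?thesis by (simp add: dderiv_def)
qed

lemma has_derivative_dderiv:
  "f differentiable (at x within S) \<Longrightarrow> (f has_derivative (\<lambda>v. dderiv S v f x)) (at x within S)"
  by (simp add: dderiv_def frechet_derivative_works)

lemma dderiv_cong:
  assumes "axis_accessible S" "x \<in> S" "\<And>y. y \<in> S \<Longrightarrow> f y = g y" "f differentiable (at x within S)"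
  shows "dderiv S v f x = dderiv S v g x"
proof -
  have "(g has_derivative (\<lambda>v. dderiv S v f x)) (at x within S)"
    by (rule has_derivative_transform[OF assms(2) _ has_derivative_dderiv[OF assms(4)]])
      (simp add: assms(3))
  from dderiv_eq[OF assms(1,2) this] show ?thesis by simp
qed

lemma smooth_onE:
  assumes "smooth_on S f" "x \<in> S"
  obtains U f' where "open U" "x \<in> U" "\<And>k. Ck_on_open k f' U" "\<And>y. y \<in> S \<Longrightarrow> y \<in> U \<Longrightarrow> f' y = f y"
proof -
  from assms have "\<exists>U f'. open U \<and> x \<in> U \<and> (\<forall>k. Ck_on_open k f' U) \<and> (\<forall>y\<in>S \<inter> U. f' y = f y)"
    unfolding smooth_on_def by (rule bspec)
  then obtain U f' where "open U \<and> x \<in> U \<and> (\<forall>k. Ck_on_open k f' U) \<and> (\<forall>y\<in>S \<inter> U. f' y = f y)"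
    by (elim exE)
  then show thesis by (intro that[of U f']) simp_all
qed

lemma smooth_onI:
  assumes "\<And>x. x \<in> S \<Longrightarrow> \<exists>U f'. open U \<and> x \<in> U \<and> (\<forall>k. Ck_on_open k f' U) \<and> (\<forall>y\<in>S \<inter> U. f' y = f y)"
  shows "smooth_on S f"
  unfolding smooth_on_def using assms by (rule ballI)

lemma local_extensionI:
  assumes "open U" "x \<in> U" "\<And>k. Ck_on_open k f' U" "\<And>y. y \<in> S \<Longrightarrow> y \<in> U \<Longrightarrow> f' y = f y"
  shows "\<exists>U f'. open U \<and> x \<in> U \<and> (\<forall>k. Ck_on_open k f' U) \<and> (\<forall>y\<in>S \<inter> U. f' y = f y)"
  using assms by (intro exI[of _ U] exI[of _ f']) simp

lemma has_derivative_extension: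
  assumes "open U" "y \<in> U" "y \<in> S" "Ck_on_open (Suc 0) f' U" "\<And>y. y \<in> S \<Longrightarrow> y \<in> U \<Longrightarrow> f' y = f y"
  shows "(f has_derivative frechet_derivative f' (at y)) (at y within S)"
proof -
  have "(f' has_derivative frechet_derivative f' (at y)) (at y within S)"
    using Ck_on_open_Suc_has_derivative[OF assms(4,2)] has_derivative_at_withinI by blast
  moreover obtain d where "0 < d" "ball y d \<subseteq> U" using assms(1,2) open_contains_ball by blast
  ultimately show ?thesis
    using assms by (elim has_derivative_transform_within[where d = d]) (auto simp: dist_commute subset_iff)
qed

lemma smooth_on_differentiable:
  assumes "smooth_on S f" "x \<in> S"
  shows "f differentiable (at x within S)"
proof -
  obtain U f' where U: "open U" "x \<in> U" "\<And>k. Ck_on_open k f' U"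
    "\<And>y. y \<in> S \<Longrightarrow> y \<in> U \<Longrightarrow> f' y = f y" using assms by (rule smooth_onE) blast
  show ?thesis
    by (rule differentiableI[OF has_derivative_extension[OF U(1,2) assms(2) U(3,4)]])
qed

lemmas smooth_on_has_derivative = has_derivative_dderiv[OF smooth_on_differentiable]

lemma smooth_on_imp_continuous_on: "smooth_on S f \<Longrightarrow> continuous_on S f"
  unfolding continuous_on_eq_continuous_within
  by (intro ballI differentiable_imp_continuous_within smooth_on_differentiable)

text \<open>Transfers facts from open sets to boundary points: whatever local extension is chosen,
  its full derivative agrees with the derivative within \<open>S\<close>.\<close>

lemma dderiv_extension:
  assumes "axis_accessible S" "open U" "y \<in> U" "y \<in> S" "Ck_on_open (Suc 0) f' U" "\<And>y. y \<in> S \<Longrightarrow> y \<in> U \<Longrightarrow> f' y = f y"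
  shows "dderiv S v f y = frechet_derivative f' (at y) v"
  by (rule dderiv_eq[OF assms(1,4) has_derivative_extension[OF assms(2-6)]]) auto

lemma smooth_on_dderiv:
  assumes "axis_accessible S" "smooth_on S f"
  shows "smooth_on S (dderiv S v f)"
proof (rule smooth_onI)
  fix x assume "x \<in> S"
  from assms(2) this obtain U f' where U: "open U" "x \<in> U" "\<And>k. Ck_on_open k f' U"
    "\<And>y. y \<in> S \<Longrightarrow> y \<in> U \<Longrightarrow> f' y = f y" by (rule smooth_onE) blast
  have ext: "Ck_on_open k (\<lambda>x. frechet_derivative f' (at x) v) U" for k
    using U(3)[of "Suc k"] by simp
  have ext': "frechet_derivative f' (at y) v = dderiv S v f y" if "y \<in> S" "y \<in> U" for y
    using dderiv_extension[OF assms(1) U(1) that(2,1) U(3,4)] by simp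
  show "\<exists>U f'. open U \<and> x \<in> U \<and> (\<forall>k. Ck_on_open k f' U) \<and> (\<forall>y\<in>S \<inter> U. f' y = dderiv S v f y)"
    by (rule local_extensionI[where U = U and f' = "\<lambda>x. frechet_derivative f' (at x) v"])
      (use ext ext' U(1,2) in \<open>simp_all\<close>)
qed

text \<open>The iterated derivative within \<open>S\<close> is that of an ambient extension, where
  symmetry is known. It is applied on chart images for the coordinate derivatives and on an interval
  times a chart image for mixed time and space derivatives.\<close>

lemma dderiv_commute:
  fixes f :: "'a::euclidean_space \<Rightarrow> 'b::euclidean_space"
  assumes "axis_accessible S" "smooth_on S f" "x \<in> S"
  shows "dderiv S w (dderiv S v f) x = dderiv S v (dderiv S w f) x"
proof -
  obtain U f' where U: "open U" "x \<in> U" "\<And>k. Ck_on_open k f' U"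
    "\<And>y. y \<in> S \<Longrightarrow> y \<in> U \<Longrightarrow> f' y = f y" using assms(2,3) by (rule smooth_onE) blast
  have *: "dderiv S b (dderiv S a f) x = frechet_derivative (\<lambda>y. frechet_derivative f' (at y) a) (at x) b" for a b
  proof (rule dderiv_extension[OF assms(1) U(1,2) assms(3)])
    show "Ck_on_open (Suc 0) (\<lambda>y. frechet_derivative f' (at y) a) U"
      using U(3)[of "Suc (Suc 0)"] by (simp only: Ck_on_open.simps(2)[of "Suc 0"])
    show "frechet_derivative f' (at y) a = dderiv S a f y" if "y \<in> S" "y \<in> U" for y
      using dderiv_extension[OF assms(1) U(1) that(2,1) U(3,4)] by simp
  qed
  show ?thesis unfolding * by (rule frechet_derivative_commute[OF U(1,2,3)])
qed

section \<open>Algebra of smooth maps and calculus rules for derivatives within a set\<close>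

lemma smooth_on_const: "smooth_on S (\<lambda>x. c)"
  by (rule smooth_onI) (auto intro!: exI[of _ UNIV] exI[of _ "\<lambda>x. c"] Ck_on_open_const)

lemma smooth_on_bilinear:
  assumes B: "bounded_bilinear B" and f: "smooth_on S f" and g: "smooth_on S g"
  shows "smooth_on S (\<lambda>x. B (f x) (g x))"
proof (rule smooth_onI)
  fix x assume x: "x \<in> S"
  obtain U f' where U: "open U" "x \<in> U" "\<And>k. Ck_on_open k f' U"
    "\<And>y. y \<in> S \<Longrightarrow> y \<in> U \<Longrightarrow> f' y = f y" using f x by (rule smooth_onE) blast
  obtain V g' where V: "open V" "x \<in> V" "\<And>k. Ck_on_open k g' V"
    "\<And>y. y \<in> S \<Longrightarrow> y \<in> V \<Longrightarrow> g' y = g y" using g x by (rule smooth_onE) blast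
  have "Ck_on_open k (\<lambda>x. B (f' x) (g' x)) (U \<inter> V)" for k
    using U V by (intro Ck_on_open_bilinear[OF _ B] Ck_on_open_subset[OF U(3)] Ck_on_open_subset[OF V(3)]) auto
  note ext = this
  show "\<exists>U f'. open U \<and> x \<in> U \<and> (\<forall>k. Ck_on_open k f' U) \<and> (\<forall>y\<in>S \<inter> U. f' y = B (f y) (g y))"
    by (rule local_extensionI[where U = "U \<inter> V" and f' = "\<lambda>x. B (f' x) (g' x)"])
      (use ext U V in \<open>simp_all add: open_Int\<close>)
qed

lemma smooth_on_add:
  assumes f: "smooth_on S f" and g: "smooth_on S g"
  shows "smooth_on S (\<lambda>x. f x + g x)"
proof (rule smooth_onI)
  fix x assume x: "x \<in> S"
  obtain U f' where U: "open U" "x \<in> U" "\<And>k. Ck_on_open k f' U"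
    "\<And>y. y \<in> S \<Longrightarrow> y \<in> U \<Longrightarrow> f' y = f y" using f x by (rule smooth_onE) blast
  obtain V g' where V: "open V" "x \<in> V" "\<And>k. Ck_on_open k g' V"
    "\<And>y. y \<in> S \<Longrightarrow> y \<in> V \<Longrightarrow> g' y = g y" using g x by (rule smooth_onE) blast
  have "Ck_on_open k (\<lambda>x. f' x + g' x) (U \<inter> V)" for k
    using U V by (intro Ck_on_open_add Ck_on_open_subset[OF U(3)] Ck_on_open_subset[OF V(3)]) auto
  note ext = this
  show "\<exists>U f'. open U \<and> x \<in> U \<and> (\<forall>k. Ck_on_open k f' U) \<and> (\<forall>y\<in>S \<inter> U. f' y = f y + g y)"
    by (rule local_extensionI[where U = "U \<inter> V" and f' = "\<lambda>x. f' x + g' x"])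
      (use ext U V in \<open>simp_all add: open_Int\<close>)
qed

lemma smooth_on_affine:
  assumes L: "bounded_linear L" and f: "smooth_on T f" and sub: "\<And>x. x \<in> S \<Longrightarrow> c + L x \<in> T"
  shows "smooth_on S (\<lambda>x. f (c + L x))"
proof (rule smooth_onI)
  fix x assume x: "x \<in> S"
  obtain U f' where U: "open U" "c + L x \<in> U" "\<And>k. Ck_on_open k f' U"
    "\<And>y. y \<in> T \<Longrightarrow> y \<in> U \<Longrightarrow> f' y = f y" using f sub[OF x] by (rule smooth_onE) blast
  have "continuous_on UNIV (\<lambda>x. c + L x)"
    by (intro continuous_intros bounded_linear.continuous_on[OF L])
  from open_vimage[OF U(1) this] have "open ((\<lambda>x. c + L x) -` U)" .
  note ext = this
  show "\<exists>U f'. open U \<and> x \<in> U \<and> (\<forall>k. Ck_on_open k f' U) \<and> (\<forall>y\<in>S \<inter> U. f' y = f (c + L y))"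
    by (rule local_extensionI[where U = "(\<lambda>x. c + L x) -` U" and f' = "\<lambda>x. f' (c + L x)"])
      (use ext U sub Ck_on_open_affine[OF L U(3,1)] in \<open>simp_all\<close>)
qed

lemma smooth_on_cong:
  assumes "smooth_on S f" "\<And>x. x \<in> S \<Longrightarrow> f x = g x"
  shows "smooth_on S g"
proof (rule smooth_onI)
  fix x assume "x \<in> S"
  from assms(1) this obtain U f' where U: "open U" "x \<in> U" "\<And>k. Ck_on_open k f' U"
    "\<And>y. y \<in> S \<Longrightarrow> y \<in> U \<Longrightarrow> f' y = f y" by (rule smooth_onE) blast
  note ext = this
  show "\<exists>U f'. open U \<and> x \<in> U \<and> (\<forall>k. Ck_on_open k f' U) \<and> (\<forall>y\<in>S \<inter> U. f' y = g y)"
    by (rule local_extensionI[where U = U and f' = f'])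
      (use ext assms(2) in \<open>simp_all\<close>)
qed

lemma smooth_on_sum:
  "(\<And>i. i \<in> I \<Longrightarrow> smooth_on S (f i)) \<Longrightarrow> smooth_on S (\<lambda>x. \<Sum>i\<in>I. f i x)"
  by (induction I rule: infinite_finite_induct) (simp_all add: smooth_on_const smooth_on_add)

lemmas smooth_on_mult = smooth_on_bilinear[OF bounded_bilinear_mult]
  and smooth_on_scaleR = smooth_on_bilinear[OF bounded_bilinear_scaleR]

lemma smooth_on_prod:
  fixes f :: "'i \<Rightarrow> 'a::euclidean_space \<Rightarrow> real"
  shows "(\<And>i. i \<in> I \<Longrightarrow> smooth_on S (f i)) \<Longrightarrow> smooth_on S (\<lambda>x. \<Prod>i\<in>I. f i x)"
  by (induction I rule: infinite_finite_induct) (simp_all add: smooth_on_const smooth_on_mult)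

lemma smooth_on_sqrt:
  fixes f :: "'a::euclidean_space \<Rightarrow> real"
  assumes f: "smooth_on S f" and pos: "\<And>x. x \<in> S \<Longrightarrow> 0 < f x"
  shows "smooth_on S (\<lambda>x. sqrt (f x))"
proof (rule smooth_onI)
  fix x assume x: "x \<in> S"
  obtain U f' where U: "open U" "x \<in> U" "\<And>k. Ck_on_open k f' U"
    "\<And>y. y \<in> S \<Longrightarrow> y \<in> U \<Longrightarrow> f' y = f y" using f x by (rule smooth_onE) blast
  \<comment> \<open>The extension \<open>f'\<close> is known to be positive only where it agrees
    with \<open>f\<close>; continuity preserves positivity on a smaller open neighbourhood of
    \<open>x\<close>.\<close>
  define V where "V = U \<inter> f' -` {0<..}"
  have V: "open V" unfolding V_def using U(3)[of 0] U(1)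
    by (intro continuous_open_preimage) auto
  have "x \<in> V" using x U pos by (auto simp: V_def)
  have ext: "Ck_on_open k (\<lambda>x. sqrt (f' x)) V" for k
    using V by (intro Ck_on_open_sqrt Ck_on_open_subset[OF U(3)]) (auto simp: V_def)
  show "\<exists>U f'. open U \<and> x \<in> U \<and> (\<forall>k. Ck_on_open k f' U) \<and> (\<forall>y\<in>S \<inter> U. f' y = sqrt (f y))"
    by (rule local_extensionI[where U = V and f' = "\<lambda>x. sqrt (f' x)"])
      (use U V ext \<open>x \<in> V\<close> in \<open>simp_all add: V_def\<close>)
qed

lemma smooth_on_inverse:
  fixes f :: "'a::euclidean_space \<Rightarrow> real"
  assumes f: "smooth_on S f" and nz: "\<And>x. x \<in> S \<Longrightarrow> f x \<noteq> 0"
  shows "smooth_on S (\<lambda>x. inverse (f x))"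
proof (rule smooth_onI)
  fix x assume x: "x \<in> S"
  obtain U f' where U: "open U" "x \<in> U" "\<And>k. Ck_on_open k f' U"
    "\<And>y. y \<in> S \<Longrightarrow> y \<in> U \<Longrightarrow> f' y = f y" using f x by (rule smooth_onE) blast
  define V where "V = U \<inter> f' -` (- {0})"
  have V: "open V" unfolding V_def using U(3)[of 0] U(1)
    by (intro continuous_open_preimage) auto
  have "x \<in> V" using x U nz by (auto simp: V_def)
  have ext: "Ck_on_open k (\<lambda>x. inverse (f' x)) V" for k
    using V by (intro Ck_on_open_inverse Ck_on_open_subset[OF U(3)]) (auto simp: V_def)
  show "\<exists>U f'. open U \<and> x \<in> U \<and> (\<forall>k. Ck_on_open k f' U) \<and> (\<forall>y\<in>S \<inter> U. f' y = inverse (f y))"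
    by (rule local_extensionI[where U = V and f' = "\<lambda>x. inverse (f' x)"])
      (use U V ext \<open>x \<in> V\<close> in \<open>simp_all add: V_def\<close>)
qed

lemma dderiv_bilinear:
  assumes "bounded_bilinear B" "axis_accessible S" "x \<in> S"
    and "f differentiable (at x within S)" "g differentiable (at x within S)"
  shows "dderiv S v (\<lambda>x. B (f x) (g x)) x = B (f x) (dderiv S v g x) + B (dderiv S v f x) (g x)"
  by (rule dderiv_eq[OF assms(2,3) bounded_bilinear.FDERIV[OF assms(1) has_derivative_dderiv has_derivative_dderiv]])
    (use assms in auto)

lemmas dderiv_scaleR = dderiv_bilinear[OF bounded_bilinear_scaleR]

lemma dderiv_const: "axis_accessible S \<Longrightarrow> x \<in> S \<Longrightarrow> dderiv S v (\<lambda>x. c) x = 0"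
  by (rule dderiv_eq) (auto intro: has_derivative_const)

lemma dderiv_add:
  assumes "axis_accessible S" "x \<in> S"
    and "f differentiable (at x within S)" "g differentiable (at x within S)"
  shows "dderiv S v (\<lambda>x. f x + g x) x = dderiv S v f x + dderiv S v g x"
  by (rule dderiv_eq[OF assms(1,2) has_derivative_add[OF has_derivative_dderiv has_derivative_dderiv]])
    (use assms in auto)

lemma dderiv_sum:
  assumes "axis_accessible S" "x \<in> S"
    and "\<And>i. i \<in> I \<Longrightarrow> f i differentiable (at x within S)"
  shows "dderiv S v (\<lambda>x. \<Sum>i\<in>I. f i x) x = (\<Sum>i\<in>I. dderiv S v (f i) x)"
  by (rule dderiv_eq[OF assms(1,2) has_derivative_sum[OF has_derivative_dderiv]])
    (use assms in auto)

lemma dderiv_affine: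
  assumes L: "bounded_linear L" and "axis_accessible S" "axis_accessible T" "x \<in> S"
    and sub: "\<And>x. x \<in> S \<Longrightarrow> c + L x \<in> T" and f: "f differentiable (at (c + L x) within T)"
  shows "dderiv S v (\<lambda>x. f (c + L x)) x = dderiv T (L v) f (c + L x)"
proof (rule dderiv_eq[OF assms(2,4)])
  have "((\<lambda>x. c + L x) has_derivative L) (at x within S)"
    using has_derivative_add[OF has_derivative_const[of c] bounded_linear_imp_has_derivative[OF L]]
    by simp
  moreover have "(f has_derivative (\<lambda>v. dderiv T v f (c + L x))) (at (c + L x) within (\<lambda>x. c + L x) ` S)"
    using sub by (intro has_derivative_subset[OF has_derivative_dderiv[OF f]]) auto
  ultimately show "((\<lambda>x. f (c + L x)) has_derivative (\<lambda>v. dderiv T (L v) f (c + L x))) (at x within S)"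
    by (rule has_derivative_in_compose)
qed

section \<open>Accessible domains: relatively open subsets of a half-space, open sets,
  products\<close>

lemma axis_accessible_relatively_open_half_space:
  fixes k :: "'n::finite"
  assumes "openin (top_of_set (half_space k)) S"
  shows "axis_accessible S"
  unfolding axis_accessible_def
proof (intro ballI allI impI)
  fix x i and e :: real assume *: "x \<in> S" "i \<in> (Basis :: (real ^ 'n) set)" "0 < e"
  obtain T where T: "open T" "S = half_space k \<inter> T" using assms by (auto simp: openin_open)
  then obtain r where r: "0 < r" "ball x r \<subseteq> T" using * open_contains_ball by blast
  \<comment> \<open>A positive step along an axis never lowers a coordinate, so it stays in the
    half-space even when it starts on the boundary.\<close>
  define d where "d = min e r / 2"
  have d: "0 < d" "d < e" "d < r" using r * by (auto simp: d_def min_def)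
  have "x + d *\<^sub>R i \<in> ball x r" using d *(2) by (simp add: dist_norm)
  moreover have "x + d *\<^sub>R i \<in> half_space k"
    using * d T by (auto simp: half_space_def Basis_vec_def axis_def)
  ultimately show "\<exists>d. 0 < \<bar>d\<bar> \<and> \<bar>d\<bar> < e \<and> x + d *\<^sub>R i \<in> S"
    using d T r by (intro exI[of _ d]) auto
qed

lemma axis_accessible_open:
  assumes "open S"
  shows "axis_accessible S"
  unfolding axis_accessible_def
proof (intro ballI allI impI)
  fix x i and e :: real assume *: "x \<in> S" "i \<in> (Basis :: 'a set)" "0 < e"
  obtain r where r: "0 < r" "ball x r \<subseteq> S" using * assms open_contains_ball by blast
  define d where "d = min e r / 2"
  have d: "0 < d" "d < e" "d < r" using r * by (auto simp: d_def min_def)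
  have "x + d *\<^sub>R i \<in> ball x r" using d *(2) by (simp add: dist_norm)
  then show "\<exists>d. 0 < \<bar>d\<bar> \<and> \<bar>d\<bar> < e \<and> x + d *\<^sub>R i \<in> S"
    using d r by (intro exI[of _ d]) auto
qed

lemma axis_accessible_Times:
  assumes "axis_accessible S" "axis_accessible T"
  shows "axis_accessible (S \<times> T)"
  unfolding axis_accessible_def
proof (intro ballI allI impI)
  fix z i and e :: real assume *: "z \<in> S \<times> T" "i \<in> (Basis :: ('a \<times> 'b) set)" "0 < e"
  obtain x y where z: "z = (x, y)" "x \<in> S" "y \<in> T" using * by auto
  consider a where "i = (a, 0)" "a \<in> Basis" | b where "i = (0, b)" "b \<in> Basis"
    using * by (auto simp: Basis_prod_def)
  then show "\<exists>d. 0 < \<bar>d\<bar> \<and> \<bar>d\<bar> < e \<and> z + d *\<^sub>R i \<in> S \<times> T"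
  proof cases
    case 1
    then obtain d where "0 < \<bar>d\<bar>" "\<bar>d\<bar> < e" "x + d *\<^sub>R a \<in> S"
      using assms(1) z *(3) unfolding axis_accessible_def by blast
    then show ?thesis using z 1 by (intro exI[of _ d]) auto
  next
    case 2
    then obtain d where "0 < \<bar>d\<bar>" "\<bar>d\<bar> < e" "y + d *\<^sub>R b \<in> T"
      using assms(2) z *(3) unfolding axis_accessible_def by blast
    then show ?thesis using z 2 by (intro exI[of _ d]) auto
  qed
qed

section \<open>Determinants and inverses of matrix-valued functions\<close>

lemma matrix_inv:
  fixes A :: "real ^ 'n ^ 'n"
  assumes "det A \<noteq> 0"
  shows matrix_inv_right_det: "A ** matrix_inv A = mat 1" and matrix_inv_left_det: "matrix_inv A ** A = mat 1"
proof -
  have "\<exists>B. A ** B = mat 1 \<and> B ** A = mat 1"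
    using assms invertible_det_nz[of A] by (auto simp: invertible_def)
  then have "A ** matrix_inv A = mat 1 \<and> matrix_inv A ** A = mat 1"
    unfolding matrix_inv_def by (rule someI_ex)
  then show "A ** matrix_inv A = mat 1" "matrix_inv A ** A = mat 1" by auto
qed

lemma matrix_inv_transpose:
  fixes A :: "real ^ 'n ^ 'n"
  assumes "det A \<noteq> 0" "transpose A = A"
  shows "transpose (matrix_inv A) = matrix_inv A"
proof -
  have "transpose (matrix_inv A) ** A = mat 1"
    using arg_cong[OF matrix_inv_right_det[OF assms(1)], of transpose] assms(2)
    by (simp add: matrix_transpose_mul transpose_mat)
  then have "transpose (matrix_inv A) ** (A ** matrix_inv A) = matrix_inv A"
    by (simp add: matrix_mul_assoc)
  then show ?thesis by (simp add: matrix_inv_right_det[OF assms(1)])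
qed

text \<open>Cramer's rule. It presents the entries of the inverse as quotients of polynomials in the
  entries of \<open>A\<close>, from which both smoothness and differentiability of the inverse are
  deduced.\<close>

lemma matrix_inv_component:
  fixes A :: "real ^ 'n ^ 'n"
  assumes "det A \<noteq> 0"
  shows "matrix_inv A $ k $ l
    = det (\<chi> i j. if j = k then axis l 1 $ i else A $ i $ j) / det A"
proof -
  have "A *v (matrix_inv A *v axis l 1) = axis l 1"
    by (simp add: matrix_vector_mul_assoc matrix_inv_right_det[OF assms])
  then have "matrix_inv A *v axis l 1 = (\<chi> k. det(\<chi> i j. if j=k then axis l 1 $ i else A$i$j) / det A)"
    using cramer[OF assms] by blast
  then have "(matrix_inv A *v axis l 1) $ k = det(\<chi> i j. if j=k then axis l 1 $ i else A$i$j) / det A"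
    by simp
  then show ?thesis by (simp add: matrix_vector_mult_basis column_def)
qed

lemma smooth_on_det:
  fixes A :: "'a::euclidean_space \<Rightarrow> real ^ 'n ^ 'n"
  assumes "\<And>i j. smooth_on S (\<lambda>x. A x $ i $ j)"
  shows "smooth_on S (\<lambda>x. det (A x))"
  unfolding det_def by (intro smooth_on_sum smooth_on_mult smooth_on_const smooth_on_prod assms)

lemma smooth_on_matrix_inv:
  fixes A :: "'a::euclidean_space \<Rightarrow> real ^ 'n ^ 'n"
  assumes A: "\<And>i j. smooth_on S (\<lambda>x. A x $ i $ j)" and nz: "\<And>x. x \<in> S \<Longrightarrow> det (A x) \<noteq> 0"
  shows "smooth_on S (\<lambda>x. matrix_inv (A x) $ k $ l)"
proof -
  have "smooth_on S (\<lambda>x. if j = k then axis l 1 $ i else A x $ i $ j)" for i j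
    using A by (cases "j = k") (auto intro: smooth_on_const)
  then have "smooth_on S (\<lambda>x. det (\<chi> i j. if j = k then axis l 1 $ i else A x $ i $ j) * inverse (det (A x)))"
    using nz by (intro smooth_on_mult smooth_on_det smooth_on_inverse A) auto
  then show ?thesis
    by (rule smooth_on_cong) (simp add: matrix_inv_component[OF nz] divide_inverse)
qed

section \<open>Positive definite and semidefinite matrices\<close>

lemma pos_def_det_nonzero:
  fixes A :: "real ^ 'n ^ 'n"
  assumes "\<And>v. v \<noteq> 0 \<Longrightarrow> 0 < v \<bullet> (A *v v)"
  shows "det A \<noteq> 0"
proof -
  have "\<forall>x. A *v x = 0 \<longrightarrow> x = 0" using assms by force
  then show ?thesis
    by (metis invertible_det_nz invertible_left_inverse matrix_left_invertible_ker)
qed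

text \<open>The determinant does not vanish on the segment from the identity to \<open>A\<close>.\<close>

lemma pos_def_det_pos:
  fixes A :: "real ^ 'n ^ 'n"
  assumes A: "\<And>v. v \<noteq> 0 \<Longrightarrow> 0 < v \<bullet> (A *v v)"
  shows "0 < det A"
proof (rule ccontr)
  define B :: "real \<Rightarrow> real ^ 'n ^ 'n" where "B s = (1 - s) *\<^sub>R mat 1 + s *\<^sub>R A" for s
  assume "\<not> 0 < det A"
  moreover have "B 0 = mat 1" "B 1 = A" by (auto simp: B_def)
  moreover have "continuous_on {0..1} (\<lambda>s. det (B s))"
    unfolding det_def B_def by (auto intro!: continuous_intros)
  ultimately obtain s where s: "0 \<le> s" "s \<le> 1" "det (B s) = 0"
    using IVT2'[of "\<lambda>s. det (B s)" 1 0 0] by (auto simp: not_less)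
  have "0 < v \<bullet> (B s *v v)" if "v \<noteq> 0" for v
  proof -
    have "v \<bullet> (B s *v v) = (1 - s) * (v \<bullet> v) + s * (v \<bullet> (A *v v))"
      by (simp add: B_def matrix_vector_mult_add_rdistrib scaleR_matrix_vector_assoc[symmetric] inner_add_right)
    moreover have "0 < (1 - s) * (v \<bullet> v) + s * (v \<bullet> (A *v v))"
      using s A[OF that] that
      by (cases "s = 0") (auto intro!: add_nonneg_pos)
    ultimately show ?thesis by simp
  qed
  from pos_def_det_nonzero[OF this] s show False by simp
qed

lemma trace_matrix_mul: "trace (A ** B) = (\<Sum>i\<in>UNIV. \<Sum>j\<in>UNIV. A $ i $ j * B $ j $ (i :: 'n::finite))"
  by (simp add: trace_def matrix_matrix_mult_def)

text \<open>A Cholesky decomposition, obtained by eliminating one nonzero diagonal entry at a time.\<close>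

lemma pos_semidef_sum_squares:
  fixes X :: "real ^ 'n ^ 'n"
  assumes "transpose X = X" "\<And>v. 0 \<le> v \<bullet> (X *v v)"
  shows "\<exists>ws :: (real ^ 'n) list. \<forall>i j. X $ i $ j = (\<Sum>w\<leftarrow>ws. w $ i * w $ j)"
  using assms
proof (induction "card {i. X $ i $ i \<noteq> 0}" arbitrary: X rule: less_induct)
  case less
  have sym: "v \<bullet> (X *v w) = w \<bullet> (X *v v)" for v w
    using less.prems(1) dot_lmul_matrix[of v X w] matrix_vector_mul_component
    by (metis inner_commute transpose_matrix_vector)
  have ent: "axis i 1 \<bullet> (X *v axis j 1) = X $ i $ j" for i j
    by (simp add: inner_axis' matrix_vector_mult_basis column_def)
  have quad: "(v + s *\<^sub>R w) \<bullet> (X *v (v + s *\<^sub>R w))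
      = v \<bullet> (X *v v) + 2 * s * (v \<bullet> (X *v w)) + s\<^sup>2 * (w \<bullet> (X *v w))" for v w s
    using sym[of w v]
    by (simp add: matrix_vector_right_distrib matrix_vector_mult_scaleR inner_add_left inner_add_right
        power2_eq_square algebra_simps)
  have zero: "X $ i $ j = 0" if "X $ i $ i = 0" for i j
  proof (rule ccontr)
    assume nz: "X $ i $ j \<noteq> 0"
    \<comment> \<open>With \<open>X $ i $ i = 0\<close> the quadratic form along
      \<open>axis j 1 + s *\<^sub>R axis i 1\<close> is affine in \<open>s\<close>; this choice
      makes its value \<open>- 1\<close>, contradicting semidefiniteness.\<close>
    define s where "s = - (X $ j $ j + 1) / (2 * X $ j $ i)"
    have ji: "X $ j $ i = X $ i $ j" using sym[of "axis j 1" "axis i 1"] by (simp add: ent)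
    have "0 \<le> X $ j $ j + 2 * s * X $ j $ i"
      using less.prems(2)[of "axis j 1 + s *\<^sub>R axis i 1"] quad[of "axis j 1" s "axis i 1"] that
      by (simp add: ent)
    moreover have "2 * s * X $ j $ i = - (X $ j $ j + 1)"
      using nz ji by (simp add: s_def)
    ultimately show False by simp
  qed
  show ?case
  proof (cases "\<exists>i. X $ i $ i \<noteq> 0")
    case False
    then show ?thesis using zero by (intro exI[of _ "[]"]) auto
  next
    case True
    then obtain a where a: "X $ a $ a \<noteq> 0" by blast
    then have apos: "0 < X $ a $ a" using less.prems(2)[of "axis a 1"] by (simp add: ent)
    \<comment> \<open>The pivot column, scaled so that subtracting the rank-one matrix of
      \<open>w\<close> clears the diagonal entry at \<open>a\<close>.\<close>
    define w :: "real ^ 'n" where "w = (\<chi> i. X $ i $ a / sqrt (X $ a $ a))"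
    define Y :: "real ^ 'n ^ 'n" where "Y = (\<chi> i j. X $ i $ j - w $ i * w $ j)"
    have ww: "w $ i * w $ j = X $ i $ a * X $ j $ a / X $ a $ a" for i j
      using apos by (simp add: w_def field_simps)
    have "{i. Y $ i $ i \<noteq> 0} \<subset> {i. X $ i $ i \<noteq> 0}"
    proof -
      have "Y $ i $ i = 0" if "X $ i $ i = 0" for i
        using zero[OF that] that by (simp add: Y_def ww)
      moreover have "Y $ a $ a = 0" using a by (simp add: Y_def ww)
      ultimately show ?thesis using a by blast
    qed
    then have "card {i. Y $ i $ i \<noteq> 0} < card {i. X $ i $ i \<noteq> 0}"
      by (intro psubset_card_mono) auto
    moreover have "transpose Y = Y"
      using less.prems(1) by (simp add: Y_def transpose_def vec_eq_iff mult.commute)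
    moreover have "0 \<le> v \<bullet> (Y *v v)" for v
    proof -
      define b where "b = v \<bullet> (X *v axis a 1)"
      have wv: "w \<bullet> v = b / sqrt (X $ a $ a)"
        by (simp add: b_def w_def inner_vec_def matrix_vector_mult_basis column_def
            sum_divide_distrib mult.commute)
      have "Y *v v = X *v v - (w \<bullet> v) *\<^sub>R w"
        by (simp add: Y_def vec_eq_iff matrix_vector_mult_def inner_vec_def left_diff_distrib right_diff_distrib
            sum_subtractf sum_distrib_left sum_distrib_right mult_ac)
      then have "v \<bullet> (Y *v v) = v \<bullet> (X *v v) - (w \<bullet> v)\<^sup>2"
        by (simp add: inner_diff_right power2_eq_square inner_commute)
      also have "\<dots> = v \<bullet> (X *v v) - b\<^sup>2 / X $ a $ a"
        using apos by (simp add: wv power_divide)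
      \<comment> \<open>Completing the square: \<open>- b / X $ a $ a\<close> is the shift along
        \<open>axis a 1\<close> at which the quadratic form of \<open>X\<close> is minimal, and the
        form of \<open>Y\<close> at \<open>v\<close> is that minimum.\<close>
      also have "\<dots> = (v + (- b / X $ a $ a) *\<^sub>R axis a 1) \<bullet> (X *v (v + (- b / X $ a $ a) *\<^sub>R axis a 1))"
        unfolding quad ent b_def[symmetric] using a by (simp add: field_simps power2_eq_square)
      finally show ?thesis using less.prems(2) by simp
    qed
    ultimately obtain ws :: "(real ^ 'n) list" where "\<forall>i j. Y $ i $ j = (\<Sum>w\<leftarrow>ws. w $ i * w $ j)"
      using less.hyps by blast
    then show ?thesis by (intro exI[of _ "w # ws"]) (simp add: Y_def algebra_simps)
  qed
qed

text \<open>Once \<open>X\<close> is a sum of rank-one matrices built from vectors \<open>w\<close>,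
  the trace becomes the sum of the numbers \<open>w \<bullet> (Y *v w)\<close>.\<close>

lemma trace_mul_pos_semidef:
  fixes X Y :: "real ^ 'n ^ 'n"
  assumes "transpose X = X" "\<And>v. 0 \<le> v \<bullet> (X *v v)" "\<And>v. 0 \<le> v \<bullet> (Y *v v)"
  shows "0 \<le> trace (X ** Y)"
proof -
  obtain ws :: "(real ^ 'n) list" where ws: "\<And>i j. X $ i $ j = (\<Sum>w\<leftarrow>ws. w $ i * w $ j)"
    using pos_semidef_sum_squares[OF assms(1,2)] by blast
  have "trace (X ** Y) = (\<Sum>i\<in>UNIV. \<Sum>j\<in>UNIV. \<Sum>w\<leftarrow>ws. w $ i * w $ j * Y $ j $ i)"
    by (simp add: trace_matrix_mul ws sum_list_mult_const)
  also have "\<dots> = (\<Sum>w\<leftarrow>ws. \<Sum>i\<in>UNIV. \<Sum>j\<in>UNIV. w $ i * w $ j * Y $ j $ i)"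
    by (induction ws) (simp_all add: sum.distrib)
  also have "\<dots> = (\<Sum>w\<leftarrow>ws. w \<bullet> (Y *v w))"
    by (intro arg_cong[where f = sum_list] map_cong refl, subst sum.swap)
      (simp add: inner_vec_def matrix_vector_mult_def sum_distrib_left mult_ac)
  also have "\<dots> \<ge> 0" using assms(3) by (intro sum_list_nonneg) auto
  finally show ?thesis .
qed

text \<open>Substituting \<open>v = G *v w\<close> turns the form of the inverse at \<open>v\<close>
  into the form of \<open>G\<close> at \<open>w\<close>.\<close>

lemma pos_def_matrix_inv_pos_semidef:
  fixes G :: "real ^ 'n ^ 'n"
  assumes "\<And>v. v \<noteq> 0 \<Longrightarrow> 0 < v \<bullet> (G *v v)"
  shows "0 \<le> v \<bullet> (matrix_inv G *v v)"
proof -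
  define w where "w = matrix_inv G *v v"
  have "G *v w = v"
    by (simp add: w_def matrix_vector_mul_assoc matrix_inv_right_det[OF pos_def_det_nonzero[OF assms]])
  moreover have "0 \<le> w \<bullet> (G *v w)" using assms[of w] by (cases "w = 0") auto
  ultimately show ?thesis by (simp add: w_def inner_commute)
qed

text \<open>Bracketing the product as \<open>matrix_inv G\<close> times
  \<open>H ** matrix_inv G ** H\<close> exhibits it as a product of two semidefinite matrices,
  although \<open>matrix_inv G ** H\<close> itself need not be symmetric.\<close>

lemma trace_square_nonneg:
  fixes G H :: "real ^ 'n ^ 'n"
  assumes G: "transpose G = G" "\<And>v. v \<noteq> 0 \<Longrightarrow> 0 < v \<bullet> (G *v v)" and H: "transpose H = H"
  shows "0 \<le> trace ((matrix_inv G ** H) ** (matrix_inv G ** H))"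
proof -
  note nz = pos_def_det_nonzero[OF G(2)]
  have "0 \<le> v \<bullet> ((H ** matrix_inv G ** H) *v v)" for v
  proof -
    have "v \<bullet> ((H ** matrix_inv G ** H) *v v) = (transpose H *v v) \<bullet> (matrix_inv G *v (H *v v))"
      by (simp add: matrix_vector_mul_assoc[symmetric] dot_lmul_matrix[symmetric] transpose_matrix_vector)
    then show ?thesis using pos_def_matrix_inv_pos_semidef[OF G(2)] H by simp
  qed
  then have "0 \<le> trace (matrix_inv G ** (H ** matrix_inv G ** H))"
    using matrix_inv_transpose[OF nz G(1)] pos_def_matrix_inv_pos_semidef[OF G(2)]
    by (intro trace_mul_pos_semidef) auto
  then show ?thesis by (simp add: matrix_mul_assoc)
qed

section \<open>Derivatives of determinants and inverses along a curve of matrices\<close>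

lemma DERIV_det:
  fixes A :: "real \<Rightarrow> real ^ 'n ^ 'n" and A' :: "real ^ 'n ^ 'n"
  assumes "\<And>i j. ((\<lambda>t. A t $ i $ j) has_real_derivative A' $ i $ j) (at t)"
  shows "((\<lambda>t. det (A t)) has_real_derivative
    (\<Sum>k\<in>UNIV. det (\<chi> i. if i = k then A' $ i else A t $ i))) (at t)"
proof -
  have "det (\<chi> i. if i = k then A' $ i else A t $ i)
      = (\<Sum>p | p permutes UNIV. of_int (sign p) * (A' $ k $ p k * (\<Prod>i\<in>UNIV - {k}. A t $ i $ p i)))" for k
  proof -
    have "(\<Prod>i\<in>UNIV. (\<chi> i. if i = k then A' $ i else A t $ i) $ i $ p i)
        = A' $ k $ p k * (\<Prod>i\<in>UNIV - {k}. A t $ i $ p i)" for p :: "'n \<Rightarrow> 'n"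
      by (subst prod.remove[of UNIV k]) auto
    then show ?thesis unfolding det_def by simp
  qed
  then have "(\<Sum>k\<in>UNIV. det (\<chi> i. if i = k then A' $ i else A t $ i))
      = (\<Sum>p | p permutes UNIV. of_int (sign p) * (\<Sum>k\<in>UNIV. A' $ k $ p k * (\<Prod>i\<in>UNIV - {k}. A t $ i $ p i)))"
    by (simp add: sum_distrib_left) (rule sum.swap)
  moreover have "((\<lambda>t. det (A t)) has_real_derivative
    (\<Sum>p | p permutes UNIV. of_int (sign p) * (\<Sum>k\<in>UNIV. A' $ k $ p k * (\<Prod>i\<in>UNIV - {k}. A t $ i $ p i)))) (at t)"
    unfolding det_def
    by (intro DERIV_sum DERIV_cmult has_field_derivative_prod assms)
  ultimately show ?thesis by simp
qed

lemma matrix_mul_row: "((B :: 'a::comm_semiring_1 ^ 'm ^ 'n) ** A) $ i = (\<Sum>j\<in>UNIV. B $ i $ j *s row j A)"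
  by (simp add: vec_eq_iff matrix_matrix_mult_def row_def)

lemma matrix_add_rdistrib: "((A :: real ^ 'm ^ 'n) + B) ** C = A ** C + B ** C"
  by (simp add: vec_eq_iff matrix_matrix_mult_def distrib_right sum.distrib)

text \<open>Jacobi's formula. Writing \<open>A' = B ** A t\<close> makes each row of
  \<open>A'\<close> a combination of the rows of \<open>A t\<close>; after replacing row
  \<open>k\<close>, only the multiple \<open>B $ k $ k\<close> of that row itself contributes to the
  determinant.\<close>

lemma DERIV_det_trace:
  fixes A :: "real \<Rightarrow> real ^ 'n ^ 'n" and A' :: "real ^ 'n ^ 'n"
  assumes "\<And>i j. ((\<lambda>t. A t $ i $ j) has_real_derivative A' $ i $ j) (at t)" "det (A t) \<noteq> 0"
  shows "((\<lambda>t. det (A t)) has_real_derivative det (A t) * trace (matrix_inv (A t) ** A')) (at t)"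
proof -
  let ?B = "A' ** matrix_inv (A t)"
  have "?B ** A t = A'" by (simp add: matrix_mul_assoc[symmetric] matrix_inv_left_det[OF assms(2)])
  then have row: "A' $ i = (\<Sum>j\<in>UNIV. (?B $ i) $ j *s row j (A t))" for i
    using matrix_mul_row[of ?B "A t" i] by simp
  have "det (\<chi> i. if i = k then A' $ i else A t $ i) = ?B $ k $ k * det (A t)" for k
  proof -
    have "(\<chi> i. if i = k then A' $ i else A t $ i)
        = (\<chi> i. if i = k then \<Sum>j\<in>UNIV. (?B $ k) $ j *s row j (A t) else row i (A t))"
      unfolding row[symmetric] by (simp add: vec_eq_iff row_def)
    then show ?thesis using cramer_lemma_transpose[of k "?B $ k" "A t"] by simp
  qed
  then have "(\<Sum>k\<in>UNIV. det (\<chi> i. if i = k then A' $ i else A t $ i)) = det (A t) * trace ?B"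
    by (simp add: trace_def sum_distrib_left mult.commute)
  then show ?thesis using DERIV_det[OF assms(1)] by (simp add: trace_mul_sym[of "matrix_inv (A t)"])
qed

text \<open>Existence of the derivative comes from Cramer's rule, and its value from differentiating
  the constant product of \<open>matrix_inv (A s)\<close> with \<open>A s\<close>.\<close>

lemma DERIV_matrix_inv:
  fixes A :: "real \<Rightarrow> real ^ 'n ^ 'n" and A' :: "real ^ 'n ^ 'n"
  assumes A: "\<And>i j. ((\<lambda>t. A t $ i $ j) has_real_derivative A' $ i $ j) (at t)"
    and nz: "open I" "t \<in> I" "\<And>s. s \<in> I \<Longrightarrow> det (A s) \<noteq> 0"
  shows "((\<lambda>s. matrix_inv (A s) $ k $ l) has_real_derivative
    - (matrix_inv (A t) ** A' ** matrix_inv (A t)) $ k $ l) (at t)"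
proof -
  have "\<exists>D. ((\<lambda>s. matrix_inv (A s) $ k $ l) has_real_derivative D) (at t)" for k l
  proof -
    let ?C = "\<lambda>s. \<chi> i j. if j = k then axis l 1 $ i else A s $ i $ j"
    have "((\<lambda>s. ?C s $ i $ j) has_real_derivative (\<chi> i j. if j = k then 0 else A' $ i $ j) $ i $ j) (at t)" for i j
      using A by simp
    from DERIV_divide[OF DERIV_det[OF this] DERIV_det[OF A] nz(3)[OF nz(2)]]
    obtain D where "((\<lambda>s. det (?C s) / det (A s)) has_real_derivative D) (at t)" by blast
    then have "((\<lambda>s. matrix_inv (A s) $ k $ l) has_real_derivative D) (at t)"
      by (rule has_field_derivative_transform_within_open[OF _ nz(1,2)]) (simp add: matrix_inv_component nz(3))
    then show ?thesis by blast
  qed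
  then obtain D where D: "\<And>k l. ((\<lambda>s. matrix_inv (A s) $ k $ l) has_real_derivative D k l) (at t)"
    by metis
  define E :: "real ^ 'n ^ 'n" where "E = (\<chi> k l. D k l)"
  have "(E ** A t + matrix_inv (A t) ** A') $ i $ j = 0" for i j
  proof (rule DERIV_unique)
    have "((\<lambda>s. \<Sum>k\<in>UNIV. matrix_inv (A s) $ i $ k * A s $ k $ j) has_real_derivative
        (\<Sum>k\<in>UNIV. D i k * A t $ k $ j + A' $ k $ j * matrix_inv (A t) $ i $ k)) (at t)"
      by (intro DERIV_sum DERIV_mult D A)
    then show "((\<lambda>s. \<Sum>k\<in>UNIV. matrix_inv (A s) $ i $ k * A s $ k $ j) has_real_derivative
        (E ** A t + matrix_inv (A t) ** A') $ i $ j) (at t)"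
      by (simp add: E_def matrix_matrix_mult_def sum.distrib mult.commute)
    have "(\<Sum>k\<in>UNIV. matrix_inv (A s) $ i $ k * A s $ k $ j) = mat 1 $ i $ j" if "s \<in> I" for s
      using matrix_inv_left_det[OF nz(3)[OF that]] by (metis (no_types, lifting) matrix_matrix_mult_def sum.cong vec_lambda_beta)
    then show "((\<lambda>s. \<Sum>k\<in>UNIV. matrix_inv (A s) $ i $ k * A s $ k $ j) has_real_derivative 0) (at t)"
      by (intro has_field_derivative_transform_within_open[OF DERIV_const[of "mat 1 $ i $ j"] nz(1,2)]) simp
  qed
  then have "E ** A t + matrix_inv (A t) ** A' = 0" by (simp add: vec_eq_iff)
  then have "(E ** A t + matrix_inv (A t) ** A') ** matrix_inv (A t) = 0" by simp
  then have "E + matrix_inv (A t) ** A' ** matrix_inv (A t) = 0"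
    using matrix_inv_right_det[OF nz(3)[OF nz(2)]]
    by (simp add: matrix_add_rdistrib matrix_mul_assoc[symmetric])
  then have "E = - (matrix_inv (A t) ** A' ** matrix_inv (A t))" by (simp add: eq_neg_iff_add_eq_0)
  then have "D k l = - (matrix_inv (A t) ** A' ** matrix_inv (A t)) $ k $ l"
    by (metis E_def vec_lambda_beta vector_uminus_component)
  then show ?thesis using D[of k l] by simp
qed

lemma DERIV_sqrt_det:
  fixes A :: "real \<Rightarrow> real ^ 'n ^ 'n" and A' :: "real ^ 'n ^ 'n"
  assumes "\<And>i j. ((\<lambda>t. A t $ i $ j) has_real_derivative A' $ i $ j) (at t)" "0 < det (A t)"
  shows "((\<lambda>t. sqrt (det (A t))) has_real_derivative
    sqrt (det (A t)) * trace (matrix_inv (A t) ** A') / 2) (at t)"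
proof -
  have "((\<lambda>t. sqrt (det (A t))) has_real_derivative
    inverse (sqrt (det (A t))) / 2 * (det (A t) * trace (matrix_inv (A t) ** A'))) (at t)"
    by (rule DERIV_chain2[OF DERIV_real_sqrt[OF assms(2)] DERIV_det_trace[OF assms(1)]])
      (use assms(2) in auto)
  moreover have "inverse (sqrt (det (A t))) * det (A t) = sqrt (det (A t))"
    using assms(2) by (simp add: field_simps)
  ultimately show ?thesis by (simp add: mult.assoc[symmetric])
qed

text \<open>This differentiates the first-order formula of \<open>DERIV_sqrt_det\<close> once more.
  The term with \<open>(trace B)\<^sup>2\<close> comes from the factor
  \<open>sqrt (det (A s))\<close>, the term with \<open>trace (B ** B)\<close> from the inverse, and
  the last one from \<open>A' s\<close>.\<close>

lemma second_derivative_sqrt_det: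
  fixes A A' :: "real \<Rightarrow> real ^ 'n ^ 'n" and A'' :: "real ^ 'n ^ 'n"
  assumes A: "\<And>s i j. s \<in> I \<Longrightarrow> ((\<lambda>t. A t $ i $ j) has_real_derivative A' s $ i $ j) (at s)"
    and A': "\<And>i j. ((\<lambda>t. A' t $ i $ j) has_real_derivative A'' $ i $ j) (at t)"
    and I: "open I" "t \<in> I" and pos: "\<And>s. s \<in> I \<Longrightarrow> 0 < det (A s)"
  defines "B \<equiv> matrix_inv (A t) ** A' t"
  shows "((\<lambda>s. sqrt (det (A s)) * trace (matrix_inv (A s) ** A' s) / 2) has_real_derivative
    sqrt (det (A t)) * ((trace B)\<^sup>2 / 4 - trace (B ** B) / 2 + trace (matrix_inv (A t) ** A'') / 2)) (at t)"
proof -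
  have nz: "\<And>s. s \<in> I \<Longrightarrow> det (A s) \<noteq> 0" using pos by force
  note inv = DERIV_matrix_inv[OF A[OF I(2)] I nz]
  have "((\<lambda>s. trace (matrix_inv (A s) ** A' s)) has_real_derivative
      (\<Sum>i\<in>UNIV. \<Sum>j\<in>UNIV. - (matrix_inv (A t) ** A' t ** matrix_inv (A t)) $ i $ j * A' t $ j $ i
        + A'' $ j $ i * matrix_inv (A t) $ i $ j)) (at t)"
    unfolding trace_matrix_mul by (intro DERIV_sum DERIV_mult inv A')
  moreover have "(\<Sum>i\<in>UNIV. \<Sum>j\<in>UNIV. - (matrix_inv (A t) ** A' t ** matrix_inv (A t)) $ i $ j * A' t $ j $ i
        + A'' $ j $ i * matrix_inv (A t) $ i $ j) = - trace (B ** B) + trace (matrix_inv (A t) ** A'')"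
    by (simp add: B_def matrix_mul_assoc trace_matrix_mul[of _ "A' t"] trace_matrix_mul[of _ A''] sum.distrib
        sum_negf sum_subtractf mult.commute)
  ultimately have tr: "((\<lambda>s. trace (matrix_inv (A s) ** A' s)) has_real_derivative
      - trace (B ** B) + trace (matrix_inv (A t) ** A'')) (at t)" by simp
  have "((\<lambda>s. sqrt (det (A s)) * trace (matrix_inv (A s) ** A' s) / 2) has_real_derivative
     (sqrt (det (A t)) * trace B / 2 * trace B + (- trace (B ** B) + trace (matrix_inv (A t) ** A'')) * sqrt (det (A t))) / 2) (at t)"
    unfolding B_def
    by (intro DERIV_cdivide DERIV_mult DERIV_sqrt_det A[OF I(2)] pos[OF I(2)] tr[unfolded B_def])
  then show ?thesis by (simp add: field_simps power2_eq_square)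
qed

section \<open>Immersions into the light-cone in coordinates\<close>

lemma bounded_bilinear_lorentz: "bounded_bilinear (lorentz :: 's::finite minkowski \<Rightarrow> _)"
proof -
  have "bilinear (lorentz :: 's minkowski \<Rightarrow> _)"
    unfolding bilinear_def lorentz_def
    by (auto intro!: linearI simp: algebra_simps inner_add_left inner_add_right)
  then show ?thesis by (simp add: bilinear_conv_bounded_bilinear)
qed

interpretation lorentz: bounded_bilinear lorentz
  by (rule bounded_bilinear_lorentz)

lemma lorentz_commute: "lorentz x y = lorentz y x"
  by (simp add: lorentz_def inner_commute mult.commute)

lemmas smooth_on_lorentz = smooth_on_bilinear[OF bounded_bilinear_lorentz]
  and dderiv_lorentz = dderiv_bilinear[OF bounded_bilinear_lorentz]

lemma dderiv_component_expansion:
  fixes f :: "real ^ 'n \<Rightarrow> 'b::real_normed_vector"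
  assumes "f differentiable (at x within S)"
  shows "dderiv S v f x = (\<Sum>i\<in>UNIV. (v $ i) *\<^sub>R dderiv S (axis i 1) f x)"
proof -
  interpret linear "\<lambda>v. dderiv S v f x"
    using has_derivative_dderiv[OF assms] by (rule has_derivative_linear)
  have "dderiv S v f x = dderiv S (\<Sum>i\<in>UNIV. (v $ i) *\<^sub>R axis i 1) f x"
    using basis_expansion[of v] by (simp add: scalar_mult_eq_scaleR)
  then show ?thesis by (simp add: sum scaleR)
qed

text \<open>Applied to the constant products of \<open>P\<close>, \<open>Q\<close> and
  \<open>D i P\<close>, it yields the orthogonality relations below.\<close>

lemma dderiv_eq_0:
  assumes "axis_accessible S" "x \<in> S" "\<And>y. y \<in> S \<Longrightarrow> f y = c"
  shows "dderiv S v f x = 0"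
proof -
  have "dderiv S v (\<lambda>_. c) x = dderiv S v f x"
    by (rule dderiv_cong[OF assms(1,2)]) (simp_all add: assms(3))
  then show ?thesis by (simp add: dderiv_const[OF assms(1,2)])
qed

text \<open>Here \<open>P\<close> and \<open>Q\<close> are the immersion and its dual map read in a chart with image \<open>S\<close>.\<close>

locale light_cone_patch =
  fixes S :: "(real ^ 'n::finite) set" and P Q :: "real ^ 'n \<Rightarrow> 's::finite minkowski"
    and g :: "real ^ 'n \<Rightarrow> real ^ 'n ^ 'n"
  assumes acc: "axis_accessible S"
    and smooth_P: "smooth_on S P" and smooth_Q: "smooth_on S Q"
    and P_P: "\<And>u. u \<in> S \<Longrightarrow> lorentz (P u) (P u) = 0"
    and Q_Q: "\<And>u. u \<in> S \<Longrightarrow> lorentz (Q u) (Q u) = 0"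
    and P_Q: "\<And>u. u \<in> S \<Longrightarrow> lorentz (P u) (Q u) = 1"
    and dP_Q: "\<And>u v. u \<in> S \<Longrightarrow> lorentz (dderiv S v P u) (Q u) = 0"
    and spacelike: "\<And>u v. u \<in> S \<Longrightarrow> v \<noteq> 0 \<Longrightarrow> 0 < lorentz (dderiv S v P u) (dderiv S v P u)"
    and g_eq: "\<And>u i j. u \<in> S \<Longrightarrow>
      g u $ i $ j = lorentz (dderiv S (axis i 1) P u) (dderiv S (axis j 1) P u)"
    and codimension: "CARD('s) = CARD('n) + 1"
begin

abbreviation D :: "'n \<Rightarrow> (real ^ 'n \<Rightarrow> 'b::real_normed_vector) \<Rightarrow> real ^ 'n \<Rightarrow> 'b" where
  "D i f \<equiv> dderiv S (axis i 1) f"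

abbreviation g_inv :: "real ^ 'n \<Rightarrow> real ^ 'n ^ 'n" where
  "g_inv u \<equiv> matrix_inv (g u)"

definition h :: "real ^ 'n \<Rightarrow> real ^ 'n ^ 'n" where
  "h u = (\<chi> i j. lorentz (D i (D j P) u) (Q u))"

text \<open>The coefficients of the tangential projection of \<open>w\<close> in the basis
  \<open>D l P u\<close>: pairing such a combination with every \<open>D m P u\<close> gives a
  linear system with matrix \<open>g u\<close>, solved here by the inverse metric.\<close>

definition tangent_coord :: "real ^ 'n \<Rightarrow> 's minkowski \<Rightarrow> 'n \<Rightarrow> real" where
  "tangent_coord u w l = (\<Sum>m\<in>UNIV. g_inv u $ l $ m * lorentz w (D m P u))"

text \<open>Connection coefficients defined extrinsically, so that they are by construction the
  tangential part of the Gauss formula. Their agreement with the intrinsic Christoffel symbols is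
  \<open>christoffel_eq_\<Gamma>\<close>.\<close>

definition \<Gamma> :: "'n \<Rightarrow> 'n \<Rightarrow> 'n \<Rightarrow> real ^ 'n \<Rightarrow> real" where
  "\<Gamma> l i j u = tangent_coord u (D i (D j P) u) l"

lemma smooth_D: "smooth_on S f \<Longrightarrow> smooth_on S (D i f)"
  by (rule smooth_on_dderiv[OF acc])

lemmas smooth_intros = smooth_P smooth_Q smooth_D

section \<open>Orthogonality relations and the frame\<close>

lemma D_lorentz:
  "smooth_on S f \<Longrightarrow> smooth_on S f' \<Longrightarrow> u \<in> S \<Longrightarrow>
    D i (\<lambda>w. lorentz (f w) (f' w)) u = lorentz (f u) (D i f' u) + lorentz (D i f u) (f' u)"
  by (intro dderiv_lorentz acc smooth_on_differentiable)

lemma DP_Q: "u \<in> S \<Longrightarrow> lorentz (D i P u) (Q u) = 0"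
  by (rule dP_Q)

lemma DP_P:
  assumes "u \<in> S"
  shows "lorentz (D i P u) (P u) = 0"
  using D_lorentz[OF smooth_P smooth_P assms, of i] dderiv_eq_0[OF acc assms P_P]
  by (simp add: lorentz_commute)

lemma DDP_commute: "u \<in> S \<Longrightarrow> D i (D j P) u = D j (D i P) u"
  by (rule dderiv_commute[OF acc smooth_P])

lemma DDP_P:
  assumes "u \<in> S"
  shows "lorentz (D i (D j P) u) (P u) = - g u $ i $ j"
  using D_lorentz[OF smooth_D[OF smooth_P] smooth_P assms, of i j] dderiv_eq_0[OF acc assms DP_P]
  by (simp add: g_eq[OF assms] lorentz_commute)

lemma DP_DQ:
  assumes "u \<in> S"
  shows "lorentz (D j P u) (D i Q u) = - h u $ i $ j"
  using D_lorentz[OF smooth_D[OF smooth_P] smooth_Q assms, of i j] dderiv_eq_0[OF acc assms DP_Q]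
  by (simp add: h_def)

lemma DQ_Q:
  assumes "u \<in> S"
  shows "lorentz (D i Q u) (Q u) = 0"
  using D_lorentz[OF smooth_Q smooth_Q assms, of i] dderiv_eq_0[OF acc assms Q_Q]
  by (simp add: lorentz_commute)

lemma DQ_P:
  assumes "u \<in> S"
  shows "lorentz (D i Q u) (P u) = 0"
  using D_lorentz[OF smooth_P smooth_Q assms, of i] dderiv_eq_0[OF acc assms P_Q] DP_Q[OF assms]
  by (simp add: lorentz_commute)

lemma h_commute: "u \<in> S \<Longrightarrow> h u $ i $ j = h u $ j $ i"
  using DDP_commute by (simp add: h_def)

lemma transpose_h: "u \<in> S \<Longrightarrow> transpose (h u) = h u"
  using h_commute by (simp add: transpose_def vec_eq_iff)

lemma g_commute: "u \<in> S \<Longrightarrow> g u $ i $ j = g u $ j $ i"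
  by (simp add: g_eq lorentz_commute)

lemma transpose_g: "u \<in> S \<Longrightarrow> transpose (g u) = g u"
  using g_commute by (simp add: transpose_def vec_eq_iff)

lemma dP_expansion: "u \<in> S \<Longrightarrow> dderiv S v P u = (\<Sum>i\<in>UNIV. (v $ i) *\<^sub>R D i P u)"
  by (intro dderiv_component_expansion smooth_on_differentiable smooth_P)

lemma g_pos:
  assumes "u \<in> S" "v \<noteq> 0"
  shows "0 < v \<bullet> (g u *v v)"
proof -
  have "v \<bullet> (g u *v v) = lorentz (dderiv S v P u) (dderiv S v P u)"
    by (simp add: dP_expansion[OF assms(1), of v] lorentz.sum_left lorentz.sum_right lorentz.scaleR_left
        lorentz.scaleR_right inner_vec_def matrix_vector_mult_def g_eq[OF assms(1)] sum_distrib_left mult_ac lorentz_commute)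
  then show ?thesis using spacelike[OF assms] by simp
qed

lemma g_det: "u \<in> S \<Longrightarrow> det (g u) \<noteq> 0"
  by (rule pos_def_det_nonzero[OF g_pos])

lemma g_inv_g: "u \<in> S \<Longrightarrow> (\<Sum>m\<in>UNIV. g_inv u $ l $ m * g u $ m $ j) = (if l = j then 1 else 0)"
  using arg_cong[OF matrix_inv_left_det[OF g_det], of u "\<lambda>A. A $ l $ j"]
  by (simp add: matrix_matrix_mult_def mat_def)

lemma tangent_coord_DP:
  assumes "u \<in> S"
  shows "tangent_coord u (D k P u) l = (if l = k then 1 else 0)"
  unfolding tangent_coord_def g_eq[OF assms, symmetric]
  using g_inv_g[OF assms, of l k] by (simp add: g_commute[OF assms, of k])

lemma tangent_coord_normal:
  assumes "u \<in> S"
  shows "tangent_coord u (P u) l = 0" "tangent_coord u (Q u) l = 0"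
  using DP_P[OF assms] DP_Q[OF assms] by (simp_all add: tangent_coord_def lorentz_commute[of "P u"] lorentz_commute[of "Q u"])

lemma tangent_coord_linear:
  "tangent_coord u (v + w) l = tangent_coord u v l + tangent_coord u w l"
  "tangent_coord u (v - w) l = tangent_coord u v l - tangent_coord u w l"
  "tangent_coord u (c *\<^sub>R w) l = c * tangent_coord u w l"
  by (simp_all add: tangent_coord_def lorentz.add_left lorentz.diff_left lorentz.scaleR_left
      distrib_left right_diff_distrib sum.distrib sum_subtractf sum_distrib_left mult_ac)

lemma tangent_coord_sum: "tangent_coord u (\<Sum>i\<in>I. f i) l = (\<Sum>i\<in>I. tangent_coord u (f i) l)"
  unfolding tangent_coord_def lorentz.sum_left sum_distrib_left by (rule sum.swap)

text \<open>The vectors \<open>D i P\<close>, \<open>P\<close>, \<open>Q\<close> form a frame: their Gram matrix is nondegenerate, and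
  there are as many of them as the dimension of the ambient space.\<close>

lemma frame_expansion:
  assumes u: "u \<in> S"
  shows "w = (\<Sum>l\<in>UNIV. tangent_coord u w l *\<^sub>R D l P u) + lorentz w (Q u) *\<^sub>R P u + lorentz w (P u) *\<^sub>R Q u"
proof -
  define L :: "(real ^ 'n) \<times> real \<times> real \<Rightarrow> 's minkowski" where
    "L = (\<lambda>(v, a, b). dderiv S v P u + a *\<^sub>R P u + b *\<^sub>R Q u)"
  note lin = has_derivative_linear[OF smooth_on_has_derivative[OF smooth_P u]]
  have "linear L"
    unfolding L_def
    by (rule linearI) (auto simp: linear_add[OF lin] linear_scale[OF lin] algebra_simps)
  have dP_P: "lorentz (dderiv S v P u) (P u) = 0" for v
    by (simp add: dP_expansion[OF u, of v] lorentz.sum_left lorentz.scaleR_left DP_P[OF u])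
  have "inj L"
    unfolding linear_injective_0[OF \<open>linear L\<close>]
  proof (intro allI impI)
    fix z assume "L z = 0"
    then obtain v a b where z: "z = (v, a, b)" and 0: "dderiv S v P u + a *\<^sub>R P u + b *\<^sub>R Q u = 0"
      by (cases z) (auto simp: L_def)
    \<comment> \<open>As \<open>P u\<close> and \<open>Q u\<close> are null with product
      \<open>1\<close> and orthogonal to tangent vectors, pairing with \<open>Q u\<close> isolates
      the coefficient of \<open>P u\<close>, and pairing with \<open>P u\<close> that of
      \<open>Q u\<close>.\<close>
    have "a = 0"
      using arg_cong[OF 0, of "\<lambda>w. lorentz w (Q u)"] dP_Q[OF u] P_Q[OF u] Q_Q[OF u]
      by (simp add: lorentz.add_left lorentz.scaleR_left lorentz.zero_left)
    moreover have "b = 0"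
      using arg_cong[OF 0, of "\<lambda>w. lorentz w (P u)"] dP_P P_Q[OF u] P_P[OF u]
      by (simp add: lorentz.add_left lorentz.scaleR_left lorentz.zero_left lorentz_commute[of "Q u"])
    ultimately have "dderiv S v P u = 0" using 0 by simp
    then have "v = 0" using spacelike[OF u, of v] by (auto simp: lorentz.zero_left)
    with \<open>a = 0\<close> \<open>b = 0\<close> z show "z = 0" by (simp add: zero_prod_def)
  qed
  have "dim (range L) = DIM((real ^ 'n) \<times> real \<times> real)"
    using dim_image_eq[OF \<open>linear L\<close>, of UNIV] \<open>inj L\<close> by (simp add: inj_on_subset)
  then have "dim (range L) = DIM('s minkowski)"
    using codimension by simp
  then have "span (range L) = UNIV" by (simp only: dim_eq_full)
  moreover have "span (range L) = range L"
    using linear_subspace_image[OF \<open>linear L\<close> subspace_UNIV] by (simp add: span_eq_iff)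
  ultimately obtain v a b where w: "w = dderiv S v P u + a *\<^sub>R P u + b *\<^sub>R Q u"
    unfolding L_def by (metis (mono_tags, lifting) UNIV_I case_prod_conv imageE prod.exhaust)
  have "tangent_coord u w l = v $ l" for l
    unfolding w
    by (simp add: tangent_coord_linear tangent_coord_normal[OF u] dP_expansion[OF u, of v] tangent_coord_sum tangent_coord_DP[OF u] if_distrib cong: if_cong)
  moreover have "lorentz w (Q u) = a" "lorentz w (P u) = b"
    using dP_P dP_Q[OF u] P_Q[OF u] Q_Q[OF u] P_P[OF u]
    by (simp_all add: w lorentz.add_left lorentz.scaleR_left lorentz_commute[of "Q u" "P u"])
  ultimately show ?thesis by (simp add: w dP_expansion[OF u, of v])
qed

lemma Gauss_formula:
  "u \<in> S \<Longrightarrow> D i (D j P) u = (\<Sum>l\<in>UNIV. \<Gamma> l i j u *\<^sub>R D l P u) + h u $ i $ j *\<^sub>R P u - g u $ i $ j *\<^sub>R Q u"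
  using frame_expansion[of u "D i (D j P) u"] by (simp add: \<Gamma>_def h_def DDP_P)

lemma tangent_coord_DQ:
  assumes "u \<in> S"
  shows "tangent_coord u (D i Q u) l = - (g_inv u ** h u) $ l $ i"
  using DP_DQ[OF assms, of _ i]
  by (simp add: tangent_coord_def lorentz_commute[of "D i Q u"] matrix_matrix_mult_def sum_negf h_commute[OF assms, of i])

text \<open>Source of the quadratic term in the second time derivative of the metric. Derivatives of
  \<open>Q\<close> are orthogonal to \<open>P\<close> and \<open>Q\<close>, so only the tangential
  part of the frame expansion contributes.\<close>

lemma DQ_DQ:
  assumes u: "u \<in> S"
  shows "lorentz (D i Q u) (D j Q u) = (h u ** g_inv u ** h u) $ i $ j"
proof -
  have "lorentz (D i Q u) (D j Q u) = (\<Sum>l\<in>UNIV. tangent_coord u (D j Q u) l * lorentz (D i Q u) (D l P u))"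
    by (subst frame_expansion[OF u, of "D j Q u"])
      (simp add: DQ_P[OF u] DQ_Q[OF u] lorentz.sum_right lorentz.scaleR_right)
  also have "\<dots> = (\<Sum>l\<in>UNIV. h u $ i $ l * (g_inv u ** h u) $ l $ j)"
    by (simp add: tangent_coord_DQ[OF u] lorentz_commute[of "D i Q u"] DP_DQ[OF u] mult.commute)
  also have "\<dots> = (h u ** (g_inv u ** h u)) $ i $ j"
    by (simp add: matrix_matrix_mult_def[of "h u"])
  finally show ?thesis by (simp add: matrix_mul_assoc)
qed

section \<open>Christoffel symbols and curvature\<close>

lemma smooth_g: "smooth_on S (\<lambda>u. g u $ i $ j)"
  by (rule smooth_on_cong[where f = "\<lambda>u. lorentz (D i P u) (D j P u)"])
    (simp_all add: g_eq smooth_on_lorentz smooth_intros)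

lemma smooth_\<Gamma>: "smooth_on S (\<Gamma> l i j)"
  unfolding \<Gamma>_def[abs_def] tangent_coord_def
  by (intro smooth_on_sum smooth_on_mult smooth_on_matrix_inv smooth_g g_det smooth_on_lorentz smooth_intros)

lemma D_g:
  assumes "u \<in> S"
  shows "D k (\<lambda>w. g w $ i $ j) u = lorentz (D i P u) (D k (D j P) u) + lorentz (D k (D i P) u) (D j P u)"
proof -
  have "D k (\<lambda>w. g w $ i $ j) u = D k (\<lambda>w. lorentz (D i P w) (D j P w)) u"
    by (rule dderiv_cong[OF acc assms g_eq smooth_on_differentiable[OF smooth_g assms]])
  then show ?thesis by (simp add: D_lorentz smooth_intros assms)
qed

text \<open>The Koszul computation: differentiating the entries of \<open>g\<close> gives six
  products, four of which cancel in pairs because second derivatives commute.\<close>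

lemma christoffel_eq_\<Gamma>:
  assumes u: "u \<in> S"
  shows "christoffel S g l i j u = \<Gamma> l i j u"
proof -
  have "D i (\<lambda>w. g w $ j $ m) u + D j (\<lambda>w. g w $ i $ m) u - D m (\<lambda>w. g w $ i $ j) u
      = 2 * lorentz (D i (D j P) u) (D m P u)" for m
    using DDP_commute[OF u, of i j] DDP_commute[OF u, of i m] DDP_commute[OF u, of j m]
    by (simp add: D_g[OF u] lorentz_commute)
  then have "(\<Sum>m\<in>UNIV. g_inv u $ l $ m * (D i (\<lambda>w. g w $ j $ m) u + D j (\<lambda>w. g w $ i $ m) u - D m (\<lambda>w. g w $ i $ j) u))
      = 2 * \<Gamma> l i j u"
    by (simp add: \<Gamma>_def tangent_coord_def sum_distrib_left mult_ac)
  then show ?thesis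
    by (simp add: christoffel_def partial_def dderiv_def[symmetric])
qed

lemma partial_christoffel:
  assumes u: "u \<in> S"
  shows "partial S k (christoffel S g l i j) u = D k (\<Gamma> l i j) u"
proof -
  have "D k (\<Gamma> l i j) u = D k (christoffel S g l i j) u"
    by (rule dderiv_cong[OF acc u christoffel_eq_\<Gamma>[symmetric] smooth_on_differentiable[OF smooth_\<Gamma> u]])
  then show ?thesis by (simp add: partial_def dderiv_def)
qed

text \<open>The outermost and innermost indices are exchanged by three adjacent transpositions:
  inner, outer, inner.\<close>

lemma DDDP_commute:
  assumes u: "u \<in> S"
  shows "D k (D i (D j P)) u = D j (D i (D k P)) u"
proof -
  have 1: "D k (D i (D j P)) u = D k (D j (D i P)) u"
    by (rule dderiv_cong[OF acc u DDP_commute]) (simp_all add: smooth_on_differentiable[OF _ u] smooth_intros)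
  have 2: "D j (D k (D i P)) u = D j (D i (D k P)) u"
    by (rule dderiv_cong[OF acc u DDP_commute]) (simp_all add: smooth_on_differentiable[OF _ u] smooth_intros)
  have "D k (D j (D i P)) u = D j (D k (D i P)) u"
    by (rule dderiv_commute[OF acc smooth_D[OF smooth_P] u])
  with 1 2 show ?thesis by simp
qed

lemma smooth_h: "smooth_on S (\<lambda>u. h u $ i $ j)"
  by (simp add: h_def smooth_on_lorentz smooth_intros)

text \<open>The Gauss formula is differentiated and projected to the tangent space. Derivatives of
  the coefficients of \<open>P\<close> and \<open>Q\<close> give normal vectors and vanish; the
  derivative of \<open>P\<close> leaves the term with \<open>h\<close>, and the derivative of
  \<open>Q\<close> leaves the term with \<open>g\<close>, whose sign is positive because the
  Weingarten formula carries a minus.\<close>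

lemma tangent_coord_DDDP:
  assumes u: "u \<in> S"
  shows "tangent_coord u (D k (D i (D j P)) u) r
    = (\<Sum>l\<in>UNIV. \<Gamma> l i j u * \<Gamma> r k l u) + D k (\<Gamma> r i j) u
      + h u $ i $ j * (if r = k then 1 else 0) + g u $ i $ j * (g_inv u ** h u) $ r $ k"
proof -
  note [simp] = smooth_on_differentiable[OF _ u] smooth_on_sum smooth_on_add smooth_on_scaleR smooth_\<Gamma>
    smooth_h smooth_g smooth_intros smooth_on_const smooth_on_mult
  \<comment> \<open>The subtraction is written as the addition of a multiple, so that the sum and
    product rules alone suffice.\<close>
  have "D k (D i (D j P)) u = D k (\<lambda>u. (\<Sum>l\<in>UNIV. \<Gamma> l i j u *\<^sub>R D l P u) + h u $ i $ j *\<^sub>R P u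
      + (- 1 * g u $ i $ j) *\<^sub>R Q u) u"
    by (rule dderiv_cong[OF acc u]) (simp_all add: Gauss_formula)
  also have "\<dots> = (\<Sum>l\<in>UNIV. \<Gamma> l i j u *\<^sub>R D k (D l P) u + D k (\<Gamma> l i j) u *\<^sub>R D l P u)
     + (h u $ i $ j *\<^sub>R D k P u + D k (\<lambda>u. h u $ i $ j) u *\<^sub>R P u)
     + ((- 1 * g u $ i $ j) *\<^sub>R D k Q u + D k (\<lambda>u. - 1 * g u $ i $ j) u *\<^sub>R Q u)"
    by (simp only: dderiv_add[OF acc u] dderiv_sum[OF acc u] dderiv_scaleR[OF acc u]
        smooth_on_differentiable[OF _ u] smooth_on_sum smooth_on_add smooth_on_scaleR smooth_\<Gamma>
        smooth_h smooth_g smooth_intros smooth_on_const smooth_on_mult)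
  finally show ?thesis
    by (simp add: tangent_coord_linear tangent_coord_sum tangent_coord_DP[OF u] tangent_coord_normal[OF u]
        tangent_coord_DQ[OF u] \<Gamma>_def[of _ k, symmetric] sum.distrib if_distrib cong: if_cong)
qed

text \<open>The Codazzi-type identity \<open>D k (D i (D j P)) = D j (D i (D k P))\<close>, contracted in its
  tangential part, is the Gauss equation for the Ricci tensor.\<close>

lemma ricci_eq:
  assumes u: "u \<in> S"
  shows "ricci S g i j u = (2 - real CARD('n)) * h u $ i $ j - g u $ i $ j * trace (g_inv u ** h u)"
proof -
  let ?A = "g_inv u ** h u"
  have "D k (\<Gamma> k i j) u - D j (\<Gamma> k i k) u + (\<Sum>m\<in>UNIV. \<Gamma> k k m u * \<Gamma> m i j u - \<Gamma> k j m u * \<Gamma> m i k u)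
      = h u $ i $ k * (if k = j then 1 else 0) + g u $ i $ k * ?A $ k $ j - h u $ i $ j - g u $ i $ j * ?A $ k $ k" for k
    using tangent_coord_DDDP[OF u, of k i j k] tangent_coord_DDDP[OF u, of j i k k] DDDP_commute[OF u, of k i j]
    by (simp add: sum_subtractf mult.commute)
  moreover have "\<Gamma> m i k u = \<Gamma> m k i u" for m i k
    using DDP_commute[OF u] by (simp add: \<Gamma>_def)
  ultimately have "ricci S g i j u = (\<Sum>k\<in>UNIV. h u $ i $ k * (if k = j then 1 else 0) + g u $ i $ k * ?A $ k $ j
      - h u $ i $ j - g u $ i $ j * ?A $ k $ k)"
    by (simp add: ricci_def partial_christoffel[OF u] christoffel_eq_\<Gamma>[OF u])
  \<comment> \<open>The Kronecker delta yields one \<open>h u $ i $ j\<close> and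
    \<open>g u ** ?A = h u\<close> a second one, while the summand free of \<open>k\<close> is
    counted \<open>CARD('n)\<close> times: hence the factor \<open>2 - n\<close>.\<close>
  also have "\<dots> = h u $ i $ j + (g u ** ?A) $ i $ j - real CARD('n) * h u $ i $ j - g u $ i $ j * trace ?A"
  proof -
    have "h u $ i $ k * (if k = j then 1 else 0) = (if k = j then h u $ i $ j else 0)" for k by simp
    then show ?thesis
      by (simp add: sum.distrib sum_subtractf trace_def sum_distrib_left matrix_matrix_mult_def[of "g u"])
  qed
  also have "g u ** ?A = h u"
    by (simp add: matrix_mul_assoc matrix_inv_right_det[OF g_det[OF u]])
  finally show ?thesis by (simp add: algebra_simps)
qed

text \<open>Contracting the Ricci tensor adds \<open>- n tr A\<close> to
  \<open>(2 - n) tr A\<close>. The resulting factor \<open>2 - 2 n\<close> is nonzero in dimension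
  at least two, so vanishing scalar curvature forces \<open>tr A = 0\<close>.\<close>

lemma scalar_curvature_eq:
  assumes u: "u \<in> S"
  shows "(\<Sum>i\<in>UNIV. \<Sum>j\<in>UNIV. g_inv u $ i $ j * ricci S g i j u)
    = (2 - 2 * real CARD('n)) * trace (g_inv u ** h u)"
proof -
  have "(\<Sum>i\<in>UNIV. \<Sum>j\<in>UNIV. g_inv u $ i $ j * h u $ i $ j) = trace (g_inv u ** h u)"
    by (simp add: trace_matrix_mul h_commute[OF u])
  moreover have "(\<Sum>i\<in>UNIV. \<Sum>j\<in>UNIV. g_inv u $ i $ j * g u $ i $ j) = real CARD('n)"
    using g_inv_g[OF u] by (simp add: g_commute[OF u])
  moreover have "(\<Sum>i\<in>UNIV. \<Sum>j\<in>UNIV. g_inv u $ i $ j * ricci S g i j u)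
    = (2 - real CARD('n)) * (\<Sum>i\<in>UNIV. \<Sum>j\<in>UNIV. g_inv u $ i $ j * h u $ i $ j)
      - (\<Sum>i\<in>UNIV. \<Sum>j\<in>UNIV. g_inv u $ i $ j * g u $ i $ j) * trace (g_inv u ** h u)"
    by (simp add: ricci_eq[OF u] sum_distrib_left sum_distrib_right right_diff_distrib sum_subtractf mult_ac)
  ultimately show ?thesis by (simp add: algebra_simps)
qed

end

section \<open>The second variation of the volume density\<close>

text \<open>Links the time derivatives in the definitions of velocity and acceleration with
  \<open>dderiv\<close> in the direction \<open>(1, 0)\<close>. As \<open>I\<close> is open, the
  derivative within \<open>I\<close> is a full derivative.\<close>

lemma has_vector_derivative_time_slice:
  assumes acc: "axis_accessible (I \<times> S)" and I: "open I" "t \<in> I" and u: "u \<in> S" and f: "smooth_on (I \<times> S) f"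
  shows "((\<lambda>s. f (s, u)) has_vector_derivative dderiv (I \<times> S) (1, 0) f (t, u)) (at t)"
proof -
  have tu: "(t, u) \<in> I \<times> S" using I u by simp
  have lin: "linear (\<lambda>v. dderiv (I \<times> S) v f (t, u))"
    by (rule has_derivative_linear[OF smooth_on_has_derivative[OF f tu]])
  have "((\<lambda>s. (s, u)) has_derivative (\<lambda>d. (d, 0))) (at t within I)"
    by (auto intro!: derivative_eq_intros)
  moreover have "(f has_derivative (\<lambda>v. dderiv (I \<times> S) v f (t, u))) (at (t, u) within (\<lambda>s. (s, u)) ` I)"
    using u by (intro has_derivative_subset[OF smooth_on_has_derivative[OF f tu]]) auto
  ultimately have "((\<lambda>s. f (s, u)) has_derivative (\<lambda>d. dderiv (I \<times> S) (d, 0) f (t, u))) (at t within I)"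
    by (rule has_derivative_in_compose)
  moreover have "(\<lambda>d. dderiv (I \<times> S) (d, 0) f (t, u)) = (\<lambda>d. d *\<^sub>R dderiv (I \<times> S) (1, 0) f (t, u))"
  proof
    show "dderiv (I \<times> S) (d, 0) f (t, u) = d *\<^sub>R dderiv (I \<times> S) (1, 0) f (t, u)" for d
      using linear_scale[OF lin, of d "(1, 0)"]
      by (simp only: scaleR_Pair real_scaleR_def mult_1_right scaleR_zero_right)
  qed
  ultimately show ?thesis
    unfolding has_vector_derivative_def by (simp only: at_within_open[OF I(2,1)])
qed

text \<open>Here \<open>\<Phi>\<close> is the variation read in the chart, and
  \<open>\<phi>\<close>, \<open>\<psi>\<close> are bare functions whose smoothness is derived in
  \<open>smooth_\<phi>\<close>. Of the curvature assumption only its consequence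
  \<open>tr A = 0\<close> is recorded.\<close>

locale characteristic_patch = light_cone_patch S P Q g
  for S :: "(real ^ 'n::finite) set" and P Q :: "real ^ 'n \<Rightarrow> 's::finite minkowski" and g +
  fixes \<epsilon> :: real and \<Phi> :: "real \<times> (real ^ 'n) \<Rightarrow> 's minkowski" and \<phi> \<psi> :: "real ^ 'n \<Rightarrow> real"
  assumes \<epsilon>: "0 < \<epsilon>"
    and smooth_\<Phi>: "smooth_on ({-\<epsilon><..<\<epsilon>} \<times> S) \<Phi>"
    and initial: "\<And>u. u \<in> S \<Longrightarrow> \<Phi> (0, u) = P u"
    and velocity: "\<And>u. u \<in> S \<Longrightarrow> dderiv ({-\<epsilon><..<\<epsilon>} \<times> S) (1, 0) \<Phi> (0, u) = \<phi> u *\<^sub>R Q u"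
    and acceleration: "\<And>u. u \<in> S \<Longrightarrow>
      dderiv ({-\<epsilon><..<\<epsilon>} \<times> S) (1, 0) (dderiv ({-\<epsilon><..<\<epsilon>} \<times> S) (1, 0) \<Phi>) (0, u) = \<psi> u *\<^sub>R Q u"
    and spacelike_\<Phi>: "\<And>t u v. t \<in> {-\<epsilon><..<\<epsilon>} \<Longrightarrow> u \<in> S \<Longrightarrow> v \<noteq> 0 \<Longrightarrow>
      0 < lorentz (dderiv S v (\<lambda>w. \<Phi> (t, w)) u) (dderiv S v (\<lambda>w. \<Phi> (t, w)) u)"
    and trace_h: "\<And>u. u \<in> S \<Longrightarrow> trace (matrix_inv (g u) ** h u) = 0"
begin

abbreviation Z :: "(real \<times> (real ^ 'n)) set" where "Z \<equiv> {-\<epsilon><..<\<epsilon>} \<times> S"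

abbreviation T :: "(real \<times> (real ^ 'n) \<Rightarrow> 'b::real_normed_vector) \<Rightarrow> real \<times> (real ^ 'n) \<Rightarrow> 'b" where
  "T \<equiv> dderiv Z (1, 0)"

abbreviation X :: "'n \<Rightarrow> (real \<times> (real ^ 'n) \<Rightarrow> 'b::real_normed_vector) \<Rightarrow> real \<times> (real ^ 'n) \<Rightarrow> 'b" where
  "X i \<equiv> dderiv Z (0, axis i 1)"

definition metric :: "real \<times> (real ^ 'n) \<Rightarrow> real ^ 'n ^ 'n" where
  "metric z = (\<chi> i j. lorentz (X i \<Phi> z) (X j \<Phi> z))"

definition density :: "real \<times> (real ^ 'n) \<Rightarrow> real" where
  "density z = sqrt (det (metric z))"

lemma accZ: "axis_accessible Z"
  by (intro axis_accessible_Times acc axis_accessible_open) auto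

lemma Z0: "u \<in> S \<Longrightarrow> (0, u) \<in> Z"
  using \<epsilon> by simp

lemma smooth_TX: "smooth_on Z f \<Longrightarrow> smooth_on Z (T f)" "smooth_on Z f \<Longrightarrow> smooth_on Z (X i f)"
  by (rule smooth_on_dderiv[OF accZ], assumption)+

lemmas smooth_\<Phi>_intros = smooth_\<Phi> smooth_TX

lemma smooth_slice: "t \<in> {-\<epsilon><..<\<epsilon>} \<Longrightarrow> smooth_on Z f \<Longrightarrow> smooth_on S (\<lambda>w. f (t, w))"
  using smooth_on_affine[of "\<lambda>w. (0, w)" Z f S "(t, 0)"]
  by (simp add: bounded_linear_Pair bounded_linear_zero bounded_linear_ident)

lemma dderiv_slice:
  assumes "t \<in> {-\<epsilon><..<\<epsilon>}" "u \<in> S" "smooth_on Z f"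
  shows "dderiv S v (\<lambda>w. f (t, w)) u = dderiv Z (0, v) f (t, u)"
  using assms dderiv_affine[of "\<lambda>w. (0, w)" S Z u "(t, 0)" f v] smooth_on_differentiable[OF assms(3), of "(t, u)"]
  by (simp add: bounded_linear_Pair bounded_linear_zero bounded_linear_ident acc accZ)

lemma smooth_metric: "smooth_on Z (\<lambda>z. metric z $ i $ j)"
  by (simp add: metric_def smooth_on_lorentz smooth_\<Phi>_intros)

lemma metric_pos:
  assumes "t \<in> {-\<epsilon><..<\<epsilon>}" "u \<in> S" "v \<noteq> 0"
  shows "0 < v \<bullet> (metric (t, u) *v v)"
proof -
  let ?f = "\<lambda>w. \<Phi> (t, w)"
  have "dderiv S v ?f u = (\<Sum>i\<in>UNIV. (v $ i) *\<^sub>R D i ?f u)"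
    by (intro dderiv_component_expansion smooth_on_differentiable[OF _ assms(2)] smooth_slice[OF assms(1)] smooth_\<Phi>)
  then have "lorentz (dderiv S v ?f u) (dderiv S v ?f u) = v \<bullet> (metric (t, u) *v v)"
    by (simp add: dderiv_slice[OF assms(1,2) smooth_\<Phi>] metric_def lorentz.sum_left lorentz.sum_right lorentz.scaleR_left
        lorentz.scaleR_right inner_vec_def matrix_vector_mult_def sum_distrib_left mult_ac lorentz_commute)
  then show ?thesis using spacelike_\<Phi>[OF assms] by simp
qed

lemma metric_det_pos: "z \<in> Z \<Longrightarrow> 0 < det (metric z)"
  using pos_def_det_pos[OF metric_pos[of "fst z" "snd z"]] by (cases z) auto

lemma smooth_density: "smooth_on Z density"
  unfolding density_def[abs_def]
  by (intro smooth_on_sqrt smooth_on_det smooth_metric metric_det_pos)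

lemma DERIV_slice:
  fixes f :: "real \<times> (real ^ 'n) \<Rightarrow> real"
  assumes "t \<in> {-\<epsilon><..<\<epsilon>}" "u \<in> S" "smooth_on Z f"
  shows "((\<lambda>s. f (s, u)) has_real_derivative T f (t, u)) (at t)"
  using has_vector_derivative_time_slice[OF accZ _ assms(1,2,3)]
  by (simp add: has_real_derivative_iff_has_vector_derivative)

text \<open>Since \<open>P\<close> and \<open>Q\<close> have product \<open>1\<close>, pairing
  velocity and acceleration with \<open>P\<close> recovers the coefficients as products of smooth
  maps.\<close>

lemma smooth_\<phi>: "smooth_on S \<phi>" and smooth_\<psi>: "smooth_on S \<psi>"
proof -
  have 0: "0 \<in> {-\<epsilon><..<\<epsilon>}" using \<epsilon> by simp
  show "smooth_on S \<phi>"
    by (rule smooth_on_cong[OF smooth_on_lorentz[OF smooth_slice[OF 0 smooth_TX(1)[OF smooth_\<Phi>]] smooth_P]])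
      (simp add: velocity lorentz.scaleR_left lorentz_commute[of "Q _"] P_Q)
  show "smooth_on S \<psi>"
    by (rule smooth_on_cong[OF smooth_on_lorentz[OF smooth_slice[OF 0 smooth_TX(1)[OF smooth_TX(1)[OF smooth_\<Phi>]]] smooth_P]])
      (simp add: acceleration lorentz.scaleR_left lorentz_commute[of "Q _"] P_Q)
qed

lemma X_\<Phi>_initial:
  assumes u: "u \<in> S"
  shows "X i \<Phi> (0, u) = D i P u"
proof -
  have "X i \<Phi> (0, u) = D i (\<lambda>w. \<Phi> (0, w)) u"
    using \<epsilon> by (subst dderiv_slice[OF _ u smooth_\<Phi>]) simp_all
  also have "\<dots> = D i P u"
    using \<epsilon> by (intro dderiv_cong[OF acc u] initial smooth_on_differentiable[OF _ u] smooth_slice smooth_\<Phi>) auto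
  finally show ?thesis .
qed

lemma metric_initial: "u \<in> S \<Longrightarrow> metric (0, u) = g u"
  by (simp add: metric_def X_\<Phi>_initial g_eq vec_eq_iff)

text \<open>Stated for an arbitrary field along \<open>Q\<close>, because it is applied to the
  velocity with \<open>\<theta> = \<phi>\<close> and to the acceleration with
  \<open>\<theta> = \<psi>\<close>.\<close>

lemma X_normal:
  assumes u: "u \<in> S" and f: "smooth_on Z f" "\<And>w. w \<in> S \<Longrightarrow> f (0, w) = \<theta> w *\<^sub>R Q w" and \<theta>: "smooth_on S \<theta>"
  shows "X i f (0, u) = \<theta> u *\<^sub>R D i Q u + D i \<theta> u *\<^sub>R Q u"
proof -
  have "X i f (0, u) = D i (\<lambda>w. f (0, w)) u"
    using \<epsilon> by (subst dderiv_slice[OF _ u f(1)]) simp_all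
  also have "\<dots> = D i (\<lambda>w. \<theta> w *\<^sub>R Q w) u"
    using \<epsilon> by (intro dderiv_cong[OF acc u] f(2) smooth_on_differentiable[OF _ u] smooth_slice f(1)) auto
  also have "\<dots> = \<theta> u *\<^sub>R D i Q u + D i \<theta> u *\<^sub>R Q u"
    by (intro dderiv_scaleR acc u smooth_on_differentiable \<theta> smooth_Q)
  finally show ?thesis .
qed

lemma TX_\<Phi>: "z \<in> Z \<Longrightarrow> T (X i \<Phi>) z = X i (T \<Phi>) z"
  by (rule dderiv_commute[OF accZ smooth_\<Phi>])

lemma TX_\<Phi>_initial:
  assumes u: "u \<in> S"
  shows "T (X i \<Phi>) (0, u) = \<phi> u *\<^sub>R D i Q u + D i \<phi> u *\<^sub>R Q u"
  using X_normal[OF u smooth_TX(1)[OF smooth_\<Phi>] velocity smooth_\<phi>] by (simp only: TX_\<Phi>[OF Z0[OF u]])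

text \<open>The space derivative is moved outside past both time derivatives, where it meets the
  acceleration; each exchange is one application of symmetry.\<close>

lemma TTX_\<Phi>_initial:
  assumes u: "u \<in> S"
  shows "T (T (X i \<Phi>)) (0, u) = \<psi> u *\<^sub>R D i Q u + D i \<psi> u *\<^sub>R Q u"
proof -
  have "T (T (X i \<Phi>)) (0, u) = T (X i (T \<Phi>)) (0, u)"
    by (intro dderiv_cong[OF accZ Z0[OF u] TX_\<Phi>] smooth_on_differentiable[OF _ Z0[OF u]] smooth_\<Phi>_intros)
  also have "\<dots> = X i (T (T \<Phi>)) (0, u)"
    by (rule dderiv_commute[OF accZ smooth_TX(1)[OF smooth_\<Phi>] Z0[OF u]])
  also have "\<dots> = \<psi> u *\<^sub>R D i Q u + D i \<psi> u *\<^sub>R Q u"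
    by (rule X_normal[OF u smooth_TX(1)[OF smooth_TX(1)[OF smooth_\<Phi>]] acceleration smooth_\<psi>])
  finally show ?thesis .
qed

lemma T_metric:
  assumes "z \<in> Z"
  shows "T (\<lambda>z. metric z $ i $ j) z = lorentz (X i \<Phi> z) (T (X j \<Phi>) z) + lorentz (T (X i \<Phi>) z) (X j \<Phi> z)"
  unfolding metric_def vec_lambda_beta
  by (intro dderiv_lorentz accZ assms smooth_on_differentiable[OF _ assms] smooth_\<Phi>_intros)

lemma TT_metric:
  assumes z: "z \<in> Z"
  shows "T (T (\<lambda>z. metric z $ i $ j)) z = lorentz (X i \<Phi> z) (T (T (X j \<Phi>)) z)
    + 2 * lorentz (T (X i \<Phi>) z) (T (X j \<Phi>) z) + lorentz (T (T (X i \<Phi>)) z) (X j \<Phi> z)"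
proof -
  have "T (T (\<lambda>z. metric z $ i $ j)) z
      = T (\<lambda>z. lorentz (X i \<Phi> z) (T (X j \<Phi>) z) + lorentz (T (X i \<Phi>) z) (X j \<Phi> z)) z"
    by (intro dderiv_cong[OF accZ z T_metric] smooth_on_differentiable[OF _ z] smooth_\<Phi>_intros smooth_metric)
  also have "\<dots> = T (\<lambda>z. lorentz (X i \<Phi> z) (T (X j \<Phi>) z)) z + T (\<lambda>z. lorentz (T (X i \<Phi>) z) (X j \<Phi> z)) z"
    by (intro dderiv_add accZ z smooth_on_differentiable[OF _ z] smooth_on_lorentz smooth_\<Phi>_intros)
  also have "T (\<lambda>z. lorentz (X i \<Phi> z) (T (X j \<Phi>) z)) z
      = lorentz (X i \<Phi> z) (T (T (X j \<Phi>)) z) + lorentz (T (X i \<Phi>) z) (T (X j \<Phi>) z)"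
    by (intro dderiv_lorentz accZ z smooth_on_differentiable[OF _ z] smooth_\<Phi>_intros)
  also have "T (\<lambda>z. lorentz (T (X i \<Phi>) z) (X j \<Phi> z)) z
      = lorentz (T (X i \<Phi>) z) (T (X j \<Phi>) z) + lorentz (T (T (X i \<Phi>)) z) (X j \<Phi> z)"
    by (intro dderiv_lorentz accZ z smooth_on_differentiable[OF _ z] smooth_\<Phi>_intros)
  finally show ?thesis by simp
qed

text \<open>The derivative of \<open>\<phi>\<close> enters only as a multiple of \<open>Q\<close>,
  which is orthogonal to every \<open>D i P\<close>. What remains is twice the pairing of
  \<open>D i P\<close> with \<open>D j Q\<close>.\<close>

lemma T_metric_initial:
  assumes u: "u \<in> S"
  shows "T (\<lambda>z. metric z $ i $ j) (0, u) = - 2 * \<phi> u * h u $ i $ j"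
  using h_commute[OF u, of i j]
  by (simp add: T_metric[OF Z0[OF u]] X_\<Phi>_initial[OF u] TX_\<Phi>_initial[OF u] lorentz.add_left lorentz.add_right
      lorentz.scaleR_left lorentz.scaleR_right DP_Q[OF u] DP_DQ[OF u] lorentz_commute[of "D i Q u"] lorentz_commute[of "Q u"])

text \<open>The second derivatives of the frame contribute the term with \<open>\<psi>\<close>,
  exactly as \<open>\<phi>\<close> arose at first order. The product of two first derivatives
  reduces to \<open>DQ_DQ\<close>, since \<open>Q\<close> is null and orthogonal to its own
  derivatives.\<close>

lemma TT_metric_initial:
  assumes u: "u \<in> S"
  shows "T (T (\<lambda>z. metric z $ i $ j)) (0, u)
    = - 2 * \<psi> u * h u $ i $ j + 2 * (\<phi> u)\<^sup>2 * (h u ** g_inv u ** h u) $ i $ j"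
proof -
  have "lorentz (T (X i \<Phi>) (0, u)) (T (X j \<Phi>) (0, u)) = (\<phi> u)\<^sup>2 * (h u ** g_inv u ** h u) $ i $ j"
    by (simp add: TX_\<Phi>_initial[OF u] lorentz.add_left lorentz.add_right
      lorentz.scaleR_left lorentz.scaleR_right DQ_Q[OF u] Q_Q[OF u] DQ_DQ[OF u] lorentz_commute[of "Q u" "D _ Q u"] power2_eq_square)
  then show ?thesis
    using h_commute[OF u, of i j]
    by (simp add: TT_metric[OF Z0[OF u]] X_\<Phi>_initial[OF u] TTX_\<Phi>_initial[OF u] lorentz.add_left lorentz.add_right
      lorentz.scaleR_left lorentz.scaleR_right DP_Q[OF u] DP_DQ[OF u] lorentz_commute[of "D i Q u"] lorentz_commute[of "Q u"])
qed

theorem second_variation_density: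
  assumes u: "u \<in> S"
  shows "T (T density) (0, u)
    = - ((\<phi> u)\<^sup>2 * trace ((g_inv u ** h u) ** (g_inv u ** h u)) * density (0, u))"
proof -
  let ?I = "{-\<epsilon><..<\<epsilon>}"
  have 0: "0 \<in> ?I" using \<epsilon> by simp
  define M M' where "M s = metric (s, u)" and "M' s = (\<chi> i j. T (\<lambda>z. metric z $ i $ j) (s, u))" for s
  define M'' :: "real ^ 'n ^ 'n" where "M'' = (\<chi> i j. T (T (\<lambda>z. metric z $ i $ j)) (0, u))"
  define A where "A = g_inv u ** h u"
  have M: "((\<lambda>s. M s $ i $ j) has_real_derivative M' s $ i $ j) (at s)" if "s \<in> ?I" for s i j
    using DERIV_slice[OF that u smooth_metric[of i j]] by (simp add: M_def M'_def)
  have M': "((\<lambda>s. M' s $ i $ j) has_real_derivative M'' $ i $ j) (at 0)" for i j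
    using DERIV_slice[OF 0 u smooth_TX(1)[OF smooth_metric[of i j]]] by (simp add: M'_def M''_def)
  have pos: "0 < det (M s)" if "s \<in> ?I" for s
    using metric_det_pos[of "(s, u)"] that u by (simp add: M_def)
  \<comment> \<open>Two expressions for the same time derivative. Their equality for all times in
    the interval, and not just at \<open>0\<close>, is what allows the explicit one to be
    differentiated again.\<close>
  have "sqrt (det (M s)) * trace (matrix_inv (M s) ** M' s) / 2 = T density (s, u)" if "s \<in> ?I" for s
  proof (rule DERIV_unique)
    show "((\<lambda>s. density (s, u)) has_real_derivative sqrt (det (M s)) * trace (matrix_inv (M s) ** M' s) / 2) (at s)"
      using DERIV_sqrt_det[OF M[OF that] pos[OF that]] by (simp add: density_def M_def)
    show "((\<lambda>s. density (s, u)) has_real_derivative T density (s, u)) (at s)"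
      by (rule DERIV_slice[OF that u smooth_density])
  qed
  then have "((\<lambda>s. sqrt (det (M s)) * trace (matrix_inv (M s) ** M' s) / 2) has_real_derivative T (T density) (0, u)) (at 0)"
    using 0 by (intro has_field_derivative_transform_within_open[OF DERIV_slice[OF 0 u smooth_TX(1)[OF smooth_density]], of ?I]) auto
  moreover have "((\<lambda>s. sqrt (det (M s)) * trace (matrix_inv (M s) ** M' s) / 2) has_real_derivative
      sqrt (det (M 0)) * ((trace (matrix_inv (M 0) ** M' 0))\<^sup>2 / 4
        - trace ((matrix_inv (M 0) ** M' 0) ** (matrix_inv (M 0) ** M' 0)) / 2 + trace (matrix_inv (M 0) ** M'') / 2)) (at 0)"
    using 0 by (intro second_derivative_sqrt_det[where I = ?I] M M' pos) auto
  ultimately have TT: "T (T density) (0, u) = sqrt (det (M 0)) * ((trace (matrix_inv (M 0) ** M' 0))\<^sup>2 / 4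
        - trace ((matrix_inv (M 0) ** M' 0) ** (matrix_inv (M 0) ** M' 0)) / 2 + trace (matrix_inv (M 0) ** M'') / 2)"
    by (rule DERIV_unique)
  have M0: "M 0 = g u" by (simp add: M_def metric_initial[OF u])
  have "M' 0 = (- 2 * \<phi> u) *\<^sub>R h u"
    by (simp add: M'_def T_metric_initial[OF u] vec_eq_iff)
  then have B: "matrix_inv (M 0) ** M' 0 = (- 2 * \<phi> u) *\<^sub>R A"
    by (simp only: M0 A_def matrix_scalar_ac scalar_matrix_assoc[symmetric])
  have "M'' = (- 2 * \<psi> u) *\<^sub>R h u + (2 * (\<phi> u)\<^sup>2) *\<^sub>R (h u ** A)"
    by (simp add: M''_def TT_metric_initial[OF u] vec_eq_iff A_def matrix_mul_assoc)
  then have C: "matrix_inv (M 0) ** M'' = (- 2 * \<psi> u) *\<^sub>R A + (2 * (\<phi> u)\<^sup>2) *\<^sub>R (A ** A)"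
    by (simp only: M0 A_def matrix_add_ldistrib matrix_scalar_ac scalar_matrix_assoc[symmetric] matrix_mul_assoc)
  have tr: "trace (c *\<^sub>R Y) = c * trace Y" for c and Y :: "real ^ 'n ^ 'n"
    by (simp add: trace_def sum_distrib_left)
  have tr2: "trace ((c *\<^sub>R A) ** (c *\<^sub>R A)) = c * (c * trace (A ** A))" for c
    by (simp only: matrix_scalar_ac scalar_matrix_assoc[symmetric] tr)
  have "trace A = 0" using trace_h[OF u] by (simp add: A_def)
  \<comment> \<open>With \<open>tr A = 0\<close> the squared trace and the term with
    \<open>\<psi>\<close> disappear. The square of \<open>B\<close> contributes \<open>- 2\<close>
    and the second derivative of the metric \<open>+ 1\<close> times
    \<open>\<phi>\<^sup>2 tr (A\<^sup>2)\<close>.\<close>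
  then have "T (T density) (0, u) = sqrt (det (M 0)) * (- 2 * \<phi> u * (- 2 * \<phi> u * trace (A ** A)) * (- 1 / 2) + (\<phi> u)\<^sup>2 * trace (A ** A))"
    unfolding TT B C tr2 by (simp add: tr trace_add del: scaleR_minus_left)
  then show ?thesis
    by (simp add: density_def M_def[symmetric] A_def[symmetric] power2_eq_square algebra_simps)
qed

end

section \<open>Integration over a compact manifold\<close>

lemma set_integrable_continuous_compact:
  fixes f :: "'a::euclidean_space \<Rightarrow> real"
  assumes "compact K" "continuous_on K f"
  shows "set_integrable lborel K f"
  unfolding set_integrable_def by (rule borel_integrable_compact[OF assms])

text \<open>Uniform continuity of \<open>f'\<close> on a compact time interval times
  \<open>K\<close> makes the first-order remainder of \<open>f (s, u)\<close> small relative to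
  \<open>s - t\<close>, uniformly in \<open>u\<close>; this bound is then integrated over
  \<open>K\<close>.\<close>

lemma DERIV_set_integral_compact:
  fixes f f' :: "real \<times> 'a::euclidean_space \<Rightarrow> real"
  assumes K: "compact K" and I: "open I" "t \<in> I"
    and f: "continuous_on (I \<times> K) f" and f': "continuous_on (I \<times> K) f'"
    and D: "\<And>s u. s \<in> I \<Longrightarrow> u \<in> K \<Longrightarrow> ((\<lambda>s. f (s, u)) has_real_derivative f' (s, u)) (at s)"
  shows "((\<lambda>s. LINT u:K|lborel. f (s, u)) has_real_derivative (LINT u:K|lborel. f' (t, u))) (at t)"
  unfolding has_field_derivative_def has_derivative_at_alt
proof (intro conjI allI impI)
  show "bounded_linear ((*) (LINT u:K|lborel. f' (t, u)))"
    by (rule bounded_linear_mult_right)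
  fix e :: real assume e: "0 < e"
  obtain r where r: "0 < r" "cball t r \<subseteq> I" using I open_contains_cball by blast
  \<comment> \<open>The volume of \<open>K\<close> plus one: the extra unit keeps the divisor
    positive when \<open>K\<close> is a null set.\<close>
  define \<mu> where "\<mu> = (LINT u:K|lborel. 1) + (1 :: real)"
  have "0 \<le> (LINT u:K|lborel. (1 :: real))"
    unfolding set_lebesgue_integral_def by (intro Bochner_Integration.integral_nonneg) simp
  then have \<mu>: "0 < \<mu>" by (simp add: \<mu>_def)
  have "compact (cball t r \<times> K)" using K by (intro compact_Times) auto
  moreover have "continuous_on (cball t r \<times> K) f'"
    using r by (intro continuous_on_subset[OF f']) auto
  ultimately have "uniformly_continuous_on (cball t r \<times> K) f'"
    by (rule compact_uniformly_continuous[rotated])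
  then obtain d where d: "0 < d" "\<And>z z'. z \<in> cball t r \<times> K \<Longrightarrow> z' \<in> cball t r \<times> K \<Longrightarrow> dist z' z < d \<Longrightarrow> dist (f' z') (f' z) < e / \<mu>"
    unfolding uniformly_continuous_on_def using e \<mu> by (metis divide_pos_pos)
  have "norm ((LINT u:K|lborel. f (s, u)) - (LINT u:K|lborel. f (t, u)) - (LINT u:K|lborel. f' (t, u)) * (s - t)) \<le> e * norm (s - t)"
    if s: "norm (s - t) < min d r" for s
  proof -
    have sI: "s \<in> I" using s r by (auto simp: dist_norm norm_minus_commute)
    have slice: "set_integrable lborel K (\<lambda>u. G (x, u))" if "x \<in> I" "continuous_on (I \<times> K) G" for x and G :: "real \<times> 'a \<Rightarrow> real"
      using that by (intro set_integrable_continuous_compact[OF K] continuous_on_compose2[OF that(2)] continuous_intros) auto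
    note ints = slice[OF sI f] slice[OF I(2) f] set_integrable_mult_right[OF slice[OF I(2) f'], of "s - t"]
    have le: "\<bar>f (s, u) - f (t, u) - (s - t) * f' (t, u)\<bar> \<le> e / \<mu> * \<bar>s - t\<bar>" if u: "u \<in> K" for u
    proof -
      let ?B = "cball t (norm (s - t))"
      have B: "x \<in> I" "x \<in> cball t r" "dist (x, u) (t, u) < d" if "x \<in> ?B" for x
        using that s r by (auto simp: dist_Pair_Pair dist_commute dist_norm)
      \<comment> \<open>Subtracting the linear function of slope \<open>f' (t, u)\<close> leaves a
        function whose derivative is the small difference of values of \<open>f'\<close>, so the
        mean value estimate applies directly.\<close>
      have "norm ((f (s, u) - f' (t, u) * s) - (f (t, u) - f' (t, u) * t)) \<le> e / \<mu> * norm (s - t)"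
      proof (rule field_differentiable_bound[where S = ?B and f' = "\<lambda>x. f' (x, u) - f' (t, u)"])
        show "((\<lambda>x. f (x, u) - f' (t, u) * x) has_real_derivative f' (x, u) - f' (t, u)) (at x within ?B)" if "x \<in> ?B" for x
          using D[OF B(1)[OF that] u]
          by (auto intro!: derivative_eq_intros intro: has_field_derivative_at_within)
        show "norm (f' (x, u) - f' (t, u)) \<le> e / \<mu>" if "x \<in> ?B" for x
          using d(2)[of "(t, u)" "(x, u)"] B[OF that] r u by (simp add: dist_norm)
      qed (auto simp: dist_norm norm_minus_commute)
      then show ?thesis by (simp add: algebra_simps)
    qed
    have "(LINT u:K|lborel. f (s, u)) - (LINT u:K|lborel. f (t, u)) - (LINT u:K|lborel. f' (t, u)) * (s - t)
        = (LINT u:K|lborel. f (s, u) - f (t, u) - (s - t) * f' (t, u))"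
      using ints by (simp add: mult.commute)
    also have "\<bar>\<dots>\<bar> \<le> (LINT u:K|lborel. e / \<mu> * \<bar>s - t\<bar>)"
    proof (rule abs_leI)
      have c: "set_integrable lborel K (\<lambda>u. e / \<mu> * \<bar>s - t\<bar>)"
        by (intro set_integrable_continuous_compact K continuous_intros)
      note i = set_integral_diff(1)[OF set_integral_diff(1)[OF ints(1,2)] ints(3)]
      have i': "set_integrable lborel K (\<lambda>u. - (f (s, u) - f (t, u) - (s - t) * f' (t, u)))"
        using i unfolding set_integrable_def scaleR_minus_right by (rule integrable_minus)
      show "(LINT u:K|lborel. f (s, u) - f (t, u) - (s - t) * f' (t, u)) \<le> (LINT u:K|lborel. e / \<mu> * \<bar>s - t\<bar>)"
        by (rule set_integral_mono[OF i c]) (use le in \<open>auto simp: abs_le_iff\<close>)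
      have "(LINT u:K|lborel. - (f (s, u) - f (t, u) - (s - t) * f' (t, u))) \<le> (LINT u:K|lborel. e / \<mu> * \<bar>s - t\<bar>)"
        by (rule set_integral_mono[OF i' c]) (use le in \<open>auto simp: abs_le_iff\<close>)
      then show "- (LINT u:K|lborel. f (s, u) - f (t, u) - (s - t) * f' (t, u)) \<le> (LINT u:K|lborel. e / \<mu> * \<bar>s - t\<bar>)"
        by (simp add: set_integral_uminus[OF i, symmetric])
    qed
    also have "\<dots> = e / \<mu> * \<bar>s - t\<bar> * (\<mu> - 1)"
      using set_integral_mult_right[of lborel K "e / \<mu> * \<bar>s - t\<bar>" "\<lambda>_. 1"] by (simp add: \<mu>_def)
    also have "\<dots> \<le> e / \<mu> * \<bar>s - t\<bar> * \<mu>"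
      using e \<mu> by (intro mult_left_mono) auto
    also have "\<dots> = e * norm (s - t)" using \<mu> by simp
    finally show ?thesis by simp
  qed
  then show "\<exists>d>0. \<forall>s. norm (s - t) < d \<longrightarrow>
      norm ((LINT u:K|lborel. f (s, u)) - (LINT u:K|lborel. f (t, u)) - (LINT u:K|lborel. f' (t, u)) * (s - t)) \<le> e * norm (s - t)"
    using d(1) r(1) by (intro exI[of _ "min d r"]) auto
qed

section \<open>Partitions of unity and localisation of integrals\<close>

lemma partition_of_unity_exists:
  fixes M :: "'a topology" and \<A> :: "('a, 'n::finite) chart set"
  assumes M: "compact_space M" "Hausdorff_space M"
    and op: "\<And>c. c \<in> \<A> \<Longrightarrow> openin M (fst c)" and cover: "(\<Union>c\<in>\<A>. fst c) = topspace M"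
  shows "\<exists>C \<rho>. partition_of_unity M \<A> C \<rho>"
proof -
  have "normal_space M" using M compact_Hausdorff_or_regular_imp_normal_space by blast
  have "\<exists>c f. c \<in> \<A> \<and> continuous_map M euclideanreal f \<and> f x = 1 \<and> (\<forall>y\<in>topspace M - fst c. f y = 0)"
    if x: "x \<in> topspace M" for x
  proof -
    obtain c where c: "c \<in> \<A>" "x \<in> fst c" using cover x by blast
    have "closedin M {x}" by (rule closedin_Hausdorff_singleton[OF M(2) x])
    moreover have "closedin M (topspace M - fst c)" using op[OF c(1)] by blast
    moreover have "disjnt {x} (topspace M - fst c)" using c by (simp add: disjnt_def)
    ultimately obtain f where "continuous_map M euclideanreal f" "f ` {x} \<subseteq> {1}" "f ` (topspace M - fst c) \<subseteq> {0}"
      by (rule Urysohn_lemma_alt[OF \<open>normal_space M\<close>])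
    then show ?thesis using c by (intro exI[of _ c] exI[of _ f]) auto
  qed
  then obtain c f where c: "\<And>x. x \<in> topspace M \<Longrightarrow> c x \<in> \<A>"
    and f: "\<And>x. x \<in> topspace M \<Longrightarrow> continuous_map M euclideanreal (f x)" "\<And>x. x \<in> topspace M \<Longrightarrow> f x x = (1 :: real)"
    "\<And>x y. x \<in> topspace M \<Longrightarrow> y \<in> topspace M \<Longrightarrow> y \<notin> fst (c x) \<Longrightarrow> f x y = 0"
    by (metis DiffI)
  \<comment> \<open>A Urysohn function only vanishes outside the chart domain, and the closure of
    its nonzero set might leave that domain. Cutting it off at height \<open>1 / 2\<close> places
    the nonzero set inside the closed set where \<open>f x\<close> is at least \<open>1 / 2\<close>,
    which lies in the domain.\<close>
  define \<eta> where "\<eta> x y = max 0 (f x y - 1 / 2)" for x y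
  have \<eta>_cont: "continuous_map M euclideanreal (\<eta> x)" if "x \<in> topspace M" for x
    unfolding \<eta>_def[abs_def] using f(1)[OF that] by (intro continuous_intros) auto
  have \<eta>_nonneg: "0 \<le> \<eta> x y" for x y by (simp add: \<eta>_def)
  define W where "W x = {y \<in> topspace M. \<eta> x y \<in> {0<..}}" for x
  have "openin M (W x)" if "x \<in> topspace M" for x
    unfolding W_def by (rule openin_continuous_map_preimage[OF \<eta>_cont[OF that]]) simp
  moreover have "topspace M \<subseteq> \<Union> (W ` topspace M)"
    using f(2) by (auto simp: W_def \<eta>_def)
  ultimately have "\<exists>\<F>. finite \<F> \<and> \<F> \<subseteq> W ` topspace M \<and> topspace M \<subseteq> \<Union>\<F>"
    using M(1) unfolding compact_space_alt by (metis imageE)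
  then obtain X where X: "finite X" "X \<subseteq> topspace M" "topspace M \<subseteq> \<Union> (W ` X)"
    by (metis finite_subset_image)
  define s where "s y = (\<Sum>x\<in>X. \<eta> x y)" for y
  have s_pos: "0 < s y" if "y \<in> topspace M" for y
  proof -
    obtain x where "x \<in> X" "0 < \<eta> x y" using X(3) \<open>y \<in> topspace M\<close> by (auto simp: W_def)
    then show ?thesis unfolding s_def using X(1) \<eta>_nonneg by (intro sum_pos2) auto
  qed
  \<comment> \<open>Several points may have selected the same chart, while the partition is indexed
    by charts, so all bumps belonging to one chart are added up.\<close>
  define \<rho> where "\<rho> d y = (\<Sum>x\<in>{x \<in> X. c x = d}. \<eta> x y) / s y" for d y
  have "M closure_of {y \<in> topspace M. \<rho> d y \<noteq> 0} \<subseteq> fst d" for d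
  proof -
    let ?V = "\<Union>x\<in>{x \<in> X. c x = d}. {y \<in> topspace M. f x y \<in> {1/2..}}"
    have "closedin M {y \<in> topspace M. f x y \<in> {1/2..}}" if "x \<in> X" for x
      using f(1) X(2) that by (intro closedin_continuous_map_preimage[of M euclideanreal]) auto
    then have "closedin M ?V" using X(1) by (intro closedin_Union) auto
    moreover have "{y \<in> topspace M. \<rho> d y \<noteq> 0} \<subseteq> ?V"
    proof
      fix y assume "y \<in> {y \<in> topspace M. \<rho> d y \<noteq> 0}"
      then have "y \<in> topspace M" "(\<Sum>x\<in>{x \<in> X. c x = d}. \<eta> x y) \<noteq> 0" by (auto simp: \<rho>_def)
      then obtain x where "x \<in> {x \<in> X. c x = d}" "\<eta> x y \<noteq> 0" by (meson sum.not_neutral_contains_not_neutral)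
      then show "y \<in> ?V" using \<open>y \<in> topspace M\<close> by (auto simp: \<eta>_def max_def split: if_splits)
    qed
    ultimately have "M closure_of {y \<in> topspace M. \<rho> d y \<noteq> 0} \<subseteq> ?V" by (rule closure_of_minimal[rotated])
    also have "?V \<subseteq> fst d"
      using f(3) X(2) by force
    finally show ?thesis .
  qed
  moreover have "continuous_map M euclideanreal (\<rho> d)" for d
    unfolding \<rho>_def[abs_def] s_def using X \<eta>_cont s_pos
    by (intro continuous_map_real_divide continuous_map_sum) (force simp: s_def)+
  moreover have "0 \<le> \<rho> d y" if "y \<in> topspace M" for d y
    unfolding \<rho>_def using \<eta>_nonneg s_pos[OF that] by (intro divide_nonneg_pos sum_nonneg) auto
  moreover have "(\<Sum>d\<in>c ` X. \<rho> d y) = 1" if "y \<in> topspace M" for y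
  proof -
    have "(\<Sum>d\<in>c ` X. \<Sum>x\<in>{x \<in> X. c x = d}. \<eta> x y) = s y"
      unfolding s_def by (rule sum.image_gen[OF X(1), symmetric])
    then show ?thesis using s_pos[OF that] by (simp add: \<rho>_def sum_divide_distrib[symmetric])
  qed
  moreover have "c ` X \<subseteq> \<A>" "finite (c ` X)" using c X by auto
  ultimately have "partition_of_unity M \<A> (c ` X) \<rho>"
    unfolding partition_of_unity_def by blast
  then show ?thesis by blast
qed

text \<open>The selection behind \<open>integral_form\<close> does not mention the form, so one pair
  \<open>C\<close>, \<open>\<rho>\<close> serves all forms simultaneously. This order of quantifiers
  permits differentiation in time under a fixed partition.\<close>

lemma integral_formE:
  assumes "\<exists>C \<rho>. partition_of_unity M \<A> C \<rho>"
  obtains C \<rho> where "partition_of_unity M \<A> C \<rho>"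
    "\<And>\<omega>. integral_form M \<A> \<omega> = (\<Sum>c\<in>C. LINT u:chart_image c|lborel. \<rho> c (chart_inv c u) * \<omega> c u)"
proof -
  obtain C \<rho> where sel: "(SOME (C, \<rho>). partition_of_unity M \<A> C \<rho>) = (C, \<rho>)" by fastforce
  have "(case (SOME (C, \<rho>). partition_of_unity M \<A> C \<rho>) of (C, \<rho>) \<Rightarrow> partition_of_unity M \<A> C \<rho>)"
    using assms by (intro someI_ex[of "\<lambda>(C, \<rho>). partition_of_unity M \<A> C \<rho>"]) auto
  then have "partition_of_unity M \<A> C \<rho>" by (simp add: sel)
  then show thesis by (rule that) (simp add: integral_form_def sel)
qed

lemma chart_inv_continuous:
  assumes "is_chart M k c"
  shows "continuous_map (top_of_set (chart_image c)) M (chart_inv c)"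
    "\<And>u. u \<in> chart_image c \<Longrightarrow> chart_inv c u \<in> fst c" "\<And>u. u \<in> chart_image c \<Longrightarrow> chart_inv c u \<in> topspace M"
    "\<And>u. u \<in> chart_image c \<Longrightarrow> snd c (chart_inv c u) = u"
    "continuous_map (subtopology M (fst c)) (top_of_set (chart_image c)) (snd c)"
proof -
  have sub: "fst c \<subseteq> topspace M" using assms by (auto simp: is_chart_def dest: openin_subset)
  show fst: "chart_inv c u \<in> fst c" if "u \<in> chart_image c" for u
    using that by (simp add: chart_image_def chart_inv_def inv_into_into)
  with sub show "chart_inv c u \<in> topspace M" if "u \<in> chart_image c" for u
    using that by blast
  show snd: "snd c (chart_inv c u) = u" if "u \<in> chart_image c" for u
    using that by (simp add: chart_image_def chart_inv_def f_inv_into_f)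
  have "homeomorphic_map (subtopology M (fst c)) (top_of_set (chart_image c)) (snd c)"
    using assms by (simp add: is_chart_def)
  then obtain h where h: "homeomorphic_maps (subtopology M (fst c)) (top_of_set (chart_image c)) (snd c) h"
    using homeomorphic_map_maps by blast
  then show "continuous_map (subtopology M (fst c)) (top_of_set (chart_image c)) (snd c)"
    by (simp add: homeomorphic_maps_def)
  have "h u = chart_inv c u" if "u \<in> chart_image c" for u
    using h fst[OF that] snd[OF that] sub unfolding homeomorphic_maps_def
    by (metis (no_types, lifting) inf.absorb_iff2 topspace_subtopology)
  moreover have "continuous_map (top_of_set (chart_image c)) M h"
    using h by (simp add: homeomorphic_maps_def continuous_map_in_subtopology)
  ultimately show "continuous_map (top_of_set (chart_image c)) M (chart_inv c)"
    by (elim continuous_map_eq) simp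
qed

text \<open>A chart image need not be compact, but the weight lives on a closed subset of a compact
  space inside the chart domain, whose image is compact. Differentiation under the integral can then
  be carried out over \<open>K\<close>.\<close>

lemma partition_of_unity_chart_support:
  assumes M: "compact_space M" and c: "is_chart M k c" "c \<in> C" and \<rho>: "partition_of_unity M \<A> C \<rho>"
  obtains K where "compact K" "K \<subseteq> chart_image c" "continuous_on (chart_image c) (\<lambda>u. \<rho> c (chart_inv c u))"
    "\<And>\<omega>. (LINT u:chart_image c|lborel. \<rho> c (chart_inv c u) * \<omega> u) = (LINT u:K|lborel. \<rho> c (chart_inv c u) * \<omega> u)"
proof
  note inv = chart_inv_continuous[OF c(1)]
  let ?N = "M closure_of {x \<in> topspace M. \<rho> c x \<noteq> 0}"
  let ?K = "snd c ` ?N"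
  have N: "?N \<subseteq> fst c" and cont: "continuous_map M euclideanreal (\<rho> c)"
    using \<rho> c(2) by (auto simp: partition_of_unity_def)
  have "compactin M ?N" by (rule closedin_compact_space[OF M]) simp
  then have "compactin (subtopology M (fst c)) ?N"
    using N by (simp add: compactin_subtopology)
  from image_compactin[OF this inv(5)] show "compact ?K"
    by (simp add: compactin_subtopology)
  show K: "?K \<subseteq> chart_image c" using N by (auto simp: chart_image_def)
  show "continuous_on (chart_image c) (\<lambda>u. \<rho> c (chart_inv c u))"
    using continuous_map_compose[OF inv(1) cont] by (simp add: o_def)
  have "\<rho> c (chart_inv c u) = 0" if u: "u \<in> chart_image c" "u \<notin> ?K" for u
  proof (rule ccontr)
    assume "\<rho> c (chart_inv c u) \<noteq> 0"
    then have "chart_inv c u \<in> ?N"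
      using inv(3)[OF u(1)] closure_of_subset[of "{x \<in> topspace M. \<rho> c x \<noteq> 0}" M] by blast
    then have "snd c (chart_inv c u) \<in> ?K" by (rule imageI)
    then show False using inv(4)[OF u(1)] u(2) by simp
  qed
  then show "(LINT u:chart_image c|lborel. \<rho> c (chart_inv c u) * \<omega> u) = (LINT u:?K|lborel. \<rho> c (chart_inv c u) * \<omega> u)" for \<omega>
    unfolding set_lebesgue_integral_def using K
    by (intro Bochner_Integration.integral_cong refl) (auto simp: indicator_def)
qed

section \<open>The second variation of the volume\<close>

lemma differential_eq_dderiv: "differential c f u v = dderiv (chart_image c) v (f \<circ> chart_inv c) u"
  by (simp add: differential_def dderiv_def)

context light_cone_patch
begin

text \<open>The existence and uniqueness of the normal part come from the frame expansion and from the
  tangent space being spacelike.\<close>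

lemma normal_part_Q:
  assumes u: "u \<in> S"
  shows "lorentz (normal_part (range (\<lambda>v. dderiv S v P u)) w) (Q u) = lorentz w (Q u)"
proof -
  let ?T = "range (\<lambda>v. dderiv S v P u)"
  let ?tan = "\<Sum>l\<in>UNIV. tangent_coord u w l *\<^sub>R D l P u"
  let ?nor = "lorentz w (Q u) *\<^sub>R P u + lorentz w (P u) *\<^sub>R Q u"
  note lin = has_derivative_linear[OF smooth_on_has_derivative[OF smooth_P u]]
  have tan: "?tan = dderiv S (\<chi> l. tangent_coord u w l) P u"
    unfolding dP_expansion[OF u, of "\<chi> l. tangent_coord u w l"] by simp
  have orth: "lorentz z (P u) = 0" "lorentz z (Q u) = 0" if z: "z \<in> ?T" for z
  proof -
    obtain v where v: "z = dderiv S v P u" using z by blast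
    then show "lorentz z (Q u) = 0" by (simp add: dP_Q[OF u])
    show "lorentz z (P u) = 0"
      unfolding v dP_expansion[OF u, of v] by (simp add: lorentz.sum_left lorentz.scaleR_left DP_P[OF u])
  qed
  define a where "a = (\<chi> l. tangent_coord u w l)"
  define \<nu>\<^sub>0 where "\<nu>\<^sub>0 = w - dderiv S a P u"
  have \<nu>\<^sub>0: "lorentz \<nu>\<^sub>0 z = 0" if "z \<in> ?T" for z
  proof -
    have "\<nu>\<^sub>0 = ?nor"
      using frame_expansion[OF u, of w] unfolding \<nu>\<^sub>0_def a_def tan[symmetric] by (simp add: algebra_simps)
    then show ?thesis
      using orth[OF that] by (simp add: lorentz.add_right lorentz.scaleR_right lorentz_commute[of _ z])
  qed
  have "\<exists>!\<nu>. (\<forall>z\<in>?T. lorentz \<nu> z = 0) \<and> w - \<nu> \<in> ?T"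
  proof (rule ex1I[of _ \<nu>\<^sub>0])
    show "(\<forall>z\<in>?T. lorentz \<nu>\<^sub>0 z = 0) \<and> w - \<nu>\<^sub>0 \<in> ?T"
      using \<nu>\<^sub>0 by (simp add: \<nu>\<^sub>0_def)
    fix \<nu> assume \<nu>: "(\<forall>z\<in>?T. lorentz \<nu> z = 0) \<and> w - \<nu> \<in> ?T"
    then obtain v where v: "w - \<nu> = dderiv S v P u" by blast
    \<comment> \<open>The difference of two candidates is both tangent and orthogonal to all tangent
      vectors, hence has square zero; spacelikeness makes it vanish.\<close>
    have eq: "\<nu>\<^sub>0 - \<nu> = dderiv S (v - a) P u"
      unfolding linear_diff[OF lin] v[symmetric] \<nu>\<^sub>0_def by simp
    then have "lorentz \<nu>\<^sub>0 (\<nu>\<^sub>0 - \<nu>) = 0" "lorentz \<nu> (\<nu>\<^sub>0 - \<nu>) = 0"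
      using \<nu> \<nu>\<^sub>0 by blast+
    then have "lorentz (\<nu>\<^sub>0 - \<nu>) (\<nu>\<^sub>0 - \<nu>) = 0" by (simp add: lorentz.diff_left)
    then have "v - a = 0"
      using spacelike[OF u, of "v - a"] unfolding eq by force
    then have "dderiv S (v - a) P u = 0" using linear_0[OF lin] by simp
    then show "\<nu> = \<nu>\<^sub>0" using eq by simp
  qed
  from theI'[OF this] have "w - normal_part ?T w \<in> ?T" by (simp add: normal_part_def)
  from orth(2)[OF this] show ?thesis by (simp add: lorentz.diff_left)
qed

text \<open>Pairing the image of \<open>axis i 1\<close> with \<open>D j P\<close> produces the
  entry \<open>(j, i)\<close> of \<open>g u ** B\<close>; symmetry of \<open>h\<close> removes the
  transposition, and the metric is inverted.\<close>

lemma shape_operator_matrix: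
  assumes u: "u \<in> S"
    and B: "\<And>i j. lorentz (dderiv S (B *v axis i 1) P u) (D j P u) = h u $ i $ j"
  shows "B = g_inv u ** h u"
proof -
  have "(g u ** B) $ j $ i = h u $ j $ i" for i j
  proof -
    have "(g u ** B) $ j $ i = (\<Sum>l\<in>UNIV. (B *v axis i 1) $ l * lorentz (D l P u) (D j P u))"
      by (simp add: matrix_vector_mult_basis column_def matrix_matrix_mult_def g_eq[OF u] lorentz_commute mult.commute)
    also have "\<dots> = lorentz (dderiv S (B *v axis i 1) P u) (D j P u)"
      unfolding dP_expansion[OF u, of "B *v axis i 1"] by (simp add: lorentz.sum_left lorentz.scaleR_left)
    finally show ?thesis using B h_commute[OF u] by simp
  qed
  then have "g u ** B = h u" by (simp add: vec_eq_iff)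
  then have "g_inv u ** (g u ** B) = g_inv u ** h u" by simp
  then show ?thesis by (simp add: matrix_mul_assoc matrix_inv_left_det[OF g_det[OF u]])
qed

end

text \<open>Packages the geometry of one chart for the integration argument: a density with two
  continuous time derivatives, and the value and sign of the second one at time
  \<open>0\<close>.\<close>

lemma volume_density_in_chart:
  fixes M :: "'a topology"
    and k :: "'n::finite"
    and \<A> :: "('a, 'n) chart set"
    and g :: "('a, 'n) metric_components"
    and p q :: "'a \<Rightarrow> 's::finite minkowski"
    and A :: "('a, 'n) chart \<Rightarrow> real ^ 'n \<Rightarrow> real ^ 'n ^ 'n"
    and \<epsilon> :: real
    and F :: "real \<Rightarrow> 'a \<Rightarrow> 's minkowski"
  assumes dim: "CARD('n) \<ge> 2" "CARD('s) = CARD('n) + 1"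
    and chart: "c \<in> \<A>" "is_chart M k c"
    and iso: "isometric_immersion_light_cone M \<A> g p"
    and dual: "dual_map M \<A> p q"
    and shape: "shape_operator \<A> p q A"
    and var: "variation M \<A> p \<epsilon> F"
    and char: "characteristic M q F"
    and scal: "\<forall>u\<in>chart_image c. scalar_curvature g c u = 0"
  defines "S \<equiv> chart_image c" and "I \<equiv> {-\<epsilon><..<\<epsilon>}"
    and "W \<equiv> \<lambda>u. (lorentz (variational_field F (chart_inv c u)) (p (chart_inv c u)))\<^sup>2
            * trace (A c u ** A c u) * volume_form (induced_metric (F 0)) c u"
  obtains V V' V'' where "continuous_on (I \<times> S) V" "continuous_on (I \<times> S) V'" "continuous_on (I \<times> S) V''"
    "\<And>t u. t \<in> I \<Longrightarrow> u \<in> S \<Longrightarrow> volume_form (induced_metric (F t)) c u = V (t, u)"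
    "\<And>t u. t \<in> I \<Longrightarrow> u \<in> S \<Longrightarrow> ((\<lambda>s. V (s, u)) has_real_derivative V' (t, u)) (at t)"
    "\<And>t u. t \<in> I \<Longrightarrow> u \<in> S \<Longrightarrow> ((\<lambda>s. V' (s, u)) has_real_derivative V'' (t, u)) (at t)"
    "\<And>u. u \<in> S \<Longrightarrow> V'' (0, u) = - W u" "\<And>u. u \<in> S \<Longrightarrow> 0 \<le> W u"
proof -
  define P Q where "P = p \<circ> chart_inv c" and "Q = q \<circ> chart_inv c"
  define \<Phi> where "\<Phi> = (\<lambda>(t, u). F t (chart_inv c u))"
  note inv = chart_inv_continuous[OF chart(2), folded S_def]
  have \<epsilon>: "0 < \<epsilon>" using var by (simp add: variation_def)
  then have I: "open I" "0 \<in> I" by (simp_all add: I_def)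
  have acc: "axis_accessible S"
    using chart(2) unfolding is_chart_def S_def by (blast intro: axis_accessible_relatively_open_half_space)
  have accZ: "axis_accessible (I \<times> S)"
    by (intro axis_accessible_Times acc axis_accessible_open I)
  have smooth_P: "smooth_on S P"
    using iso chart(1) by (auto simp: isometric_immersion_light_cone_def immersion_def smooth_map_def P_def S_def)
  have smooth_Q: "smooth_on S Q"
    using dual chart(1) by (auto simp: dual_map_def smooth_map_def Q_def S_def)
  have smooth_\<Phi>: "smooth_on (I \<times> S) \<Phi>"
    using var chart(1) by (auto simp: variation_def \<Phi>_def I_def S_def)
  have initial: "\<Phi> (0, u) = P u" if "u \<in> S" for u
    using var inv(3)[OF that] by (simp add: variation_def \<Phi>_def P_def)
  have slice: "F t \<circ> chart_inv c = (\<lambda>w. \<Phi> (t, w))" for t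
    by (simp add: \<Phi>_def fun_eq_iff)
  have spacelike_\<Phi>: "0 < lorentz (dderiv S v (\<lambda>w. \<Phi> (t, w)) u) (dderiv S v (\<lambda>w. \<Phi> (t, w)) u)"
    if "t \<in> I" "u \<in> S" "v \<noteq> 0" for t u v
    using var that chart(1)
    by (auto simp: variation_def spacelike_immersion_def differential_eq_dderiv slice[symmetric] S_def I_def)
  have smooth_\<Phi>0: "smooth_on S (\<lambda>w. \<Phi> (0, w))"
    by (rule smooth_on_cong[OF smooth_P]) (simp add: initial)
  have patch: "light_cone_patch S P Q (g c)"
  proof
    fix u assume u: "u \<in> S"
    have x: "chart_inv c u \<in> topspace M" by (rule inv(3)[OF u])
    show "lorentz (P u) (P u) = 0"
      using iso x by (auto simp: isometric_immersion_light_cone_def light_cone_def P_def)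
    show "lorentz (Q u) (Q u) = 0" "lorentz (P u) (Q u) = 1"
      using dual x by (auto simp: dual_map_def light_cone_def P_def Q_def)
    show "lorentz (dderiv S v P u) (Q u) = 0" for v
      using dual chart(1) u by (simp add: dual_map_def differential_eq_dderiv P_def Q_def S_def)
    show "g c u $ i $ j = lorentz (dderiv S (axis i 1) P u) (dderiv S (axis j 1) P u)" for i j
    proof -
      have "g c u = induced_metric p c u"
        using iso chart(1) u by (simp add: isometric_immersion_light_cone_def S_def)
      then show ?thesis by (simp add: induced_metric_def differential_eq_dderiv P_def S_def)
    qed
    \<comment> \<open>Spacelikeness of the tangent spaces of \<open>p\<close> is read off from the
      variation at time \<open>0\<close>, whose slice agrees with \<open>P\<close> on
      \<open>S\<close>.\<close>
    have "dderiv S v (\<lambda>w. \<Phi> (0, w)) u = dderiv S v P u" for v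
      by (rule dderiv_cong[OF acc u initial smooth_on_differentiable[OF smooth_\<Phi>0 u]])
    then show "0 < lorentz (dderiv S v P u) (dderiv S v P u)" if "v \<noteq> 0" for v
      using spacelike_\<Phi>[OF I(2) u that] by simp
  qed (use acc smooth_P smooth_Q dim in auto)
  interpret light_cone_patch S P Q "g c" by (rule patch)
  let ?T = "dderiv (I \<times> S) (1, 0)"
  have field: "extended_variational_field F t (chart_inv c u) = ?T \<Phi> (t, u)" if "t \<in> I" "u \<in> S" for t u
    using vector_derivative_at[OF has_vector_derivative_time_slice[OF accZ I(1) that smooth_\<Phi>]]
    by (simp add: extended_variational_field_def \<Phi>_def)
  have acceleration: "variational_acceleration F (chart_inv c u) = ?T (?T \<Phi>) (0, u)" if u: "u \<in> S" for u
  proof -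
    note smT = smooth_on_dderiv[OF accZ smooth_\<Phi>]
    have "((\<lambda>t. extended_variational_field F t (chart_inv c u)) has_vector_derivative ?T (?T \<Phi>) (0, u)) (at 0)"
      by (rule has_vector_derivative_transform_within_open[OF has_vector_derivative_time_slice[OF accZ I u smT] I])
        (simp add: field[OF _ u])
    then show ?thesis by (simp add: variational_acceleration_def vector_derivative_at)
  qed
  obtain \<phi> \<psi> where \<phi>: "\<forall>x\<in>topspace M. variational_field F x = \<phi> x *\<^sub>R q x"
    and \<psi>: "\<forall>x\<in>topspace M. variational_acceleration F x = \<psi> x *\<^sub>R q x"
    using char unfolding characteristic_def admissible_def by blast
  have trace_h: "trace (g_inv u ** h u) = 0" if u: "u \<in> S" for u
  proof -
    have "(2 - 2 * real CARD('n)) * trace (g_inv u ** h u) = 0"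
      using scal u scalar_curvature_eq[OF u] by (simp add: scalar_curvature_def S_def)
    then show ?thesis using dim(1) by auto
  qed
  have "characteristic_patch S P Q (g c) \<epsilon> \<Phi> (\<phi> \<circ> chart_inv c) (\<psi> \<circ> chart_inv c)"
  proof (unfold_locales, fold I_def)
    show "?T \<Phi> (0, u) = (\<phi> \<circ> chart_inv c) u *\<^sub>R Q u" if "u \<in> S" for u
      using \<phi> inv(3)[OF that] field[OF I(2) that] by (simp add: variational_field_def Q_def)
    show "?T (?T \<Phi>) (0, u) = (\<psi> \<circ> chart_inv c) u *\<^sub>R Q u" if "u \<in> S" for u
      using \<psi> inv(3)[OF that] acceleration[OF that] by (simp add: Q_def)
  qed (use \<epsilon> smooth_\<Phi> initial spacelike_\<Phi> trace_h in auto)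
  then interpret characteristic_patch S P Q "g c" \<epsilon> \<Phi> "\<phi> \<circ> chart_inv c" "\<psi> \<circ> chart_inv c" .
  have vol: "volume_form (induced_metric (F t)) c u = density (t, u)" if "t \<in> I" "u \<in> S" for t u
  proof -
    have "induced_metric (F t) c u = metric (t, u)"
      using that by (simp add: induced_metric_def metric_def differential_eq_dderiv slice
          S_def[symmetric] dderiv_slice[OF _ _ smooth_\<Phi>] I_def)
    then show ?thesis by (simp add: volume_form_def density_def)
  qed
  have A: "A c u = g_inv u ** h u" if u: "u \<in> S" for u
  proof (rule shape_operator_matrix[OF u])
    fix i j
    \<comment> \<open>The defining identity holds for all smooth fields; the constant coordinate
      fields already determine the matrix.\<close>
    have "lorentz (differential c p u (A c u *v axis i 1)) (differential c p u (axis j 1))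
        = lorentz (second_fundamental_form c p (\<lambda>_. axis i 1) (\<lambda>_. axis j 1) u) (q (chart_inv c u))"
      using shape chart(1) u smooth_on_const unfolding shape_operator_def S_def by blast
    moreover have "second_fundamental_form c p (\<lambda>_. axis i 1) (\<lambda>_. axis j 1) u
        = normal_part (range (\<lambda>v. dderiv S v P u)) (D i (D j P) u)"
      by (simp add: second_fundamental_form_def differential_eq_dderiv dderiv_def[abs_def] P_def S_def)
    moreover have "h u $ i $ j = lorentz (D i (D j P) u) (q (chart_inv c u))"
      unfolding h_def by (simp add: Q_def)
    ultimately show "lorentz (dderiv S (A c u *v axis i 1) P u) (D j P u) = h u $ i $ j"
      using normal_part_Q[OF u] by (simp add: differential_eq_dderiv P_def Q_def S_def)
  qed
  have W: "W u = ((\<phi> \<circ> chart_inv c) u)\<^sup>2 * trace ((g_inv u ** h u) ** (g_inv u ** h u)) * density (0, u)"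
    if u: "u \<in> S" for u
  proof -
    have "lorentz (variational_field F (chart_inv c u)) (p (chart_inv c u)) = (\<phi> \<circ> chart_inv c) u"
      using \<phi> inv(3)[OF u] P_Q[OF u] by (simp add: lorentz.scaleR_left P_def Q_def lorentz_commute[of "q _"])
    then show ?thesis by (simp add: W_def A[OF u] vol[OF I(2) u])
  qed
  note smT = smooth_TX(1)[OF smooth_density]
  show thesis
  proof (rule that[of density "T density" "T (T density)"])
    show "continuous_on (I \<times> S) density" "continuous_on (I \<times> S) (T density)" "continuous_on (I \<times> S) (T (T density))"
      unfolding I_def using smooth_on_imp_continuous_on[OF smooth_density] smooth_on_imp_continuous_on[OF smT]
        smooth_on_imp_continuous_on[OF smooth_TX(1)[OF smT]] by auto
    show "((\<lambda>s. density (s, u)) has_real_derivative T density (t, u)) (at t)"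
      "((\<lambda>s. T density (s, u)) has_real_derivative T (T density) (t, u)) (at t)" if "t \<in> I" "u \<in> S" for t u
      using DERIV_slice[OF _ that(2) smooth_density, of t] DERIV_slice[OF _ that(2) smT, of t] that(1)
      by (simp_all add: I_def)
    show "T (T density) (0, u) = - W u" if "u \<in> S" for u
      using second_variation_density[OF that] W[OF that] by simp
    show "0 \<le> W u" if u: "u \<in> S" for u
    proof -
      have "0 \<le> trace ((g_inv u ** h u) ** (g_inv u ** h u))"
        by (rule trace_square_nonneg[OF transpose_g[OF u] g_pos[OF u] transpose_h[OF u]])
      moreover have "0 \<le> density (0, u)"
        using metric_det_pos[OF Z0[OF u]] by (simp add: density_def)
      ultimately show ?thesis by (simp add: W[OF u])
    qed
  qed (rule vol)
qed

text \<open>\<open>deriv\<close> is total and says nothing where no derivative exists, so the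
  conclusion states differentiability of the volume on the whole interval along with the second
  derivative at \<open>0\<close>.\<close>

theorem proposition2p8:
  fixes M :: "'a topology"
    and k :: "'n::finite"
    and \<A> :: "('a, 'n) chart set"
    and g :: "('a, 'n) metric_components"
    and p q :: "'a \<Rightarrow> 's::finite minkowski"
    and A :: "('a, 'n) chart \<Rightarrow> real ^ 'n \<Rightarrow> real ^ 'n ^ 'n"
    and \<epsilon> :: real
    and F :: "real \<Rightarrow> 'a \<Rightarrow> 's minkowski"
  assumes "CARD('n) \<ge> 2"
    and "CARD('s) = CARD('n) + 1"
    and "oriented_manifold_with_boundary M k \<A>"
    and "compact_space M"
    and "riemannian_metric \<A> g"
    and "conformally_flat \<A> g"
    and "isometric_immersion_light_cone M \<A> g p"
    and "dual_map M \<A> p q"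
    and "shape_operator \<A> p q A"
    and "variation M \<A> p \<epsilon> F"
    and "fixed_boundary k \<A> p \<epsilon> F"
    and "characteristic M q F"
    and "\<forall>c\<in>\<A>. \<forall>u\<in>chart_image c. scalar_curvature g c u = 0"
  shows "let I = integral_form M \<A> (\<lambda>c u.
            (lorentz (variational_field F (chart_inv c u)) (p (chart_inv c u)))\<^sup>2
            * trace (A c u ** A c u) * volume_form (induced_metric (F 0)) c u)
         in (\<forall>t\<in>{-\<epsilon><..<\<epsilon>}. Vol M \<A> F differentiable (at t)) \<and>
            (deriv (Vol M \<A> F) has_real_derivative - I) (at 0) \<and>
            - I \<le> 0"
proof -
  define W where "W c u = (lorentz (variational_field F (chart_inv c u)) (p (chart_inv c u)))\<^sup>2
            * trace (A c u ** A c u) * volume_form (induced_metric (F 0)) c u" for c :: "('a, 'n) chart" and u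
  define I where "I = {-\<epsilon><..<\<epsilon>}"
  have I: "open I" "0 \<in> I" using assms(10) by (simp_all add: I_def variation_def)
  have atlas: "\<And>c. c \<in> \<A> \<Longrightarrow> is_chart M k c" "(\<Union>c\<in>\<A>. fst c) = topspace M" and haus: "Hausdorff_space M"
    using assms(3) by (auto simp: oriented_manifold_with_boundary_def oriented_atlas_def)
  have "\<exists>C \<rho>. partition_of_unity M \<A> C \<rho>"
    using atlas by (intro partition_of_unity_exists[OF assms(4) haus]) (auto simp: is_chart_def)
  then obtain C \<rho> where \<rho>: "partition_of_unity M \<A> C \<rho>"
    and int: "\<And>\<omega>. integral_form M \<A> \<omega> = (\<Sum>c\<in>C. LINT u:chart_image c|lborel. \<rho> c (chart_inv c u) * \<omega> c u)"
    by (rule integral_formE) blast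
  have C: "finite C" "C \<subseteq> \<A>" using \<rho> by (auto simp: partition_of_unity_def)
  define J where "J c \<omega> = (LINT u:chart_image c|lborel. \<rho> c (chart_inv c u) * \<omega> u)" for c \<omega>
  have "\<exists>V' V'' :: real \<times> (real ^ 'n) \<Rightarrow> real. (\<forall>t\<in>I. ((\<lambda>s. J c (volume_form (induced_metric (F s)) c)) has_real_derivative J c (\<lambda>u. V' (t, u))) (at t)) \<and>
      ((\<lambda>s. J c (\<lambda>u. V' (s, u))) has_real_derivative J c (\<lambda>u. V'' (0, u))) (at 0) \<and>
      J c (\<lambda>u. V'' (0, u)) = - J c (W c) \<and> 0 \<le> J c (W c)" if c: "c \<in> C" for c
  proof -
    have cA: "c \<in> \<A>" using c C by blast
    let ?S = "chart_image c"
    obtain V V' V'' where cont: "continuous_on (I \<times> ?S) V" "continuous_on (I \<times> ?S) V'" "continuous_on (I \<times> ?S) V''"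
      and V: "\<And>t u. t \<in> I \<Longrightarrow> u \<in> ?S \<Longrightarrow> volume_form (induced_metric (F t)) c u = V (t, u)"
      and D: "\<And>t u. t \<in> I \<Longrightarrow> u \<in> ?S \<Longrightarrow> ((\<lambda>s. V (s, u)) has_real_derivative V' (t, u)) (at t)"
        "\<And>t u. t \<in> I \<Longrightarrow> u \<in> ?S \<Longrightarrow> ((\<lambda>s. V' (s, u)) has_real_derivative V'' (t, u)) (at t)"
      and W: "\<And>u. u \<in> ?S \<Longrightarrow> V'' (0, u) = - W c u" "\<And>u. u \<in> ?S \<Longrightarrow> 0 \<le> W c u"
      unfolding I_def W_def
      by (rule volume_density_in_chart[OF assms(1,2) cA atlas(1)[OF cA] assms(7-10,12) bspec[OF assms(13) cA]]) blast
    obtain K where K: "compact K" "K \<subseteq> ?S" "continuous_on ?S (\<lambda>u. \<rho> c (chart_inv c u))"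
      and JK: "\<And>\<omega>. J c \<omega> = (LINT u:K|lborel. \<rho> c (chart_inv c u) * \<omega> u)"
      unfolding J_def by (rule partition_of_unity_chart_support[OF assms(4) atlas(1)[OF cA] c \<rho>]) blast
    \<comment> \<open>The set integral carries the indicator of the chart image, so agreement of the
      integrands there is enough.\<close>
    have J_cong: "J c \<omega> = J c \<omega>'" if "\<And>u. u \<in> ?S \<Longrightarrow> \<omega> u = \<omega>' u" for \<omega> \<omega>'
      unfolding J_def set_lebesgue_integral_def using that
      by (intro Bochner_Integration.integral_cong refl) (auto simp: indicator_def)
    have J_deriv: "((\<lambda>s. J c (\<lambda>u. f (s, u))) has_real_derivative J c (\<lambda>u. f' (t, u))) (at t)"
      if "t \<in> I" "continuous_on (I \<times> ?S) f" "continuous_on (I \<times> ?S) f'"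
        "\<And>t u. t \<in> I \<Longrightarrow> u \<in> ?S \<Longrightarrow> ((\<lambda>s. f (s, u)) has_real_derivative f' (t, u)) (at t)" for t f f'
    proof -
      have w: "continuous_on (I \<times> K) (\<lambda>z. \<rho> c (chart_inv c (snd z)))"
        using K(2) by (intro continuous_on_compose2[OF K(3)] continuous_intros) auto
      have "I \<times> K \<subseteq> I \<times> ?S" using K(2) by auto
      note sub = continuous_on_subset[OF _ this]
      have "((\<lambda>s. LINT u:K|lborel. (\<lambda>z. \<rho> c (chart_inv c (snd z)) * f z) (s, u)) has_real_derivative
          (LINT u:K|lborel. (\<lambda>z. \<rho> c (chart_inv c (snd z)) * f' z) (t, u))) (at t)"
        by (rule DERIV_set_integral_compact[OF K(1) I(1) that(1)])
          (use w sub[OF that(2)] sub[OF that(3)] that(4) K(2) in \<open>auto intro!: continuous_on_mult DERIV_cmult\<close>)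
      then show ?thesis by (simp add: JK)
    qed
    have d1: "((\<lambda>s. J c (volume_form (induced_metric (F s)) c)) has_real_derivative J c (\<lambda>u. V' (t, u))) (at t)" if t: "t \<in> I" for t
      by (rule has_field_derivative_transform_within_open[OF J_deriv[OF t cont(1,2)] I(1) t])
        (auto intro: D(1) intro!: J_cong V[symmetric])
    have d2: "((\<lambda>s. J c (\<lambda>u. V' (s, u))) has_real_derivative J c (\<lambda>u. V'' (0, u))) (at 0)"
      by (rule J_deriv[OF I(2) cont(2,3)]) (rule D(2))
    have j1: "J c (\<lambda>u. V'' (0, u)) = - J c (W c)"
    proof -
      have "J c (\<lambda>u. V'' (0, u)) = J c (\<lambda>u. - W c u)" by (rule J_cong) (rule W(1))
      then show ?thesis by (simp add: J_def set_lebesgue_integral_def)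
    qed
    have j2: "0 \<le> J c (W c)"
      unfolding J_def set_lebesgue_integral_def
    proof (rule Bochner_Integration.integral_nonneg)
      fix u :: "real ^ 'n"
      show "0 \<le> indicator ?S u *\<^sub>R (\<rho> c (chart_inv c u) * W c u)"
      proof (cases "u \<in> ?S")
        case True
        then have "0 \<le> \<rho> c (chart_inv c u)"
          using chart_inv_continuous(3)[OF atlas(1)[OF cA]] \<rho> c by (auto simp: partition_of_unity_def)
        then show ?thesis using W(2)[OF True] by simp
      qed simp
    qed
    show ?thesis
      by (rule exI[of _ V'], rule exI[of _ V'']) (intro conjI ballI d1 d2 j1 j2)
  qed
  then obtain V' V'' :: "_ \<Rightarrow> real \<times> (real ^ 'n) \<Rightarrow> real" where D1: "\<And>c t. c \<in> C \<Longrightarrow> t \<in> I \<Longrightarrow>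
        ((\<lambda>s. J c (volume_form (induced_metric (F s)) c)) has_real_derivative J c (\<lambda>u. V' c (t, u))) (at t)"
    and D2: "\<And>c. c \<in> C \<Longrightarrow> ((\<lambda>s. J c (\<lambda>u. V' c (s, u))) has_real_derivative J c (\<lambda>u. V'' c (0, u))) (at 0)"
    and JW: "\<And>c. c \<in> C \<Longrightarrow> J c (\<lambda>u. V'' c (0, u)) = - J c (W c)" "\<And>c. c \<in> C \<Longrightarrow> 0 \<le> J c (W c)"
    by metis
  have Vol: "Vol M \<A> F = (\<lambda>t. \<Sum>c\<in>C. J c (volume_form (induced_metric (F t)) c))"
    by (simp add: Vol_def int J_def fun_eq_iff)
  have dVol: "(Vol M \<A> F has_real_derivative (\<Sum>c\<in>C. J c (\<lambda>u. V' c (t, u)))) (at t)" if "t \<in> I" for t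
    unfolding Vol by (intro DERIV_sum D1 that)
  have "((\<lambda>t. \<Sum>c\<in>C. J c (\<lambda>u. V' c (t, u))) has_real_derivative (\<Sum>c\<in>C. J c (\<lambda>u. V'' c (0, u)))) (at 0)"
    by (intro DERIV_sum D2)
  \<comment> \<open>The explicit first derivative is available on all of \<open>I\<close>, a
    neighbourhood of \<open>0\<close>, so it may replace \<open>deriv\<close> before the second
    differentiation.\<close>
  then have "(deriv (Vol M \<A> F) has_real_derivative (\<Sum>c\<in>C. J c (\<lambda>u. V'' c (0, u)))) (at 0)"
    by (rule has_field_derivative_transform_within_open[OF _ I]) (simp add: DERIV_imp_deriv[OF dVol])
  moreover have "(\<Sum>c\<in>C. J c (\<lambda>u. V'' c (0, u))) = - integral_form M \<A> W"
    by (simp add: JW(1) int J_def[symmetric] sum_negf)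
  moreover have "0 \<le> integral_form M \<A> W"
    using JW(2) by (simp add: int J_def[symmetric] sum_nonneg)
  moreover have "Vol M \<A> F differentiable (at t)" if "t \<in> {-\<epsilon><..<\<epsilon>}" for t
    using dVol[of t] that by (auto simp: I_def real_differentiable_def)
  moreover have "integral_form M \<A> (\<lambda>c u.
            (lorentz (variational_field F (chart_inv c u)) (p (chart_inv c u)))\<^sup>2
            * trace (A c u ** A c u) * volume_form (induced_metric (F 0)) c u) = integral_form M \<A> W"
    by (simp add: W_def[abs_def])
  ultimately show ?thesis by (simp add: Let_def)
qed

end
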